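(* Let $(\mathcal X,\mathcal B)$ be the measurable space, $\pi_\circ'$ the probability distribution on it with density $\phi$ with respect to $\tau$, and $P_1,\dots,P_5$ the transition probability functions defined in the context. Let $p_1,\dots,p_5>0$ with $\sum_{j=1}^5p_j=1$, and let $P(x,dy)=\sum_{j=1}^5p_jP_j(x,dy)$. Then: (1) $P$ satisfies detailed balance with respect to $\pi_\circ'$, i.e. $\int_A P(x,B)\,\pi_\circ'(dx)=\int_B P(x,A)\,\pi_\circ'(dx)$ for all $A,B\in\mathcal B$. (2) $P$ satisfies the conditions of the Athreya–Doss–Sethuraman ergodic theorem, namely: $\pi_\circ'$ is an invariant probability measure of $P$, and there exist a set $A\in\mathcal B$, a probability measure $\lambda$ on $(\mathcal X,\mathcal B)$ with $\lambda(A)=1$, a constant $\epsilon>0$ and an integer $n_0\ge1$ such that $\pi_\circ'(\{x:P_x(X_m\in A\text{ for some }m\ge1)>0\})=1$; $P^{n_0}(x,\cdot)\ge\epsilon\lambda(\cdot)$ for each $x\in A$; and either $n_0=1$ or $\gcd\{m:\text{there is }\epsilon_m>0\text{ with }P^m(x,\cdot)\ge\epsilon_m\lambda(\cdot)\text{ for each }x\in A\}=1$. (3) $\pi_\circ'$ is the unique invariant distribution of $P$. (4) There is a set $D\in\mathcal B$ with $\pi_\circ'(D)=1$ such that $\sup_{C\in\mathcal B}|P^n(x,C)-\pi_\circ'(C)|\to0$ as $n\to\infty$ for each $x\in D$. (5) If $f$ is a measurable function on $(\mathcal X,\mathcal B)$ with $\int\pi_\circ'(dy)|f(y)|<\infty$,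 then for $\pi_\circ'$-almost all $x$, $P_x\{\frac1n\sum_{j=1}^nf(X_j)\to\int\pi_\circ'(dy)f(y)\}=1$.
   Context: $P_x$ denotes the law of the Markov chain $X_0,X_1,\dots$ with transition function $P$ started at $X_0=x$; $P^n$ is the $n$-step transition function. State space. $\mathcal X=\bigcup_{k\ge1}\mathcal X_k$, with $\mathcal X_k=\{(k,\mathbf v):\mathbf v\in[0,1]^{k-1}\}$ for $k\ge2$, and $\mathcal X_1=\{x_0\}$ a singleton, $x_0=(1,\emptyset)$ (empty list). $\mathcal B$ is the $\sigma$-algebra generated by $\mathcal X_1$ and the sets $\{k\}\times B$, $k\ge2$, $B\subset[0,1]^{k-1}$ Borel. $\tau$ is the measure on $\mathcal B$ with $\tau(\mathcal X_1)=1$ and $\tau(\{k\}\times B)=$ $(k-1)$-dimensional Lebesgue measure of $B$. Target. Fix data $(x_1,y_1),\dots,(x_n,y_n)\in[0,1]\times\{0,1\}$ and a probability distribution $\kappa$ on $\mathbb N=\{1,2,\dots\}$ with $\kappa(k)>0$ for all $k$. For $(k,\mathbf v)$ with $k\ge2$ let $\mathbf v_{(1)}\le\dots\le\mathbf v_{(k-1)}$ be the ordered values and $I_1=[0,\mathbf v_{(1)})$, $I_i=[\mathbf v_{(i-1)},\mathbf v_{(i)})$ for $2\le i\le k-1$, $I_k=[\mathbf v_{(k-1)},1]$; for $k=1$, $I_1=[0,1]$. Let $N^1_j(\mathbf v)$, $N^0_j(\mathbf v)$ be the numbers of data points with $x_i\in I_j$ and $y_i=1$, respectively $y_i=0$.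 Put $\rho_k(\mathbf v)=\prod_{j=1}^k\frac{N^1_j(\mathbf v)!\,N^0_j(\mathbf v)!}{(N^1_j(\mathbf v)+N^0_j(\mathbf v)+1)!}$, $\rho_k=\int_{[0,1]^{k-1}}\rho_k(\mathbf v)\,d\mathbf v$ for $k\ge2$, $\rho_1=\rho_1(\emptyset)$, $c=\sum_{k\ge1}\kappa(k)\rho_k$, and $\phi((k,\mathbf v))=\kappa(k)\rho_k(\mathbf v)/c$. Then $\pi_\circ'(dx)=\phi(x)\tau(dx)$. (This is the posterior distribution of the number of steps and of the change-points, for the prior with $K\sim\kappa$ and i.i.d. uniform change-points and step heights.) Component chains. Given a proposal transition function $\widetilde P_j$ and acceptance function $\alpha_j$, let $Q_j(x,dy)=\alpha_j(x,y)\widetilde P_j(x,dy)$ and $P_j(x,dy)=Q_j(x,dy)+[1-Q_j(x,\mathcal X)]\delta_x(dy)$. For $j=1,2,3,5$, $\alpha_j(x,y)=\min(1,\phi(y)/\phi(x))$. - $\widetilde P_1(x,\cdot)=\frac12\lambda^x_\uparrow+\frac12\lambda^x_\downarrow$. Here $\lambda^x_\uparrow$ is the law of the point obtained from $x=(k,\mathbf v)$ by appending to $\mathbf v$ a last coordinate $U$ uniform on $[0,1]$ (giving a point of $\mathcal X_{k+1}$), and $\lambda^x_\downarrow$ is the Dirac measure at the point obtained by deleting the last coordinate of $\mathbf v$ (giving a point of $\mathcal X_{k-1}$), with $\lambda^{x_0}_\downarrow=\delta_{x_0}$. - $\widetilde P_2(x,\cdot)=\lambda^x_\cdot$, where for $x\in\mathcal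 X_k$, $k\ge2$, $\lambda^x_\cdot=\frac1{k-1}\sum_{i=1}^{k-1}\lambda^x_{\cdot i}$ and $\lambda^x_{\cdot i}$ is the law of the point obtained by replacing the $i$-th coordinate of $\mathbf v$ by a uniform random variable on $[0,1]$; $\lambda^{x_0}_\cdot=\delta_{x_0}$. - $\widetilde P_3(x,dy)=\Psi(x,y)\lambda^x_\cdot(dy)+h_\Psi(x)\delta_x(dy)$, where $\Psi$ is any measurable non-negative function on $\mathcal X\times\mathcal X$ with $\Psi(x,y)=\Psi(y,x)$ for all $x,y$ and, for $x\in\mathcal X_k$, $\int_{\mathcal X_k}\Psi(x,y)\lambda^x_\cdot(dy)+h_\Psi(x)=1$ for some non-negative $h_\Psi(x)$. (Example: for $x=(k,\mathbf v_x)$, $y=(k,\mathbf v_y)$, $\Psi(x,y)=\phi_\sigma(\|\mathbf v_x-\mathbf v_y\|_2)$ with $\phi_\sigma$ the centred univariate normal density with standard deviation $\sigma>0$.) - $\widetilde P_4(x,dy)=\xi_x(y)\tau(dy)$, where $(x,y)\mapsto\xi_x(y)$ is measurable and $\xi_x$ is a probability density with respect to $\tau$ for each $x$; $\alpha_4(x,y)=\min\bigl(1,\frac{\phi(y)\xi_y(x)}{\phi(x)\xi_x(y)}\bigr)$ if $\phi(x)\xi_x(y)>0$ and $\alpha_4(x,y)=1$ otherwise. (Example: $\xi_x(y)=\mathbf 1\{y\in\mathcal X_k\}$ for $x\in\mathcal X_k$.) - $\widetilde P_5$: for $x\in\mathcal X_k$, $\widetilde P_5(x,\cdot)$ is the composition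 of the $k-1$ transition probability functions $\widetilde P_5^{\,i}$ applied sequentially from $i=1$ to $i=k-1$ (so $\widetilde P_5(x_0,\cdot)=\delta_{x_0}$), where $\widetilde P_5^{\,i}(x,dy)=\Psi(x,y)\lambda^x_{\cdot i}(dy)+h_\Psi(x)\delta_x(dy)$ for some $\Psi$ and $h_\Psi$ satisfying the same constraints as for $\widetilde P_3$: $\Psi$ is a measurable non-negative function on $\mathcal X\times\mathcal X$ with $\Psi(x,y)=\Psi(y,x)$ for all $x,y$, and $h_\Psi\ge0$ (which here may depend on $i$) is such that the total mass $\int_{\mathcal X_k}\Psi(x,y)\lambda^x_{\cdot i}(dy)+h_\Psi(x)$ equals $1$.
   Formalization: Added assumption: for τ-almost every x, composing the kernels P̃_5^i in the order 1,…,k−1 gives the same law as in the order k−1,…,1. Without it detailed balance (1) can fail for P_5; it is exactly the condition under which (1) holds, and the Gaussian example of Ψ satisfies it. *)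

theory Defs
  imports "HOL-Probability.Probability"
begin

text \<open>A transition function on a measurable space \<open>S\<close> is a map \<open>K :: 'a \<Rightarrow> 'a measure\<close>;
  \<open>K x\<close> is the measure \<open>K(x, dy)\<close>. Only its values at points of \<open>space S\<close> matter.\<close>

definition mixture :: "'a measure \<Rightarrow> (ennreal \<times> 'a measure) list \<Rightarrow> 'a measure" where
  "mixture S cs = measure_of (space S) (sets S) (\<lambda>A. \<Sum>(c, M)\<leftarrow>cs. c * emeasure M A)"

primrec kernel_power :: "'a measure \<Rightarrow> ('a \<Rightarrow> 'a measure) \<Rightarrow> nat \<Rightarrow> 'a \<Rightarrow> 'a measure" where
  "kernel_power S K 0 x = return S x"
| "kernel_power S K (Suc n) x = kernel_power S K n x \<bind> K"

primrec kernel_seq :: "'a measure \<Rightarrow> ('a \<Rightarrow> 'a measure) list \<Rightarrow> 'a \<Rightarrow> 'a measure" where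
  "kernel_seq S [] x = return S x"
| "kernel_seq S (K # Ks) x = K x \<bind> kernel_seq S Ks"

text \<open>The law \<open>P\<^sub>x\<close> on the sequence space of the chain with transition function \<open>K\<close> started at \<open>x\<close>,
  obtained from the Ionescu-Tulcea theorem: \<open>X\<^sub>0\<close> has law \<open>\<delta>\<^sub>x\<close>, and given \<open>X\<^sub>0, \<dots>, X\<^sub>n\<close> the law of
  \<open>X\<^sub>n\<^sub>+\<^sub>1\<close> is \<open>K X\<^sub>n\<close>.\<close>

definition chain_step ::
    "'a measure \<Rightarrow> ('a \<Rightarrow> 'a measure) \<Rightarrow> 'a \<Rightarrow> nat \<Rightarrow> (nat \<Rightarrow> 'a) \<Rightarrow> 'a measure" where
  "chain_step S K x n \<omega> = (case n of 0 \<Rightarrow> return S x | Suc m \<Rightarrow> K (\<omega> m))"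

definition chain_law :: "'a measure \<Rightarrow> ('a \<Rightarrow> 'a measure) \<Rightarrow> 'a \<Rightarrow> (nat \<Rightarrow> 'a) measure" where
  "chain_law S K x =
     projective_family.lim UNIV (Ionescu_Tulcea.CI (chain_step S K x) (\<lambda>_. S)) (\<lambda>_. S)"

definition detailed_balance :: "'a measure \<Rightarrow> ('a \<Rightarrow> 'a measure) \<Rightarrow> 'a measure \<Rightarrow> bool" where
  "detailed_balance S K \<mu> \<longleftrightarrow> (\<forall>A\<in>sets S. \<forall>B\<in>sets S.
     (\<integral>\<^sup>+x\<in>A. emeasure (K x) B \<partial>\<mu>) = (\<integral>\<^sup>+x\<in>B. emeasure (K x) A \<partial>\<mu>))"

definition invariant_distribution :: "'a measure \<Rightarrow> ('a \<Rightarrow> 'a measure) \<Rightarrow> 'a measure \<Rightarrow> bool" where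
  "invariant_distribution S K \<mu> \<longleftrightarrow> sets \<mu> = sets S \<and> prob_space \<mu> \<and>
     (\<forall>B\<in>sets S. (\<integral>\<^sup>+x. emeasure (K x) B \<partial>\<mu>) = emeasure \<mu> B)"

definition minorized ::
    "'a measure \<Rightarrow> ('a \<Rightarrow> 'a measure) \<Rightarrow> 'a set \<Rightarrow> real \<Rightarrow> 'a measure \<Rightarrow> bool" where
  "minorized S K A \<epsilon> \<nu> \<longleftrightarrow> (\<forall>x\<in>A. \<forall>C\<in>sets S. emeasure (K x) C \<ge> ennreal \<epsilon> * emeasure \<nu> C)"

definition ADS_conditions :: "'a measure \<Rightarrow> ('a \<Rightarrow> 'a measure) \<Rightarrow> 'a measure \<Rightarrow> bool" where
  "ADS_conditions S K \<mu> \<longleftrightarrow>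
     invariant_distribution S K \<mu> \<and>
     (\<exists>A \<nu> \<epsilon> n\<^sub>0.
        A \<in> sets S \<and>
        sets \<nu> = sets S \<and> prob_space \<nu> \<and> emeasure \<nu> A = 1 \<and>
        \<epsilon> > 0 \<and> n\<^sub>0 \<ge> (1::nat) \<and>
        emeasure \<mu> {x \<in> space S. \<P>(\<omega> in chain_law S K x. \<exists>m\<ge>1. \<omega> m \<in> A) > 0} = 1 \<and>
        minorized S (kernel_power S K n\<^sub>0) A \<epsilon> \<nu> \<and>
        (n\<^sub>0 = 1 \<or> Gcd {m. m \<ge> 1 \<and> (\<exists>e>0. minorized S (kernel_power S K m) A e \<nu>)} = 1))"

definition accept_reject ::
    "'a measure \<Rightarrow> ('a \<Rightarrow> 'a \<Rightarrow> real) \<Rightarrow> ('a \<Rightarrow> 'a measure) \<Rightarrow> 'a \<Rightarrow> 'a measure" where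
  "accept_reject S \<alpha> K x =
     (let Q = density (K x) (\<lambda>y. ennreal (\<alpha> x y))
      in mixture S [(1, Q), (1 - emeasure Q (space S), return S x)])"

text \<open>A point \<open>(k, v)\<close> is a pair whose second component is an extensional function on
  \<open>{1..<k}\<close>, i.e. a vector \<open>(v 1, \<dots>, v (k - 1))\<close>; for \<open>k = 1\<close> this is the single function
  \<open>\<lambda>_. undefined\<close>, the empty vector.\<close>

type_synonym state = "nat \<times> (nat \<Rightarrow> real)"

abbreviation unit_leb :: "real measure" where
  "unit_leb \<equiv> restrict_space lborel {0..1}"

definition cube :: "nat \<Rightarrow> (nat \<Rightarrow> real) measure" where
  "cube k = PiM {1..<k} (\<lambda>_. unit_leb)"

definition layer :: "nat \<Rightarrow> state set" where
  "layer k = {k} \<times> space (cube k)"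

definition x\<^sub>0 :: state where
  "x\<^sub>0 = (1, \<lambda>_. undefined)"

definition SX :: "state measure" where
  "SX = sigma (\<Union>k\<in>{1..}. layer k) (insert (layer 1) {{k} \<times> B |k B. k \<ge> 2 \<and> B \<in> sets (cube k)})"

definition tau :: "state measure" where
  "tau = measure_of (space SX) (sets SX) (\<lambda>A. \<Sum>k. emeasure (cube (Suc k)) {v. (Suc k, v) \<in> A})"

type_synonym data = "(real \<times> nat) list"

definition order_stat :: "nat \<Rightarrow> (nat \<Rightarrow> real) \<Rightarrow> nat \<Rightarrow> real" where
  "order_stat k v i = sort (map v [1..<k]) ! (i - 1)"

definition cell :: "nat \<Rightarrow> (nat \<Rightarrow> real) \<Rightarrow> nat \<Rightarrow> real set" where
  "cell k v j =
     (if k = 1 then {0..1}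
      else if j = 1 then {0..<order_stat k v 1}
      else if j < k then {order_stat k v (j - 1)..<order_stat k v j}
      else {order_stat k v (k - 1)..1})"

definition count_cell :: "data \<Rightarrow> nat \<Rightarrow> nat \<Rightarrow> (nat \<Rightarrow> real) \<Rightarrow> nat \<Rightarrow> nat" where
  "count_cell D b k v j = length (filter (\<lambda>(x, y). x \<in> cell k v j \<and> y = b) D)"

definition rho :: "data \<Rightarrow> nat \<Rightarrow> (nat \<Rightarrow> real) \<Rightarrow> real" where
  "rho D k v = (\<Prod>j=1..k. fact (count_cell D 1 k v j) * fact (count_cell D 0 k v j)
                          / fact (count_cell D 1 k v j + count_cell D 0 k v j + 1))"

definition rho_total :: "data \<Rightarrow> nat \<Rightarrow> real" where
  "rho_total D k = (if k = 1 then rho D 1 (snd x\<^sub>0) else (LINT v|cube k. rho D k v))"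

definition norm_const :: "data \<Rightarrow> nat pmf \<Rightarrow> real" where
  "norm_const D \<kappa> = (\<Sum>k. pmf \<kappa> (Suc k) * rho_total D (Suc k))"

definition phi :: "data \<Rightarrow> nat pmf \<Rightarrow> state \<Rightarrow> real" where
  "phi D \<kappa> = (\<lambda>(k, v). pmf \<kappa> k * rho D k v / norm_const D \<kappa>)"

definition post :: "data \<Rightarrow> nat pmf \<Rightarrow> state measure" where
  "post D \<kappa> = density tau (\<lambda>x. ennreal (phi D \<kappa> x))"

definition law_up :: "state \<Rightarrow> state measure" where
  "law_up = (\<lambda>(k, v). distr unit_leb SX (\<lambda>u. (k + 1, v(k := u))))"

definition law_down :: "state \<Rightarrow> state measure" where
  "law_down = (\<lambda>(k, v). return SX (if k = 1 then (k, v) else (k - 1, v(k - 1 := undefined))))"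

definition law_coord :: "nat \<Rightarrow> state \<Rightarrow> state measure" where
  "law_coord i = (\<lambda>(k, v). distr unit_leb SX (\<lambda>u. (k, v(i := u))))"

definition law_any :: "state \<Rightarrow> state measure" where
  "law_any x =
     (if fst x = 1 then return SX x
      else mixture SX (map (\<lambda>i. (1 / of_nat (fst x - 1), law_coord i x)) [1..<fst x]))"

definition sym_weight :: "(state \<Rightarrow> state \<Rightarrow> real) \<Rightarrow> bool" where
  "sym_weight \<Psi> \<longleftrightarrow> case_prod \<Psi> \<in> borel_measurable (SX \<Otimes>\<^sub>M SX) \<and>
     (\<forall>x\<in>space SX. \<forall>y\<in>space SX. \<Psi> x y \<ge> 0 \<and> \<Psi> x y = \<Psi> y x)"

definition unit_mass ::
    "(state \<Rightarrow> state \<Rightarrow> real) \<Rightarrow> (state \<Rightarrow> real) \<Rightarrow> (state \<Rightarrow> state measure) \<Rightarrow> state \<Rightarrow> bool" where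
  "unit_mass \<Psi> h L x \<longleftrightarrow>
     h x \<ge> 0 \<and> (\<integral>\<^sup>+y\<in>layer (fst x). ennreal (\<Psi> x y) \<partial>L x) + ennreal (h x) = 1"

definition weighted ::
    "(state \<Rightarrow> state \<Rightarrow> real) \<Rightarrow> (state \<Rightarrow> real) \<Rightarrow> (state \<Rightarrow> state measure) \<Rightarrow> state \<Rightarrow> state measure"
  where
  "weighted \<Psi> h L x =
     mixture SX [(1, density (L x) (\<lambda>y. ennreal (\<Psi> x y))), (ennreal (h x), return SX x)]"

definition prop1 :: "state \<Rightarrow> state measure" where
  "prop1 x = mixture SX [(1/2, law_up x), (1/2, law_down x)]"

definition prop4 :: "(state \<Rightarrow> state \<Rightarrow> real) \<Rightarrow> state \<Rightarrow> state measure" where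
  "prop4 \<xi> x = density tau (\<lambda>y. ennreal (\<xi> x y))"

text \<open>The \<open>i\<close>-th coordinate only exists on layers \<open>k > i\<close>; the kernel is extended by the identity
  so that it is a transition function on the whole space. The sweep below never leaves the layer
  it starts in, so the extension plays no role in it.\<close>

definition prop5_coord ::
    "(state \<Rightarrow> state \<Rightarrow> real) \<Rightarrow> (nat \<Rightarrow> state \<Rightarrow> real) \<Rightarrow> nat \<Rightarrow> state \<Rightarrow> state measure" where
  "prop5_coord \<Psi> h i x =
     (if i \<in> {1..<fst x} then weighted \<Psi> (h i) (law_coord i) x else return SX x)"

definition prop5 ::
    "(state \<Rightarrow> state \<Rightarrow> real) \<Rightarrow> (nat \<Rightarrow> state \<Rightarrow> real) \<Rightarrow> state \<Rightarrow> state measure" where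
  "prop5 \<Psi> h x = kernel_seq SX (map (prop5_coord \<Psi> h) [1..<fst x]) x"

definition prop5_reversed ::
    "(state \<Rightarrow> state \<Rightarrow> real) \<Rightarrow> (nat \<Rightarrow> state \<Rightarrow> real) \<Rightarrow> state \<Rightarrow> state measure" where
  "prop5_reversed \<Psi> h x = kernel_seq SX (map (prop5_coord \<Psi> h) (rev [1..<fst x])) x"

definition alpha_ratio :: "data \<Rightarrow> nat pmf \<Rightarrow> state \<Rightarrow> state \<Rightarrow> real" where
  "alpha_ratio D \<kappa> x y = min 1 (phi D \<kappa> y / phi D \<kappa> x)"

definition alpha4 :: "data \<Rightarrow> nat pmf \<Rightarrow> (state \<Rightarrow> state \<Rightarrow> real) \<Rightarrow> state \<Rightarrow> state \<Rightarrow> real" where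
  "alpha4 D \<kappa> \<xi> x y =
     (if phi D \<kappa> x * \<xi> x y > 0 then min 1 (phi D \<kappa> y * \<xi> y x / (phi D \<kappa> x * \<xi> x y)) else 1)"

lemma sets_mixture [simp]: "sets (mixture S cs) = sets S"
  and space_mixture [simp]: "space (mixture S cs) = space S"
  by (simp_all add: mixture_def sets.sigma_sets_eq sets.space_closed)

lemma emeasure_mixture:
  assumes "\<And>c M. (c, M) \<in> set cs \<Longrightarrow> sets M = sets S" and A: "A \<in> sets S"
  shows "emeasure (mixture S cs) A = (\<Sum>(c, M)\<leftarrow>cs. c * emeasure M A)"
proof -
  have "countably_additive (sets S) (\<lambda>A. \<Sum>(c, M)\<leftarrow>cs. c * emeasure M A)"
    unfolding countably_additive_def
  proof safe
    fix F :: "nat \<Rightarrow> 'a set"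
    assume F: "range F \<subseteq> sets S" "disjoint_family F"
    show "(\<Sum>i. \<Sum>(c, M)\<leftarrow>cs. c * emeasure M (F i)) = (\<Sum>(c, M)\<leftarrow>cs. c * emeasure M (\<Union> (range F)))"
      using assms(1)
    proof (induction cs)
      case (Cons a cs)
      obtain c M where a: "a = (c, M)" by force
      have "(\<Sum>i. c * emeasure M (F i)) = c * emeasure M (\<Union> (range F))"
        using suminf_emeasure[of F M] F Cons.prems[of c M] a by simp
      moreover have "(\<Sum>i. \<Sum>(c, M)\<leftarrow>cs. c * emeasure M (F i))
          = (\<Sum>(c, M)\<leftarrow>cs. c * emeasure M (\<Union> (range F)))"
        using Cons.prems by (intro Cons.IH) auto
      ultimately show ?case
        by (simp add: a suminf_add[symmetric])
    qed simp
  qed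
  moreover have "positive (sets S) (\<lambda>A. \<Sum>(c, M)\<leftarrow>cs. c * emeasure M A)"
    by (induction cs) (auto simp: positive_def)
  ultimately show ?thesis
    unfolding mixture_def using A by (intro emeasure_measure_of_sigma sets.sigma_algebra_axioms)
qed

lemma space_SX: "space SX = (\<Union>k\<in>{1..}. layer k)"
  and sets_SX: "sets SX = sigma_sets (\<Union>k\<in>{1..}. layer k)
                 (insert (layer 1) {{k} \<times> B |k B. k \<ge> 2 \<and> B \<in> sets (cube k)})"
proof -
  have "insert (layer 1) {{k} \<times> B |k B. k \<ge> 2 \<and> B \<in> sets (cube k)} \<subseteq> Pow (\<Union>k\<in>{1..}. layer k)"
    by (auto simp: layer_def dest!: sets.sets_into_space intro!: exI[of _ "Suc 0"])
  then show "space SX = (\<Union>k\<in>{1..}. layer k)"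
    and "sets SX = sigma_sets (\<Union>k\<in>{1..}. layer k)
                 (insert (layer 1) {{k} \<times> B |k B. k \<ge> 2 \<and> B \<in> sets (cube k)})"
    unfolding SX_def by auto
qed

lemma space_cube: "space (cube k) = {1..<k} \<rightarrow>\<^sub>E {0..1}"
  by (simp add: cube_def space_PiM space_restrict_space)

lemma layer_1: "layer 1 = {x\<^sub>0}"
  by (auto simp: layer_def space_cube x\<^sub>0_def)

lemma prob_space_cube: "prob_space (cube k)"
proof -
  have "prob_space unit_leb"
    by (rule prob_spaceI) (simp add: emeasure_restrict_space space_restrict_space)
  then show ?thesis
    unfolding cube_def by (intro prob_space_PiM)
qed

lemma Times_sets_SX:
  assumes "k \<ge> 1" "B \<in> sets (cube k)" shows "{k} \<times> B \<in> sets SX"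
proof (cases "k = 1")
  case True
  then have "B = {} \<or> B = space (cube 1)"
    using sets.sets_into_space[OF assms(2)] by (auto simp: space_cube)
  then show ?thesis
    using True by (auto simp: sets_SX layer_def intro!: sigma_sets.Basic sigma_sets.Empty)
next
  case False
  then show ?thesis
    using assms by (auto simp: sets_SX intro!: sigma_sets.Basic)
qed

lemma section_sets:
  assumes A: "A \<in> sets SX" shows "{v. (k, v) \<in> A} \<in> sets (cube k)"
  using A unfolding sets_SX
proof (induction rule: sigma_sets.induct)
  case (Basic a)
  then obtain j B where "a = {j} \<times> B" "B \<in> sets (cube j)"
    by (auto simp: layer_def)
  then show ?case
    by (cases "k = j") auto
next
  case (Compl a)
  have "{v. (k, v) \<in> (\<Union>k\<in>{1..}. layer k) - a}
      = (if k \<ge> 1 then space (cube k) - {v. (k, v) \<in> a} else {})"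
    by (auto simp: layer_def)
  then show ?case
    using Compl by auto
next
  case (Union a)
  have "{v. (k, v) \<in> \<Union> (range a)} = (\<Union>i. {v. (k, v) \<in> a i})"
    by auto
  then show ?case
    using Union by auto
qed auto

lemma sets_tau [simp]: "sets tau = sets SX"
  and space_tau [simp]: "space tau = space SX"
  by (simp_all add: tau_def sets.sigma_sets_eq sets.space_closed)

lemma emeasure_tau:
  assumes A: "A \<in> sets SX"
  shows "emeasure tau A = (\<Sum>k. emeasure (cube (Suc k)) {v. (Suc k, v) \<in> A})"
proof -
  have "countably_additive (sets SX) (\<lambda>A. \<Sum>k. emeasure (cube (Suc k)) {v. (Suc k, v) \<in> A})"
    unfolding countably_additive_def
  proof safe
    fix F :: "nat \<Rightarrow> state set"
    assume F: "range F \<subseteq> sets SX" "disjoint_family F"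
    have "emeasure (cube k) {v. (k, v) \<in> \<Union> (range F)} = (\<Sum>i. emeasure (cube k) {v. (k, v) \<in> F i})"
      for k
    proof -
      have "{v. (k, v) \<in> \<Union> (range F)} = (\<Union>i. {v. (k, v) \<in> F i})"
        by auto
      moreover have "disjoint_family (\<lambda>i. {v. (k, v) \<in> F i})"
        using F(2) by (auto simp: disjoint_family_on_def)
      moreover have "range (\<lambda>i. {v. (k, v) \<in> F i}) \<subseteq> sets (cube k)"
        using F(1) section_sets by auto
      ultimately show ?thesis
        by (simp add: suminf_emeasure)
    qed
    then show "(\<Sum>i. \<Sum>k. emeasure (cube (Suc k)) {v. (Suc k, v) \<in> F i})
        = (\<Sum>k. emeasure (cube (Suc k)) {v. (Suc k, v) \<in> \<Union> (range F)})"
      using nn_integral_suminf[of "\<lambda>i k. emeasure (cube (Suc k)) {v. (Suc k, v) \<in> F i}"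
          "count_space UNIV"]
      by (simp add: nn_integral_count_space_nat)
  qed
  moreover have "positive (sets SX) (\<lambda>A. \<Sum>k. emeasure (cube (Suc k)) {v. (Suc k, v) \<in> A})"
    by (simp add: positive_def)
  ultimately show ?thesis
    unfolding tau_def using A by (intro emeasure_measure_of_sigma sets.sigma_algebra_axioms)
qed

lemma emeasure_tau_Times:
  assumes k: "k \<ge> 1" and B: "B \<in> sets (cube k)"
  shows "emeasure tau ({k} \<times> B) = emeasure (cube k) B"
proof -
  have "emeasure tau ({k} \<times> B) = (\<Sum>j. if j = k - 1 then emeasure (cube k) B else 0)"
    unfolding emeasure_tau[OF Times_sets_SX[OF k B]]
  proof (intro suminf_cong)
    fix j
    show "emeasure (cube (Suc j)) {v. (Suc j, v) \<in> {k} \<times> B}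
        = (if j = k - 1 then emeasure (cube k) B else 0)"
      using k by (cases "Suc j = k") auto
  qed
  also have "\<dots> = emeasure (cube k) B"
    using suminf_finite[of "{k - 1}" "\<lambda>j. if j = k - 1 then emeasure (cube k) B else 0"] by simp
  finally show ?thesis .
qed

lemma emeasure_tau_x\<^sub>0: "emeasure tau {x\<^sub>0} = 1"
  using emeasure_tau_Times[of 1 "space (cube 1)"] prob_space.emeasure_space_1[OF prob_space_cube]
  by (simp add: layer_1[symmetric] layer_def)

text \<open>If \<open>K\<close> is a transition probability function then the hypotheses of the Ionescu-Tulcea
  theorem hold, so the projective limit in the definition of \<open>chain_law\<close> has the intended
  finite-dimensional distributions.\<close>

lemma Ionescu_Tulcea_chain_step:
  assumes K [measurable]: "K \<in> measurable S (prob_algebra S)" and x: "x \<in> space S"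
  shows "Ionescu_Tulcea (chain_step S K x) (\<lambda>_. S)"
proof (rule Ionescu_Tulcea.intro)
  have K' [measurable]: "K \<in> measurable S (subprob_algebra S)"
    using K by (rule measurable_prob_algebraD)
  show "chain_step S K x i \<in> measurable (PiM {0..<i} (\<lambda>_. S)) (subprob_algebra S)" for i
  proof (cases i)
    case 0
    then show ?thesis
      using x by (auto simp: chain_step_def[abs_def] space_subprob_algebra prob_space_return
          prob_space_imp_subprob_space intro!: measurable_const)
  next
    case (Suc m)
    have "(\<lambda>\<omega>. \<omega> m) \<in> measurable (PiM {0..<i} (\<lambda>_. S)) S"
      using Suc by (intro measurable_component_singleton) simp
    from measurable_compose[OF this K'] show ?thesis
      using Suc by (simp add: chain_step_def[abs_def])
  qed
  fix i :: nat and \<omega> assume "\<omega> \<in> space (PiM {0..<i} (\<lambda>_. S))"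
  then show "prob_space (chain_step S K x i \<omega>)"
    using x measurable_space[OF K]
    by (cases i) (auto simp: chain_step_def space_PiM PiE_iff prob_space_return space_prob_algebra)
qed

end

theory Submission
  imports Defs
begin

text \<open>The argument rests on a single state. The empty vector \<open>x\<^sub>0\<close> is an atom: the target gives it
positive mass, the chain stays in it with positive probability, and it is reached with positive
probability from every state, because the first proposal deletes the last coordinate with
probability one half and the target density vanishes nowhere, so that no proposal is rejected with
certainty (\<open>strong_atom_x0\<close>). Hence the conditions of the ergodic theorem hold with the one-point set
\<open>{x\<^sub>0}\<close>, the point mass at \<open>x\<^sub>0\<close> and \<open>n\<^sub>0 = 1\<close> (\<open>ADS_conditions_atom\<close>). The three limit theorems
are then proved for an arbitrary chain with such an atom.

Their common core is \<open>subharmonic_constant\<close>. If \<open>u\<close> is bounded and \<open>u \<le> K u\<close>, then along the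
stationary chain \<open>u (X\<^sub>n)\<close> is a submartingale with constant second moment; expanding the square shows
that \<open>u (X\<^sub>n) = u (X\<^sub>0)\<close> almost surely, and since the atom is reached from everywhere, \<open>u\<close> is almost
everywhere equal to its value at the atom.

For total variation, \<open>u\<close> is taken on the product chain of two independent copies: \<open>u z\<close> is the
probability that copies started in \<open>z\<close> are never simultaneously in the atom. It vanishes at the atom
of the product chain, hence almost everywhere, and the distance of the two laws at time \<open>n\<close> is at most
the probability of not having met by then (\<open>coupling_inequality\<close>). Since the atom has positive mass,
the laws of the chain started in the atom converge to the invariant distribution; as this limit does
not refer to the invariant distribution, the latter is unique.

For the law of large numbers, \<open>u x\<close> is the probability, for the chain started in \<open>x\<close>, that the partial
sums of \<open>f\<close> are unbounded above. This event is invariant under the shift, so \<open>u\<close> is harmonic and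
almost everywhere equal to a constant \<open>c\<close>. The maximal ergodic inequality on that event reads
\<open>0 \<le> c * (LINT x|\<mu>. f x)\<close>, so \<open>c = 0\<close> as soon as \<open>f\<close> has negative mean (\<open>AE_sums_bounded\<close>). Applied
to \<open>\<plusminus>(f - (LINT x|\<mu>. f x)) - \<epsilon>\<close> this gives the theorem.

Detailed balance is checked kernel by kernel. With the acceptance function \<open>alpha_ratio\<close> the density
\<open>\<phi> x\<close> turns into the symmetric \<open>min (\<phi> x) (\<phi> y)\<close>, so it suffices that the proposal be reversible with
respect to \<open>\<tau>\<close> (\<open>detailed_balance_ratio\<close>); for the fourth kernel the density of the accepted moves is
itself symmetric (\<open>prop4_flow\<close>). Appending and deleting a coordinate are inverse to each other because
a cube is the product of the preceding one with the unit interval; resampling a coordinate is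
reversible by Fubini's theorem; and a composition of reversible kernels is reversed by the
composition in the opposite order (\<open>reverses_kernel_seq\<close>), which is where the hypothesis on the sweep
enters.\<close>

section \<open>Transition functions\<close>

lemma nn_integral_add_measure:
  assumes [measurable_cong]: "sets M = sets N" "sets M' = sets N"
    and N: "\<And>A. A \<in> sets N \<Longrightarrow> emeasure N A = c * emeasure M A + emeasure M' A"
    and f: "f \<in> borel_measurable N"
  shows "(\<integral>\<^sup>+x. f x \<partial>N) = c * (\<integral>\<^sup>+x. f x \<partial>M) + (\<integral>\<^sup>+x. f x \<partial>M')"
  using f
proof (induction rule: borel_measurable_induct)
  case (cong f g)
  have "space M = space N" "space M' = space N"
    by (rule sets_eq_imp_space_eq; fact)+
  then have "integral\<^sup>N N f = integral\<^sup>N N g" "integral\<^sup>N M f = integral\<^sup>N M g"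
    "integral\<^sup>N M' f = integral\<^sup>N M' g"
    by (intro nn_integral_cong; simp add: cong(3))+
  then show ?case
    using cong by simp
next
  case (set A)
  then show ?case
    by (simp add: N assms)
next
  case (mult u d)
  then show ?case
    by (simp add: nn_integral_cmult distrib_left ac_simps)
next
  case (add u v)
  then show ?case
    by (simp add: nn_integral_add distrib_left ac_simps)
next
  case (seq U)
  have inc: "incseq (\<lambda>i. \<integral>\<^sup>+x. U i x \<partial>M)" "incseq (\<lambda>i. \<integral>\<^sup>+x. U i x \<partial>M')"
    using seq by (auto simp: mono_def le_fun_def intro!: nn_integral_mono)
  have "(\<integral>\<^sup>+x. (SUP i. U i) x \<partial>N) = (SUP i. \<integral>\<^sup>+x. U i x \<partial>N)"
    using seq by (simp add: nn_integral_monotone_convergence_SUP image_comp)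
  also have "\<dots> = (SUP i. c * (\<integral>\<^sup>+x. U i x \<partial>M) + (\<integral>\<^sup>+x. U i x \<partial>M'))"
    using seq by simp
  also have "\<dots> = (SUP i. c * (\<integral>\<^sup>+x. U i x \<partial>M)) + (SUP i. \<integral>\<^sup>+x. U i x \<partial>M')"
    using inc by (intro ennreal_SUP_add) (auto simp: mono_def intro!: mult_left_mono)
  also have "\<dots> = c * (\<integral>\<^sup>+x. (SUP i. U i) x \<partial>M) + (\<integral>\<^sup>+x. (SUP i. U i) x \<partial>M')"
    using seq by (simp add: nn_integral_monotone_convergence_SUP image_comp SUP_mult_left_ennreal)
  finally show ?case .
qed

lemma nn_integral_mixture:
  assumes "\<And>c M. (c, M) \<in> set cs \<Longrightarrow> sets M = sets S" and f: "f \<in> borel_measurable S"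
  shows "(\<integral>\<^sup>+x. f x \<partial>mixture S cs) = (\<Sum>(c, M)\<leftarrow>cs. c * (\<integral>\<^sup>+x. f x \<partial>M))"
  using assms(1)
proof (induction cs)
  case Nil
  have "mixture S [] = null_measure S"
    by (rule measure_eqI) (simp, subst emeasure_mixture, auto)
  then show ?case
    by simp
next
  case (Cons a cs)
  obtain c M where a: "a = (c, M)" by force
  have "(\<integral>\<^sup>+x. f x \<partial>mixture S ((c, M) # cs))
      = c * (\<integral>\<^sup>+x. f x \<partial>M) + (\<integral>\<^sup>+x. f x \<partial>mixture S cs)"
  proof (rule nn_integral_add_measure)
    show "sets M = sets (mixture S ((c, M) # cs))"
      using Cons.prems[of c M] a by simp
    show "emeasure (mixture S ((c, M) # cs)) A = c * emeasure M A + emeasure (mixture S cs) A"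
      if "A \<in> sets (mixture S ((c, M) # cs))" for A
    proof -
      have "emeasure (mixture S ((c, M) # cs)) A = (\<Sum>(c, M)\<leftarrow>(c, M) # cs. c * emeasure M A)"
        using Cons.prems that unfolding a by (intro emeasure_mixture) auto
      moreover have "emeasure (mixture S cs) A = (\<Sum>(c, M)\<leftarrow>cs. c * emeasure M A)"
        using Cons.prems that unfolding a by (intro emeasure_mixture) auto
      ultimately show ?thesis by simp
    qed
  qed (use f in \<open>auto simp: measurable_def\<close>)
  moreover have "(\<integral>\<^sup>+x. f x \<partial>mixture S cs) = (\<Sum>(c, M)\<leftarrow>cs. c * (\<integral>\<^sup>+x. f x \<partial>M))"
    using Cons.prems by (intro Cons.IH) auto
  ultimately show ?case
    by (simp add: a)
qed

lemma measurable_mixture: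
  assumes cs: "\<And>c M. (c, M) \<in> set cs \<Longrightarrow> c \<in> borel_measurable S \<and> M \<in> S \<rightarrow>\<^sub>M subprob_algebra S"
    and mass: "\<And>x. x \<in> space S \<Longrightarrow> (\<Sum>(c, M)\<leftarrow>cs. c x * emeasure (M x) (space S)) = 1"
  shows "(\<lambda>x. mixture S (map (\<lambda>(c, M). (c x, M x)) cs)) \<in> S \<rightarrow>\<^sub>M prob_algebra S"
proof (rule measurable_prob_algebraI)
  have *: "emeasure (mixture S (map (\<lambda>(c, M). (c x, M x)) cs)) A
      = (\<Sum>(c, M)\<leftarrow>cs. c x * emeasure (M x) A)" if "x \<in> space S" "A \<in> sets S" for x A
  proof (subst emeasure_mixture)
    show "sets M = sets S" if "(c, M) \<in> set (map (\<lambda>(c, M). (c x, M x)) cs)" for c M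
    proof -
      have "\<exists>z\<in>set cs. M = snd z x"
        using that by force
      then obtain c' M' where "(c', M') \<in> set cs" "M = M' x"
        by auto
      then show ?thesis
        using cs sets_kernel[OF _ \<open>x \<in> space S\<close>] by blast
    qed
  qed (use that in \<open>simp_all add: o_def split_def\<close>)
  show prob: "prob_space (mixture S (map (\<lambda>(c, M). (c x, M x)) cs))" if "x \<in> space S" for x
    by (rule prob_spaceI) (simp add: * that mass)
  show "(\<lambda>x. mixture S (map (\<lambda>(c, M). (c x, M x)) cs)) \<in> S \<rightarrow>\<^sub>M subprob_algebra S"
  proof (rule measurable_subprob_algebra)
    fix A assume A [measurable]: "A \<in> sets S"
    have "(\<lambda>x. \<Sum>(c, M)\<leftarrow>cs. c x * emeasure (M x) A) \<in> borel_measurable S"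
      using cs
    proof (induction cs)
      case (Cons a cs)
      obtain c M where a: "a = (c, M)" by force
      have [measurable]: "c \<in> borel_measurable S" "M \<in> S \<rightarrow>\<^sub>M subprob_algebra S"
        "(\<lambda>x. \<Sum>(c, M)\<leftarrow>cs. c x * emeasure (M x) A) \<in> borel_measurable S"
        using Cons a by auto
      show ?case
        by (simp add: a)
    qed simp
    then show "(\<lambda>x. emeasure (mixture S (map (\<lambda>(c, M). (c x, M x)) cs)) A) \<in> borel_measurable S"
      by (subst measurable_cong[OF *[OF _ A]])
  qed (use prob in \<open>auto intro: prob_space_imp_subprob_space\<close>)
qed

lemma sets_kernel_prob: "K \<in> M \<rightarrow>\<^sub>M prob_algebra S \<Longrightarrow> x \<in> space M \<Longrightarrow> sets (K x) = sets S"
  by (auto dest: measurable_space simp: space_prob_algebra)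

lemma space_kernel_prob: "K \<in> M \<rightarrow>\<^sub>M prob_algebra S \<Longrightarrow> x \<in> space M \<Longrightarrow> space (K x) = space S"
  by (metis sets_kernel_prob sets_eq_imp_space_eq)

lemma prob_space_kernel_prob: "K \<in> M \<rightarrow>\<^sub>M prob_algebra S \<Longrightarrow> x \<in> space M \<Longrightarrow> prob_space (K x)"
  by (auto dest: measurable_space simp: space_prob_algebra)

lemma mixture_kernel:
  fixes cs :: "(ennreal \<times> ('a \<Rightarrow> 'a measure)) list"
  assumes K: "\<And>c K. (c, K) \<in> set cs \<Longrightarrow> K \<in> S \<rightarrow>\<^sub>M prob_algebra S" and one: "(\<Sum>(c, K)\<leftarrow>cs. c) = 1"
  shows "(\<lambda>x. mixture S (map (\<lambda>(c, K). (c, K x)) cs)) \<in> S \<rightarrow>\<^sub>M prob_algebra S"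
proof -
  have "(\<lambda>x. mixture S (map (\<lambda>(c, M). (c x, M x)) (map (\<lambda>(c, K). (\<lambda>_ :: 'a. c, K)) cs))) \<in> S \<rightarrow>\<^sub>M prob_algebra S"
  proof (rule measurable_mixture)
    fix c M assume "(c, M) \<in> set (map (\<lambda>(c, K). (\<lambda>_ :: 'a. c, K)) cs)"
    then have "\<exists>z\<in>set cs. c = (\<lambda>_ :: 'a. fst z) \<and> M = snd z"
      by force
    then show "c \<in> borel_measurable S \<and> M \<in> S \<rightarrow>\<^sub>M subprob_algebra S"
      using K by (auto intro: measurable_prob_algebraD)
  next
    fix x assume x: "x \<in> space S"
    have "emeasure (K x) (space S) = 1" if "(c, K) \<in> set cs" for c K
      using prob_space.emeasure_space_1[OF prob_space_kernel_prob[OF K[OF that] x]]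
      by (simp add: space_kernel_prob[OF K[OF that] x])
    then have "map (\<lambda>(c, K). c * emeasure (K x) (space S)) cs = map (\<lambda>(c, K). c) cs"
      by (intro map_cong refl) auto
    then have "(\<Sum>(c, K)\<leftarrow>cs. c * emeasure (K x) (space S)) = 1"
      using one by (simp only:)
    then show "(\<Sum>(c, M)\<leftarrow>map (\<lambda>(c, K). (\<lambda>_ :: 'a. c, K)) cs. c x * emeasure (M x) (space S)) = 1"
      by (simp add: o_def split_def)
  qed
  then show ?thesis
    by (simp add: o_def split_def)
qed

lemma emeasure_mixture_kernels:
  fixes cs :: "(ennreal \<times> ('a \<Rightarrow> 'a measure)) list"
  assumes K: "\<And>c K. (c, K) \<in> set cs \<Longrightarrow> K \<in> S \<rightarrow>\<^sub>M prob_algebra S" and x: "x \<in> space S" and B: "B \<in> sets S"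
  shows "emeasure (mixture S (map (\<lambda>(c, K). (c, K x)) cs)) B = (\<Sum>(c, K)\<leftarrow>cs. c * emeasure (K x) B)"
proof -
  have "emeasure (mixture S (map (\<lambda>(c, K). (c, K x)) cs)) B
      = (\<Sum>(c, M)\<leftarrow>map (\<lambda>(c, K). (c, K x)) cs. c * emeasure M B)"
  proof (rule emeasure_mixture[OF _ B])
    fix c M assume "(c, M) \<in> set (map (\<lambda>(c, K). (c, K x)) cs)"
    then have "\<exists>z\<in>set cs. M = snd z x" by force
    then obtain c' K' where "(c', K') \<in> set cs" "M = K' x" by auto
    then show "sets M = sets S"
      using sets_kernel_prob[OF K x] by blast
  qed
  then show ?thesis
    by (simp add: o_def split_def)
qed

lemma measurable_kernel_density:
  assumes K: "K \<in> S \<rightarrow>\<^sub>M subprob_algebra S"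
    and f [measurable]: "case_prod f \<in> borel_measurable (S \<Otimes>\<^sub>M S)"
    and le: "\<And>x. x \<in> space S \<Longrightarrow> (\<integral>\<^sup>+y. f x y \<partial>K x) \<le> 1"
  shows "(\<lambda>x. density (K x) (f x)) \<in> S \<rightarrow>\<^sub>M subprob_algebra S"
proof (rule measurable_subprob_algebra)
  have [measurable_cong]: "sets (K x) = sets S" if "x \<in> space S" for x
    using K that by (rule subprob_measurableD)
  have *: "emeasure (density (K x) (f x)) A = (\<integral>\<^sup>+y. f x y * indicator A y \<partial>K x)"
    if "x \<in> space S" "A \<in> sets S" for x A
  proof (rule emeasure_density)
    have "f x \<in> borel_measurable S"
      using that by measurable
    then show "f x \<in> borel_measurable (K x)"
      by (simp add: measurable_cong_sets[OF sets_kernel[OF K] refl] that)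
  qed (use that K sets_kernel in \<open>auto\<close>)
  show "sets (density (K x) (f x)) = sets S" if "x \<in> space S" for x
    using that sets_kernel[OF K] by simp
  show "subprob_space (density (K x) (f x))" if "x \<in> space S" for x
  proof (rule subprob_spaceI)
    have "space (K x) = space S"
      using that sets_kernel[OF K] by (intro sets_eq_imp_space_eq) simp
    have "emeasure (density (K x) (f x)) (space (density (K x) (f x)))
        = (\<integral>\<^sup>+y. f x y * indicator (space S) y \<partial>K x)"
      using that \<open>space (K x) = space S\<close> by (simp add: *)
    also have "\<dots> = (\<integral>\<^sup>+y. f x y \<partial>K x)"
      by (intro nn_integral_cong) (simp add: \<open>space (K x) = space S\<close>)
    finally show "emeasure (density (K x) (f x)) (space (density (K x) (f x))) \<le> 1"
      using le[OF that] by simp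
    show "space (density (K x) (f x)) \<noteq> {}"
      using that \<open>space (K x) = space S\<close> by auto
  qed
  show "(\<lambda>x. emeasure (density (K x) (f x)) A) \<in> borel_measurable S" if [measurable]: "A \<in> sets S" for A
  proof (subst measurable_cong[OF *[OF _ that]])
    show "(\<lambda>x. \<integral>\<^sup>+y. f x y * indicator A y \<partial>K x) \<in> borel_measurable S"
      by (rule nn_integral_measurable_subprob_algebra2[OF _ K]) simp
  qed
qed

locale kernel =
  fixes S :: "'a measure" and K :: "'a \<Rightarrow> 'a measure"
  assumes K [measurable]: "K \<in> S \<rightarrow>\<^sub>M prob_algebra S"
begin

lemma K_subprob [measurable]: "K \<in> S \<rightarrow>\<^sub>M subprob_algebra S"
  using K by (rule measurable_prob_algebraD)

lemma sets_K [measurable_cong]: "x \<in> space S \<Longrightarrow> sets (K x) = sets S"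
  using K by (rule sets_kernel_prob)

lemma space_K: "x \<in> space S \<Longrightarrow> space (K x) = space S"
  using K by (rule space_kernel_prob)

lemma prob_space_K: "x \<in> space S \<Longrightarrow> prob_space (K x)"
  using K by (rule prob_space_kernel_prob)

lemma measurable_K: "x \<in> space S \<Longrightarrow> f \<in> S \<rightarrow>\<^sub>M N \<Longrightarrow> f \<in> K x \<rightarrow>\<^sub>M N"
  by (simp add: measurable_cong_sets[OF sets_K refl])

lemma kernel_power_measurable [measurable]: "kernel_power S K n \<in> S \<rightarrow>\<^sub>M prob_algebra S"
proof (induction n)
  case 0
  have "kernel_power S K 0 = return S" by auto
  then show ?case by simp
next
  case (Suc n)
  have "kernel_power S K (Suc n) = (\<lambda>x. kernel_power S K n x \<bind> K)" by auto
  with Suc show ?case by simp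
qed

lemma kernel_power_subprob [measurable]: "kernel_power S K n \<in> S \<rightarrow>\<^sub>M subprob_algebra S"
  using kernel_power_measurable by (rule measurable_prob_algebraD)

lemmas sets_kernel_power = sets_kernel_prob[OF kernel_power_measurable]
  and space_kernel_power = space_kernel_prob[OF kernel_power_measurable]
  and prob_space_kernel_power = prob_space_kernel_prob[OF kernel_power_measurable]

text \<open>Powers are defined by appending a last step, whereas arguments that condition on the first
  move of the chain split off the first one.\<close>

lemma kernel_power_first_step:
  assumes x: "x \<in> space S"
  shows "kernel_power S K (Suc n) x = K x \<bind> kernel_power S K n"
proof (induction n)
  case 0
  have "kernel_power S K 0 = return S" by auto
  moreover have "return S x \<bind> K = K x"
    using x by (intro bind_return[OF K_subprob])
  ultimately show ?case
    using bind_return''[OF sets_K[OF x]] by simp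
next
  case (Suc n)
  have "kernel_power S K (Suc (Suc n)) x = (K x \<bind> kernel_power S K n) \<bind> K"
    using Suc by simp
  also have "\<dots> = K x \<bind> (\<lambda>y. kernel_power S K n y \<bind> K)"
  proof (rule bind_assoc)
    show "kernel_power S K n \<in> K x \<rightarrow>\<^sub>M subprob_algebra S"
      using x by (rule measurable_K[OF _ kernel_power_subprob])
  qed (rule K_subprob)
  also have "(\<lambda>y. kernel_power S K n y \<bind> K) = kernel_power S K (Suc n)" by auto
  finally show ?case .
qed

lemma emeasure_kernel_power_Suc:
  assumes "x \<in> space S" "A \<in> sets S"
  shows "emeasure (kernel_power S K (Suc n) x) A = (\<integral>\<^sup>+y. emeasure (kernel_power S K n y) A \<partial>K x)"
  unfolding kernel_power_first_step[OF assms(1)]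
proof (rule emeasure_bind)
  show "kernel_power S K n \<in> K x \<rightarrow>\<^sub>M subprob_algebra S"
    using assms(1) by (rule measurable_K[OF _ kernel_power_subprob])
qed (use assms space_K in auto)

end

section \<open>The law of the chain\<close>

context kernel
begin

abbreviation paths :: "(nat \<Rightarrow> 'a) measure" where
  "paths \<equiv> PiM UNIV (\<lambda>_. S)"

definition shift :: "(nat \<Rightarrow> 'a) \<Rightarrow> nat \<Rightarrow> 'a" where
  "shift \<omega> = (\<lambda>i. \<omega> (Suc i))"

lemma measurable_shift [measurable]: "shift \<in> paths \<rightarrow>\<^sub>M paths"
  unfolding shift_def by (rule measurable_PiM_single') (auto simp: space_PiM)

text \<open>The expectation of \<open>F 0 (X\<^sub>0) * \<dots> * F n (X\<^sub>n)\<close> for the chain started in \<open>x\<close>, evaluated from the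
  front. The construction of the path law appends coordinates at the back; the Markov property at
  time 1 becomes evident once both evaluations are known to agree.\<close>

primrec nest :: "nat \<Rightarrow> (nat \<Rightarrow> 'a \<Rightarrow> ennreal) \<Rightarrow> 'a \<Rightarrow> ennreal" where
  "nest 0 F x = F 0 x"
| "nest (Suc n) F x = F 0 x * (\<integral>\<^sup>+y. nest n (\<lambda>i. F (Suc i)) y \<partial>K x)"

lemma measurable_nest [measurable]:
  assumes "\<And>i. F i \<in> borel_measurable S"
  shows "nest n F \<in> borel_measurable S"
  using assms
proof (induction n arbitrary: F)
  case 0
  have "nest 0 F = F 0" by auto
  then show ?case using 0 by simp
next
  case (Suc n)
  have [measurable]: "F 0 \<in> borel_measurable S" "nest n (\<lambda>i. F (Suc i)) \<in> borel_measurable S"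
    using Suc by auto
  have "nest (Suc n) F = (\<lambda>x. F 0 x * (\<integral>\<^sup>+y. nest n (\<lambda>i. F (Suc i)) y \<partial>K x))"
    by auto
  then show ?case by simp
qed

text \<open>Integrating out the last coordinate leaves one more weight on the coordinate before it.\<close>

lemma nest_merge_last:
  "nest (Suc n) F x = nest n (F(n := \<lambda>z. F n z * (\<integral>\<^sup>+y. F (Suc n) y \<partial>K z))) x"
proof (induction n arbitrary: F x)
  case (Suc n)
  have "nest (Suc (Suc n)) F x = F 0 x * (\<integral>\<^sup>+y. nest (Suc n) (\<lambda>i. F (Suc i)) y \<partial>K x)"
    by simp
  also have "(\<lambda>y. nest (Suc n) (\<lambda>i. F (Suc i)) y) = nest n (\<lambda>i. (F(Suc n := \<lambda>z. F (Suc n) z * (\<integral>\<^sup>+y. F (Suc (Suc n)) y \<partial>K z))) (Suc i))"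
  proof
    fix y
    have "(\<lambda>i. F (Suc i))(n := \<lambda>z. F (Suc n) z * (\<integral>\<^sup>+y. F (Suc (Suc n)) y \<partial>K z))
        = (\<lambda>i. (F(Suc n := \<lambda>z. F (Suc n) z * (\<integral>\<^sup>+y. F (Suc (Suc n)) y \<partial>K z))) (Suc i))"
      by auto
    then show "nest (Suc n) (\<lambda>i. F (Suc i)) y = nest n (\<lambda>i. (F(Suc n := \<lambda>z. F (Suc n) z * (\<integral>\<^sup>+y. F (Suc (Suc n)) y \<partial>K z))) (Suc i)) y"
      using Suc[of "\<lambda>i. F (Suc i)" y] by simp
  qed
  finally show ?case
    by simp
qed simp

text \<open>The outermost step in the construction produces the last coordinate, which
  \<open>nest_merge_last\<close> absorbs; so the induction is on the number of coordinates, with varying weights.\<close>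

lemma nn_integral_C_nest:
  assumes x: "x \<in> space S" and F [measurable]: "\<And>i. F i \<in> borel_measurable S"
  shows "(\<integral>\<^sup>+\<omega>. (\<Prod>i\<le>n. F i (\<omega> i)) \<partial>Ionescu_Tulcea.C (chain_step S K x) (\<lambda>_. S) 0 (Suc n) (\<lambda>_. undefined))
    = nest n F x"
  using F
proof (induction n arbitrary: F)
  interpret IT: Ionescu_Tulcea "chain_step S K x" "\<lambda>_. S"
    using K x by (rule Ionescu_Tulcea_chain_step)
  have undef: "(\<lambda>_. undefined) \<in> space (PiM {0..<0::nat} (\<lambda>_. S))"
    by (auto simp: space_PiM)
  {
    case 0
    have [measurable]: "F 0 \<in> borel_measurable S" using 0 by simp
    have "IT.C 0 (Suc 0) (\<lambda>_. undefined) = IT.eP 0 (\<lambda>_. undefined)"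
      using bind_return[OF IT.measurable_eP undef] by simp
    moreover have "(\<integral>\<^sup>+\<omega>. F 0 (\<omega> 0) \<partial>IT.eP 0 (\<lambda>_. undefined)) = (\<integral>\<^sup>+y. F 0 y \<partial>return S x)"
    proof (subst IT.nn_integral_eP[OF undef])
      have "(\<lambda>\<omega>. \<omega> 0) \<in> PiM {0..<Suc 0} (\<lambda>_. S) \<rightarrow>\<^sub>M S"
        by (rule measurable_component_singleton) simp
      then show "(\<lambda>\<omega>. F 0 (\<omega> 0)) \<in> borel_measurable (PiM {0..<Suc 0} (\<lambda>_. S))"
        by measurable
    qed (simp add: chain_step_def)
    ultimately show ?case
      using x by (simp add: nn_integral_return)
  next
    case (Suc n)
    let ?C = "IT.C 0 (Suc n) (\<lambda>_. undefined)"
    let ?F = "F(n := \<lambda>z. F n z * (\<integral>\<^sup>+y. F (Suc n) y \<partial>K z))"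
    have F [measurable]: "\<And>i. F i \<in> borel_measurable S" using Suc by simp
    have comp: "(\<lambda>\<omega>. \<omega> i) \<in> PiM {0..<m} (\<lambda>_. S) \<rightarrow>\<^sub>M S" if "i < m" for i m :: nat
      using that by (intro measurable_component_singleton) simp
    have meas: "(\<lambda>\<omega>. \<Prod>i\<le>Suc n. F i (\<omega> i)) \<in> borel_measurable (PiM {0..<Suc (Suc n)} (\<lambda>_. S))"
      by (intro borel_measurable_prod_ennreal measurable_compose[OF comp F]) simp
    have "(\<integral>\<^sup>+\<omega>. (\<Prod>i\<le>Suc n. F i (\<omega> i)) \<partial>IT.C 0 (Suc (Suc n)) (\<lambda>_. undefined))
        = (\<integral>\<^sup>+\<omega>. \<integral>\<^sup>+\<omega>'. (\<Prod>i\<le>Suc n. F i (\<omega>' i)) \<partial>IT.eP (Suc n) \<omega> \<partial>?C)"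
    proof -
      have "IT.eP (Suc n) \<in> ?C \<rightarrow>\<^sub>M subprob_algebra (PiM {0..<Suc (Suc n)} (\<lambda>_. S))"
        unfolding measurable_cong_sets[OF IT.sets_C[OF undef, of "Suc n"] refl]
        using IT.measurable_eP[of "Suc n"] by simp
      from nn_integral_bind[OF meas this] show ?thesis
        by simp
    qed
    also have "\<dots> = (\<integral>\<^sup>+\<omega>. (\<Prod>i\<le>n. ?F i (\<omega> i)) \<partial>?C)"
    proof (rule nn_integral_cong)
      fix \<omega> assume "\<omega> \<in> space ?C"
      then have \<omega>: "\<omega> \<in> space (PiM {0..<Suc n} (\<lambda>_. S))"
        by (simp add: IT.space_C[OF undef, of "Suc n"] del: IT.C.simps)
      then have \<omega>n: "\<omega> n \<in> space S"
        by (auto simp: space_PiM)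
      have "(\<integral>\<^sup>+\<omega>'. (\<Prod>i\<le>Suc n. F i (\<omega>' i)) \<partial>IT.eP (Suc n) \<omega>)
          = (\<integral>\<^sup>+y. (\<Prod>i\<le>Suc n. F i (fun_upd \<omega> (Suc n) y i)) \<partial>K (\<omega> n))"
        using IT.nn_integral_eP[OF \<omega> meas] by (simp add: chain_step_def del: prod.atMost_Suc)
      also have "\<dots> = (\<integral>\<^sup>+y. (\<Prod>i\<le>n. F i (\<omega> i)) * F (Suc n) y \<partial>K (\<omega> n))"
        by simp
      also have "\<dots> = (\<Prod>i\<le>n. F i (\<omega> i)) * (\<integral>\<^sup>+y. F (Suc n) y \<partial>K (\<omega> n))"
        by (rule nn_integral_cmult[OF measurable_K[OF \<omega>n F]])
      also have "\<dots> = (\<Prod>i<n. F i (\<omega> i)) * ?F n (\<omega> n)"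
        by (simp add: lessThan_Suc_atMost[symmetric] mult.assoc)
      also have "\<dots> = (\<Prod>i\<le>n. ?F i (\<omega> i))"
        by (simp add: lessThan_Suc_atMost[symmetric])
      finally show "(\<integral>\<^sup>+\<omega>'. (\<Prod>i\<le>Suc n. F i (\<omega>' i)) \<partial>IT.eP (Suc n) \<omega>) = (\<Prod>i\<le>n. ?F i (\<omega> i))" .
    qed
    also have "\<dots> = nest n ?F x"
      by (rule Suc.IH) auto
    also have "\<dots> = nest (Suc n) F x"
      by (rule nest_merge_last[symmetric])
    finally show ?case .
  }
qed

lemma sets_chain_law [simp]: "x \<in> space S \<Longrightarrow> sets (chain_law S K x) = sets paths"
  and space_chain_law [simp]: "x \<in> space S \<Longrightarrow> space (chain_law S K x) = space paths"
proof -
  assume x: "x \<in> space S"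
  interpret IT: Ionescu_Tulcea "chain_step S K x" "\<lambda>_. S"
    using K x by (rule Ionescu_Tulcea_chain_step)
  show "sets (chain_law S K x) = sets paths" "space (chain_law S K x) = space paths"
    by (simp_all add: chain_law_def)
qed

lemma nn_integral_chain_law_prod:
  assumes x: "x \<in> space S" and F [measurable]: "\<And>i. F i \<in> borel_measurable S"
  shows "(\<integral>\<^sup>+\<omega>. (\<Prod>i\<le>n. F i (\<omega> i)) \<partial>chain_law S K x) = nest n F x"
proof -
  interpret IT: Ionescu_Tulcea "chain_step S K x" "\<lambda>_. S"
    using K x by (rule Ionescu_Tulcea_chain_step)
  let ?J = "{0..<Suc n}"
  let ?P = "PiM ?J (\<lambda>_. S)"
  have undef: "(\<lambda>_. undefined) \<in> space (PiM {0..<0::nat} (\<lambda>_. S))"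
    by (simp add: space_PiM)
  have up: "IT.up_to ?J = Suc n"
    using IT.up_to_less[of ?J n] IT.up_to_iff[of ?J "Suc n"] by simp
  have comp: "(\<lambda>\<omega>. \<omega> i) \<in> ?P \<rightarrow>\<^sub>M S" if "i \<le> n" for i
    using that by (intro measurable_component_singleton) simp
  have meas: "(\<lambda>\<omega>. \<Prod>i\<le>n. F i (\<omega> i)) \<in> borel_measurable ?P"
    by (intro borel_measurable_prod_ennreal measurable_compose[OF comp F]) simp
  have restr: "(\<Prod>i\<le>n. F i (restrict \<omega> ?J i)) = (\<Prod>i\<le>n. F i (\<omega> i))" for \<omega>
    by (intro prod.cong) auto
  have "(\<integral>\<^sup>+\<omega>. (\<Prod>i\<le>n. F i (\<omega> i)) \<partial>chain_law S K x)
      = (\<integral>\<^sup>+\<omega>. (\<Prod>i\<le>n. F i (\<omega> i)) \<partial>distr IT.PF.lim ?P (\<lambda>\<omega>. restrict \<omega> ?J))"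
  proof (subst nn_integral_distr)
    show "(\<lambda>\<omega>. restrict \<omega> ?J) \<in> IT.PF.lim \<rightarrow>\<^sub>M ?P"
      by (simp add: measurable_cong_sets[OF IT.PF.sets_lim refl] measurable_restrict_subset)
  qed (use meas restr in \<open>simp_all add: chain_law_def\<close>)
  also have "distr IT.PF.lim ?P (\<lambda>\<omega>. restrict \<omega> ?J)
      = distr (IT.C 0 (Suc n) (\<lambda>_. undefined)) ?P (\<lambda>\<omega>. restrict \<omega> ?J)"
    by (subst IT.distr_lim) (simp_all add: IT.CI_def up del: IT.C.simps)
  also have "(\<integral>\<^sup>+\<omega>. (\<Prod>i\<le>n. F i (\<omega> i)) \<partial>\<dots>)
      = (\<integral>\<^sup>+\<omega>. (\<Prod>i\<le>n. F i (\<omega> i)) \<partial>IT.C 0 (Suc n) (\<lambda>_. undefined))"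
  proof (subst nn_integral_distr)
    have "sets (IT.C 0 (Suc n) (\<lambda>_. undefined)) = sets ?P"
      using IT.sets_C[OF undef, of "Suc n"] by simp
    from measurable_cong_sets[OF this refl]
    show "(\<lambda>\<omega>. restrict \<omega> ?J) \<in> IT.C 0 (Suc n) (\<lambda>_. undefined) \<rightarrow>\<^sub>M ?P"
      by (simp add: measurable_restrict_subset del: IT.C.simps)
  qed (use meas restr in \<open>simp_all del: IT.C.simps\<close>)
  also have "\<dots> = nest n F x"
    using x F by (rule nn_integral_C_nest)
  finally show ?thesis .
qed

lemma prob_space_chain_law: "x \<in> space S \<Longrightarrow> prob_space (chain_law S K x)"
  using nn_integral_chain_law_prod[of x "\<lambda>_ _. 1" 0] by (auto intro!: prob_spaceI)

text \<open>All sides but finitely many are the whole space, so that the probability of a cylinder is the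
  expectation of a finite product; indexing the sides by all natural numbers makes intersection a
  coordinatewise operation.\<close>

definition cylinders :: "(nat \<Rightarrow> 'a) set set" where
  "cylinders = {{\<omega> \<in> space paths. \<forall>i. \<omega> i \<in> A i} | A n. \<forall>i. A i \<in> sets S \<and> (n < i \<longrightarrow> A i = space S)}"

lemma cylinders_sets: "cylinders \<subseteq> sets paths"
proof
  fix X assume "X \<in> cylinders"
  then obtain A where X: "X = {\<omega> \<in> space paths. \<forall>i. \<omega> i \<in> A i}" and [measurable]: "\<And>i. A i \<in> sets S"
    by (auto simp: cylinders_def)
  show "X \<in> sets paths"
    unfolding X by measurable
qed

lemma Int_stable_cylinders: "Int_stable cylinders"
proof (rule Int_stableI)
  fix X Y assume "X \<in> cylinders" "Y \<in> cylinders"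
  then obtain A n B m where
    X: "X = {\<omega> \<in> space paths. \<forall>i. \<omega> i \<in> A i}" "\<And>i. A i \<in> sets S" "\<And>i. n < i \<Longrightarrow> A i = space S" and
    Y: "Y = {\<omega> \<in> space paths. \<forall>i. \<omega> i \<in> B i}" "\<And>i. B i \<in> sets S" "\<And>i. m < i \<Longrightarrow> B i = space S"
    unfolding cylinders_def by blast
  have "X \<inter> Y = {\<omega> \<in> space paths. \<forall>i. \<omega> i \<in> A i \<inter> B i}"
    using X Y by auto
  moreover have "\<forall>i. A i \<inter> B i \<in> sets S \<and> (max n m < i \<longrightarrow> A i \<inter> B i = space S)"
    using X Y by auto
  ultimately show "X \<inter> Y \<in> cylinders"
    unfolding cylinders_def by (intro CollectI exI[of _ "\<lambda>i. A i \<inter> B i"] exI[of _ "max n m"]) simp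
qed

lemma space_cylinders: "space paths \<in> cylinders"
  unfolding cylinders_def
  by (intro CollectI exI[of _ "\<lambda>_. space S"] exI[of _ 0]) (auto simp: space_PiM)

lemma sets_paths_cylinders: "sets paths = sigma_sets (space paths) cylinders"
proof (intro antisym sets.sigma_sets_subset cylinders_sets)
  show "sets paths \<subseteq> sigma_sets (space paths) cylinders"
    unfolding sets_PiM_single space_PiM[symmetric]
  proof (intro sigma_sets_mono', safe)
    fix i A assume A: "A \<in> sets S"
    have "{f \<in> space paths. f i \<in> A} = {\<omega> \<in> space paths. \<forall>j. \<omega> j \<in> (if j = i then A else space S)}"
      by (auto simp: space_PiM)
    then show "{f \<in> space paths. f i \<in> A} \<in> cylinders"
      unfolding cylinders_def using A
      by (intro CollectI exI[of _ "\<lambda>j. if j = i then A else space S"] exI[of _ i]) auto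
  qed
qed

lemma emeasure_chain_law_cylinder:
  assumes x: "x \<in> space S" and A: "\<And>i. A i \<in> sets S" "\<And>i. n < i \<Longrightarrow> A i = space S"
  shows "emeasure (chain_law S K x) {\<omega> \<in> space paths. \<forall>i. \<omega> i \<in> A i} = nest n (\<lambda>i. indicator (A i)) x"
proof -
  let ?X = "{\<omega> \<in> space paths. \<forall>i. \<omega> i \<in> A i}"
  have [measurable]: "A i \<in> sets S" for i by fact
  have "?X \<in> sets paths"
    by measurable
  then have "emeasure (chain_law S K x) ?X = (\<integral>\<^sup>+\<omega>. indicator ?X \<omega> \<partial>chain_law S K x)"
    using x by simp
  also have "\<dots> = (\<integral>\<^sup>+\<omega>. (\<Prod>i\<le>n. indicator (A i) (\<omega> i)) \<partial>chain_law S K x)"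
  proof (rule nn_integral_cong)
    fix \<omega> assume "\<omega> \<in> space (chain_law S K x)"
    then have \<omega>: "\<omega> \<in> space paths" "\<And>i. \<omega> i \<in> space S"
      using x by (auto simp: space_PiM)
    show "indicator ?X \<omega> = (\<Prod>i\<le>n. indicator (A i) (\<omega> i) :: ennreal)"
    proof (cases "\<forall>i\<le>n. \<omega> i \<in> A i")
      case True
      then have "\<forall>i. \<omega> i \<in> A i"
        using A(2) \<omega>(2) by (metis not_le)
      then show ?thesis using \<omega> by simp
    next
      case False
      then obtain i where "i \<le> n" "\<omega> i \<notin> A i"
        by auto
      then have "(\<Prod>i\<le>n. indicator (A i) (\<omega> i) :: ennreal) = 0"
        by (intro prod_zero bexI[of _ i]) simp_all
      moreover have "\<omega> \<notin> ?X"
        using \<open>\<omega> i \<notin> A i\<close> by blast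
      ultimately show ?thesis by simp
    qed
  qed
  also have "\<dots> = nest n (\<lambda>i. indicator (A i)) x"
    using x by (intro nn_integral_chain_law_prod) auto
  finally show ?thesis .
qed

lemma measurable_chain_law [measurable]: "chain_law S K \<in> S \<rightarrow>\<^sub>M prob_algebra paths"
proof (rule measurable_prob_algebra_generated[OF sets_paths_cylinders Int_stable_cylinders])
  show "cylinders \<subseteq> Pow (space paths)"
    using cylinders_sets sets.sets_into_space by blast
  show "prob_space (chain_law S K x)" "sets (chain_law S K x) = sets paths" if "x \<in> space S" for x
    using that prob_space_chain_law by auto
  fix X assume "X \<in> cylinders"
  then obtain A n where X: "X = {\<omega> \<in> space paths. \<forall>i. \<omega> i \<in> A i}"
    and A [measurable]: "\<And>i. A i \<in> sets S" "\<And>i. n < i \<Longrightarrow> A i = space S"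
    unfolding cylinders_def by blast
  show "(\<lambda>x. emeasure (chain_law S K x) X) \<in> borel_measurable S"
    unfolding X by (subst measurable_cong[OF emeasure_chain_law_cylinder[OF _ A]]) auto
qed

text \<open>On a cylinder, passing to the shifted path inserts the trivial side \<open>space S\<close> in front, and the
  first step of \<open>nest\<close> integrates the remaining factor against \<open>K x\<close>.\<close>

lemma markov_property:
  assumes x: "x \<in> space S"
  shows "distr (chain_law S K x) paths shift = K x \<bind> chain_law S K"
proof (rule measure_eqI_generator_eq[OF Int_stable_cylinders])
  have cl: "chain_law S K \<in> K x \<rightarrow>\<^sub>M subprob_algebra paths"
    using x measurable_prob_algebraD[OF measurable_chain_law] by (rule measurable_K)
  have ne: "space (K x) \<noteq> {}"
    using x by (auto simp: space_K)
  show "cylinders \<subseteq> Pow (space paths)"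
    using cylinders_sets sets.sets_into_space by blast
  have sets_bind: "sets (K x \<bind> chain_law S K) = sets paths"
    using x ne by (intro sets_bind) (auto simp: space_K)
  then show "sets (distr (chain_law S K x) paths shift) = sigma_sets (space paths) cylinders"
    "sets (K x \<bind> chain_law S K) = sigma_sets (space paths) cylinders"
    by (simp_all add: sets_paths_cylinders)
  show "range (\<lambda>_. space paths) \<subseteq> cylinders" "(\<Union>i::nat. space paths) = space paths"
    using space_cylinders by auto
  have meas: "shift \<in> chain_law S K x \<rightarrow>\<^sub>M paths"
    using x by (simp add: measurable_cong_sets[OF sets_chain_law refl])
  have "prob_space (distr (chain_law S K x) paths shift)"
    using prob_space_chain_law[OF x] meas by (rule prob_space.prob_space_distr)
  then show "emeasure (distr (chain_law S K x) paths shift) (space paths) \<noteq> \<infinity>" for i :: nat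
    by (simp add: finite_measure.emeasure_finite prob_space.finite_measure)
  fix X assume "X \<in> cylinders"
  then obtain A n where X: "X = {\<omega> \<in> space paths. \<forall>i. \<omega> i \<in> A i}"
    and A [measurable]: "\<And>i. A i \<in> sets S" "\<And>i. n < i \<Longrightarrow> A i = space S"
    unfolding cylinders_def by blast
  have X_sets: "X \<in> sets paths"
    unfolding X by measurable
  let ?B = "\<lambda>i. case i of 0 \<Rightarrow> space S | Suc j \<Rightarrow> A j"
  have B: "?B i \<in> sets S" "Suc n < i \<Longrightarrow> ?B i = space S" for i
    using A by (auto split: nat.splits)
  have "shift -` X \<inter> space (chain_law S K x) = {\<omega> \<in> space paths. \<forall>i. \<omega> i \<in> ?B i}"
    using x by (auto simp: X shift_def space_PiM split: nat.splits)
  then have "emeasure (distr (chain_law S K x) paths shift) X = nest (Suc n) (\<lambda>i. indicator (?B i)) x"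
    using emeasure_chain_law_cylinder[OF x B, of "Suc n"] by (simp add: emeasure_distr[OF meas X_sets] del: nest.simps)
  also have "\<dots> = (\<integral>\<^sup>+y. nest n (\<lambda>i. indicator (A i)) y \<partial>K x)"
    using x by simp
  also have "\<dots> = (\<integral>\<^sup>+y. emeasure (chain_law S K y) X \<partial>K x)"
    using x unfolding X
    by (intro nn_integral_cong) (simp add: emeasure_chain_law_cylinder[OF _ A] space_K)
  also have "\<dots> = emeasure (K x \<bind> chain_law S K) X"
    by (rule emeasure_bind[symmetric, OF ne cl X_sets])
  finally show "emeasure (distr (chain_law S K x) paths shift) X = emeasure (K x \<bind> chain_law S K) X" .
qed

lemma emeasure_chain_law_shift:
  assumes x: "x \<in> space S" and X: "X \<in> sets paths"
  shows "emeasure (chain_law S K x) {\<omega> \<in> space paths. shift \<omega> \<in> X}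
    = (\<integral>\<^sup>+y. emeasure (chain_law S K y) X \<partial>K x)"
proof -
  have meas: "shift \<in> chain_law S K x \<rightarrow>\<^sub>M paths"
    using x by (simp add: measurable_cong_sets[OF sets_chain_law refl])
  have "shift -` X \<inter> space (chain_law S K x) = {\<omega> \<in> space paths. shift \<omega> \<in> X}"
    using x by auto
  then have "emeasure (chain_law S K x) {\<omega> \<in> space paths. shift \<omega> \<in> X}
      = emeasure (distr (chain_law S K x) paths shift) X"
    by (simp add: emeasure_distr[OF meas X])
  also have "\<dots> = (\<integral>\<^sup>+y. emeasure (chain_law S K y) X \<partial>K x)"
    unfolding markov_property[OF x]
    using x X measurable_prob_algebraD[OF measurable_chain_law]
    by (intro emeasure_bind measurable_K) (auto simp: space_K)
  finally show ?thesis .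
qed

lemma emeasure_chain_law_at:
  assumes "x \<in> space S" and B [measurable]: "B \<in> sets S"
  shows "emeasure (chain_law S K x) {\<omega> \<in> space paths. \<omega> n \<in> B} = emeasure (kernel_power S K n x) B"
  using assms(1)
proof (induction n arbitrary: x)
  case 0
  let ?A = "\<lambda>i::nat. if i = 0 then B else space S"
  have "{\<omega> \<in> space paths. \<omega> 0 \<in> B} = {\<omega> \<in> space paths. \<forall>i. \<omega> i \<in> ?A i}"
    by (auto simp: space_PiM)
  then show ?case
    using emeasure_chain_law_cylinder[OF 0, of ?A 0] 0 B by simp
next
  case (Suc n)
  let ?X = "{\<omega> \<in> space paths. \<omega> n \<in> B}"
  have X: "?X \<in> sets paths"
    by measurable
  have "{\<omega> \<in> space paths. \<omega> (Suc n) \<in> B} = {\<omega> \<in> space paths. shift \<omega> \<in> ?X}"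
    using measurable_space[OF measurable_shift] by (auto simp: shift_def)
  then have "emeasure (chain_law S K x) {\<omega> \<in> space paths. \<omega> (Suc n) \<in> B}
      = (\<integral>\<^sup>+y. emeasure (chain_law S K y) ?X \<partial>K x)"
    using emeasure_chain_law_shift[OF Suc.prems X] by simp
  also have "\<dots> = (\<integral>\<^sup>+y. emeasure (kernel_power S K n y) B \<partial>K x)"
    using Suc by (intro nn_integral_cong) (simp add: space_K)
  finally show ?case
    using emeasure_kernel_power_Suc[OF Suc.prems B] by simp
qed

lemma AE_chain_law_start:
  assumes x: "x \<in> space S" and g [measurable]: "g \<in> S \<rightarrow>\<^sub>M (borel :: real measure)"
  shows "AE \<omega> in chain_law S K x. g (\<omega> 0) = g x"
proof -
  interpret P: prob_space "chain_law S K x"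
    using x by (rule prob_space_chain_law)
  have B: "{y \<in> space S. g y = g x} \<in> sets S"
    by measurable
  have "emeasure (chain_law S K x) {\<omega> \<in> space paths. \<omega> 0 \<in> {y \<in> space S. g y = g x}} = 1"
    using emeasure_chain_law_at[OF x B, of 0] x B by simp
  moreover have "{\<omega> \<in> space paths. \<omega> 0 \<in> {y \<in> space S. g y = g x}} \<in> sets paths"
    by measurable
  ultimately have "AE \<omega> in chain_law S K x. \<omega> \<in> {\<omega> \<in> space paths. \<omega> 0 \<in> {y \<in> space S. g y = g x}}"
    using x by (subst P.AE_in_set_eq_1) (simp_all add: P.emeasure_eq_measure)
  then show ?thesis
    by eventually_elim simp
qed

end

section \<open>Chains with an accessible atom\<close>

lemma emeasure_singleton_eq_0:
  assumes "{a} \<in> sets M" "AE y in M. y \<noteq> a"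
  shows "emeasure M {a} = 0"
proof -
  have "{y \<in> space M. \<not> y \<noteq> a} = {a}"
    using sets.sets_into_space[OF assms(1)] by auto
  from AE_iff_measurable[OF assms(1) this] assms(2) show ?thesis
    by simp
qed

context kernel
begin

lemma measurable_kernel_power: "x \<in> space S \<Longrightarrow> f \<in> S \<rightarrow>\<^sub>M N \<Longrightarrow> f \<in> kernel_power S K n x \<rightarrow>\<^sub>M N"
  by (simp add: measurable_cong_sets[OF sets_kernel_power refl])

lemma integrable_kernel:
  fixes f :: "'a \<Rightarrow> real"
  assumes L: "L \<in> M \<rightarrow>\<^sub>M prob_algebra S" and x: "x \<in> space M"
    and f: "f \<in> borel_measurable S" "\<And>x. x \<in> space S \<Longrightarrow> \<bar>f x\<bar> \<le> B"
  shows "integrable (L x) f"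
proof -
  interpret prob_space "L x"
    using L x by (rule prob_space_kernel_prob)
  have "f \<in> borel_measurable (L x)"
    using f(1) by (simp add: measurable_cong_sets[OF sets_kernel_prob[OF L x] refl])
  then show ?thesis
    using f(2) by (intro integrable_const_bound[where B = B]) (auto simp: space_kernel_prob[OF L x])
qed

lemma integral_kernel_bounds:
  fixes f :: "'a \<Rightarrow> real"
  assumes L: "L \<in> M \<rightarrow>\<^sub>M prob_algebra S" and x: "x \<in> space M"
    and f: "f \<in> borel_measurable S" "\<And>x. x \<in> space S \<Longrightarrow> 0 \<le> f x \<and> f x \<le> 1"
  shows "0 \<le> (\<integral>y. f y \<partial>L x)" "(\<integral>y. f y \<partial>L x) \<le> 1"
proof -
  interpret prob_space "L x"
    using L x by (rule prob_space_kernel_prob)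
  have i: "integrable (L x) f"
    using f(2) by (intro integrable_kernel[OF L x f(1), of 1]) (auto simp: abs_le_iff intro: order_trans)
  show "0 \<le> (\<integral>y. f y \<partial>L x)"
    using f(2) by (intro Bochner_Integration.integral_nonneg) (auto simp: space_kernel_prob[OF L x])
  have "(\<integral>y. f y \<partial>L x) \<le> (\<integral>y. 1 \<partial>L x)"
    using f(2) i by (intro integral_mono) (auto simp: space_kernel_prob[OF L x])
  then show "(\<integral>y. f y \<partial>L x) \<le> 1"
    by (simp add: prob_space)
qed

lemma measurable_integral_kernel:
  fixes f :: "'a \<Rightarrow> real"
  assumes "L \<in> M \<rightarrow>\<^sub>M prob_algebra S" "f \<in> borel_measurable S"
  shows "(\<lambda>x. \<integral>y. f y \<partial>L x) \<in> borel_measurable M"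
  using measurable_compose[OF measurable_prob_algebraD[OF assms(1)] integral_measurable_subprob_algebra[OF assms(2)]] .

lemma integral_kernel_bind:
  fixes f :: "'a \<Rightarrow> real"
  assumes M: "prob_space M" and L: "L \<in> M \<rightarrow>\<^sub>M prob_algebra S"
    and f: "f \<in> borel_measurable S" "\<And>x. x \<in> space S \<Longrightarrow> \<bar>f x\<bar> \<le> B"
  shows "(\<integral>y. f y \<partial>(M \<bind> L)) = (\<integral>x. \<integral>y. f y \<partial>L x \<partial>M)"
proof (rule integral_bind[OF f measurable_prob_algebraD[OF L], where B' = 1])
  show "finite_measure M"
    using M by (rule prob_space.finite_measure)
  show "AE x in M. emeasure (L x) (space (L x)) \<le> ennreal 1"
    using L by (intro AE_I2) (simp add: prob_space.emeasure_space_1 prob_space_kernel_prob)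
qed

end

locale stationary_kernel = kernel +
  fixes \<mu>
  assumes invariant: "invariant_distribution S K \<mu>"
begin

lemma sets_stationary [measurable_cong, simp]: "sets \<mu> = sets S"
  using invariant by (simp add: invariant_distribution_def)

lemma space_stationary [simp]: "space \<mu> = space S"
  using sets_stationary by (rule sets_eq_imp_space_eq)

sublocale \<mu>: prob_space \<mu>
  using invariant by (simp add: invariant_distribution_def)

lemma bind_stationary: "\<mu> \<bind> kernel_power S K n = \<mu>"
proof (induction n)
  case 0
  have "kernel_power S K 0 = return S" by auto
  then show ?case
    by (simp add: bind_return'')
next
  case (Suc n)
  have ne: "space \<mu> \<noteq> {}"
    by (rule \<mu>.not_empty)
  have "kernel_power S K (Suc n) = (\<lambda>x. kernel_power S K n x \<bind> K)"
    by auto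
  then have "\<mu> \<bind> kernel_power S K (Suc n) = (\<mu> \<bind> kernel_power S K n) \<bind> K"
    by (simp add: bind_assoc[where N = S and R = S])
  also have "\<dots> = \<mu> \<bind> K"
    using Suc by simp
  also have "\<dots> = \<mu>"
  proof (rule measure_eqI)
    show "sets (\<mu> \<bind> K) = sets \<mu>"
      using ne by (subst sets_bind[where N = S]) (auto simp: sets_K)
    fix A assume "A \<in> sets (\<mu> \<bind> K)"
    then have "A \<in> sets S"
      using ne by (subst (asm) sets_bind[where N = S]) (auto simp: sets_K)
    then show "emeasure (\<mu> \<bind> K) A = emeasure \<mu> A"
      using invariant ne
      by (subst emeasure_bind[where N = S]) (auto simp: invariant_distribution_def)
  qed
  finally show ?case .
qed

lemma integral_stationary:
  fixes f :: "'a \<Rightarrow> real"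
  assumes "f \<in> borel_measurable S" "\<And>x. x \<in> space S \<Longrightarrow> \<bar>f x\<bar> \<le> B"
  shows "(\<integral>x. \<integral>y. f y \<partial>kernel_power S K n x \<partial>\<mu>) = (\<integral>x. f x \<partial>\<mu>)"
  using integral_kernel_bind[OF \<mu>.prob_space_axioms _ assms, of "kernel_power S K n"]
  by (simp add: bind_stationary)

lemma emeasure_stationary:
  assumes "A \<in> sets S"
  shows "(\<integral>\<^sup>+x. emeasure (kernel_power S K n x) A \<partial>\<mu>) = emeasure \<mu> A"
  using emeasure_bind[of \<mu> "kernel_power S K n" S A] assms \<mu>.not_empty
  by (simp add: bind_stationary)

end

locale atom_kernel = kernel +
  fixes a
  assumes atom: "a \<in> space S" "{a} \<in> sets S"
    and accessible: "x \<in> space S \<Longrightarrow> \<exists>n. emeasure (kernel_power S K n x) {a} > 0"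

locale stationary_atom = stationary_kernel + atom_kernel
begin

text \<open>By stationarity \<open>u (X\<^sub>0)\<close> and \<open>u (X\<^sub>n)\<close> have the same second moment, and \<open>u \<le> P\<^sup>n u\<close> bounds their
  mixed moment from below by it; hence the mean square of \<open>u (X\<^sub>n) - u (X\<^sub>0)\<close> is at most zero. For
  almost every starting point \<open>x\<close> this applies to the \<open>n\<close> at which the atom is reached from \<open>x\<close>.\<close>

lemma subharmonic_constant:
  fixes u :: "'a \<Rightarrow> real"
  assumes u [measurable]: "u \<in> borel_measurable S"
    and bd: "\<And>x. x \<in> space S \<Longrightarrow> 0 \<le> u x \<and> u x \<le> 1"
    and sub: "\<And>x. x \<in> space S \<Longrightarrow> u x \<le> (\<integral>y. u y \<partial>K x)"
  shows "AE x in \<mu>. u x = u a"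
proof -
  let ?P = "kernel_power S K"
  have bd': "\<bar>u x\<bar> \<le> 1" "\<bar>(u x)\<^sup>2\<bar> \<le> 1" if "x \<in> space S" for x
    using bd[OF that] by (auto simp: abs_le_iff power_le_one)
  note int = integrable_kernel[OF kernel_power_measurable _ u bd'(1)]
  have sub_n: "u x \<le> (\<integral>y. u y \<partial>?P n x)" if x: "x \<in> space S" for x n
  proof (induction n)
    case 0
    then show ?case using x by (simp add: integral_return)
  next
    case (Suc n)
    have Px: "prob_space (?P n x)"
      using x by (rule prob_space_kernel_power)
    have Kx: "K \<in> ?P n x \<rightarrow>\<^sub>M prob_algebra S"
      using x K by (rule measurable_kernel_power)
    have "(\<integral>y. u y \<partial>?P n x) \<le> (\<integral>y. \<integral>z. u z \<partial>K y \<partial>?P n x)"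
    proof (rule integral_mono)
      show "integrable (?P n x) u"
        using x by (rule int)
      show "integrable (?P n x) (\<lambda>y. \<integral>z. u z \<partial>K y)"
        using x integral_kernel_bounds[OF K _ u bd]
        by (intro integrable_kernel[where B = 1, OF kernel_power_measurable] measurable_integral_kernel[OF K u])
          (auto simp: abs_le_iff intro: order_trans)
      show "u y \<le> (\<integral>z. u z \<partial>K y)" if "y \<in> space (?P n x)" for y
        using that x by (intro sub) (simp add: space_kernel_power)
    qed
    also have "\<dots> = (\<integral>y. u y \<partial>?P (Suc n) x)"
      using integral_kernel_bind[OF Px Kx u bd'(1)] by simp
    finally show ?case
      using Suc by simp
  qed
  \<comment> \<open>the conditional mean square of \<open>u (X\<^sub>n) - u (X\<^sub>0)\<close>, expanded so that it can be integrated termwise\<close>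
  define D where "D n x = (\<integral>y. (u y)\<^sup>2 \<partial>?P n x) - 2 * u x * (\<integral>y. u y \<partial>?P n x) + (u x)\<^sup>2" for n x
  have D_eq: "D n x = (\<integral>y. (u y - u x)\<^sup>2 \<partial>?P n x)" and D_int: "integrable (?P n x) (\<lambda>y. (u y - u x)\<^sup>2)"
    if x: "x \<in> space S" for n x
  proof -
    interpret P: prob_space "?P n x"
      using x by (rule prob_space_kernel_power)
    have [simp]: "integrable (?P n x) u" "integrable (?P n x) (\<lambda>y. (u y)\<^sup>2)"
      using x bd' by (auto intro!: int integrable_kernel[OF kernel_power_measurable, where B = 1])
    have *: "(\<lambda>y. (u y - u x)\<^sup>2) = (\<lambda>y. (u y)\<^sup>2 - 2 * u x * u y + (u x)\<^sup>2)"
      by (auto simp: power2_eq_square algebra_simps)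
    show "integrable (?P n x) (\<lambda>y. (u y - u x)\<^sup>2)"
      unfolding * by simp
    show "D n x = (\<integral>y. (u y - u x)\<^sup>2 \<partial>?P n x)"
      unfolding * D_def by (simp add: P.prob_space)
  qed
  have "AE x in \<mu>. D n x = 0" for n
  proof -
    have m [measurable]: "(\<lambda>x. \<integral>y. u y \<partial>?P n x) \<in> borel_measurable S"
      "(\<lambda>x. \<integral>y. (u y)\<^sup>2 \<partial>?P n x) \<in> borel_measurable S"
      by (intro measurable_integral_kernel[OF kernel_power_measurable]; measurable)+
    have b: "0 \<le> (\<integral>y. u y \<partial>?P n x)" "(\<integral>y. u y \<partial>?P n x) \<le> 1"
      "0 \<le> (\<integral>y. (u y)\<^sup>2 \<partial>?P n x)" "(\<integral>y. (u y)\<^sup>2 \<partial>?P n x) \<le> 1" if "x \<in> space S" for x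
      using integral_kernel_bounds[OF kernel_power_measurable that u bd]
        integral_kernel_bounds[OF kernel_power_measurable that, of "\<lambda>y. (u y)\<^sup>2"] bd
      by (auto simp: power_le_one)
    have i: "integrable \<mu> (\<lambda>x. \<integral>y. (u y)\<^sup>2 \<partial>?P n x)" "integrable \<mu> (\<lambda>x. u x * (\<integral>y. u y \<partial>?P n x))"
      "integrable \<mu> (\<lambda>x. (u x)\<^sup>2)"
      using b bd' bd
      by (auto intro!: \<mu>.integrable_const_bound[where B = 1] simp: abs_mult mult_le_one)
    have D_alt: "D n = (\<lambda>x. (\<integral>y. (u y)\<^sup>2 \<partial>?P n x) - 2 * (u x * (\<integral>y. u y \<partial>?P n x)) + (u x)\<^sup>2)"
      by (auto simp: D_def)
    have D_i: "integrable \<mu> (D n)"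
      unfolding D_alt using i by simp
    have D_pos: "0 \<le> D n x" if "x \<in> space S" for x
      unfolding D_eq[OF that] by simp
    have "(\<integral>x. (u x)\<^sup>2 \<partial>\<mu>) \<le> (\<integral>x. u x * (\<integral>y. u y \<partial>?P n x) \<partial>\<mu>)"
      using i sub_n bd by (intro integral_mono) (auto simp: power2_eq_square mult_left_mono)
    moreover have "(\<integral>x. \<integral>y. (u y)\<^sup>2 \<partial>?P n x \<partial>\<mu>) = (\<integral>x. (u x)\<^sup>2 \<partial>\<mu>)"
      using bd'(2) by (intro integral_stationary) auto
    ultimately have "(\<integral>x. D n x \<partial>\<mu>) \<le> 0"
      unfolding D_alt using i by simp
    moreover have "0 \<le> (\<integral>x. D n x \<partial>\<mu>)"
      using D_pos by (intro Bochner_Integration.integral_nonneg) simp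
    ultimately have "(\<integral>x. D n x \<partial>\<mu>) = 0"
      by simp
    then show ?thesis
      using D_i D_pos by (subst (asm) integral_nonneg_eq_0_iff_AE) auto
  qed
  then have "AE x in \<mu>. \<forall>n. D n x = 0"
    by (simp add: AE_all_countable)
  then show ?thesis
  proof (rule AE_mp, intro AE_I2 impI)
    fix x assume "x \<in> space \<mu>" and D0: "\<forall>n. D n x = 0"
    then have x: "x \<in> space S"
      by simp
    then obtain n where n: "emeasure (?P n x) {a} > 0"
      using accessible by blast
    have "(\<integral>y. (u y - u x)\<^sup>2 \<partial>?P n x) = 0"
      using D0 D_eq[OF x] by simp
    then have "AE y in ?P n x. (u y - u x)\<^sup>2 = 0"
      using D_int[OF x] by (subst (asm) integral_nonneg_eq_0_iff_AE) auto
    then have AE: "AE y in ?P n x. u y = u x"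
      by eventually_elim simp
    show "u x = u a"
    proof (rule ccontr)
      assume "u x \<noteq> u a"
      then have "AE y in ?P n x. y \<noteq> a"
        by - (rule AE_mp[OF AE], rule AE_I2, auto)
      then have "emeasure (?P n x) {a} = 0"
        using x atom by (intro emeasure_singleton_eq_0) (simp add: sets_kernel_power)
      with n show False by simp
    qed
  qed
qed

lemma atom_mass: "emeasure \<mu> {a} > 0"
proof (rule ccontr)
  assume "\<not> emeasure \<mu> {a} > 0"
  then have "(\<integral>\<^sup>+x. emeasure (kernel_power S K n x) {a} \<partial>\<mu>) = 0" for n
    using emeasure_stationary[OF atom(2)] by simp
  then have "AE x in \<mu>. emeasure (kernel_power S K n x) {a} = 0" for n
    using atom by (subst (asm) nn_integral_0_iff_AE) auto
  then have "AE x in \<mu>. \<forall>n. emeasure (kernel_power S K n x) {a} = 0"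
    by (simp add: AE_all_countable)
  then have "AE x in \<mu>. False"
    by (rule AE_mp) (use accessible in \<open>force intro!: AE_I2\<close>)
  then show False
    by simp
qed

end

subsection \<open>Convergence in total variation by coupling\<close>

lemma distr_pair_snd:
  assumes "prob_space M" "prob_space N"
  shows "distr (M \<Otimes>\<^sub>M N) N snd = N"
proof (rule measure_eqI)
  interpret M: prob_space M by fact
  interpret N: prob_space N by fact
  fix A assume "A \<in> sets (distr (M \<Otimes>\<^sub>M N) N snd)"
  then have A: "A \<in> sets N" by simp
  then have "snd -` A \<inter> space (M \<Otimes>\<^sub>M N) = space M \<times> A"
    using sets.sets_into_space[OF A] by (auto simp: space_pair_measure)
  then show "emeasure (distr (M \<Otimes>\<^sub>M N) N snd) A = emeasure N A"
    using A by (simp add: emeasure_distr N.emeasure_pair_measure_Times M.emeasure_space_1)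
qed simp

text \<open>Since the chain may stay in its atom, the times at which it can be there contain all large
  integers. This aperiodicity makes the pair of atoms accessible to two independent copies.\<close>

locale strong_atom = atom_kernel +
  assumes stay: "emeasure (K a) {a} > 0"
begin

definition pair_kernel :: "'a \<times> 'a \<Rightarrow> ('a \<times> 'a) measure" where
  "pair_kernel z = K (fst z) \<Otimes>\<^sub>M K (snd z)"

lemma measurable_pair_kernel: "pair_kernel \<in> S \<Otimes>\<^sub>M S \<rightarrow>\<^sub>M prob_algebra (S \<Otimes>\<^sub>M S)"
  unfolding pair_kernel_def[abs_def] by measurable

sublocale pair: kernel "S \<Otimes>\<^sub>M S" pair_kernel
  by standard (rule measurable_pair_kernel)

lemma eventually_at_atom:
  assumes x: "x \<in> space S"
  shows "\<exists>N. \<forall>n\<ge>N. emeasure (kernel_power S K n x) {a} > 0"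
proof -
  obtain N where N: "emeasure (kernel_power S K N x) {a} > 0"
    using accessible[OF x] by blast
  have "emeasure (kernel_power S K n x) {a} > 0" if "n \<ge> N" for n
    using that
  proof (induction rule: dec_induct)
    case (step n)
    have "0 < emeasure (K a) {a} * emeasure (kernel_power S K n x) {a}"
      using step stay by (simp add: ennreal_zero_less_mult_iff)
    also have "\<dots> = (\<integral>\<^sup>+y. emeasure (K a) {a} * indicator {a} y \<partial>kernel_power S K n x)"
      using x atom by (intro nn_integral_cmult_indicator[symmetric]) (simp add: sets_kernel_power)
    also have "\<dots> \<le> (\<integral>\<^sup>+y. emeasure (K y) {a} \<partial>kernel_power S K n x)"
      by (intro nn_integral_mono) (auto split: split_indicator)
    also have "\<dots> = emeasure (kernel_power S K n x \<bind> K) {a}"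
      using x atom measurable_kernel_power[OF x K_subprob]
      by (intro emeasure_bind[symmetric, where N = S]) (auto simp: space_kernel_power)
    finally show ?case
      by simp
  qed (use N in simp)
  then show ?thesis
    by blast
qed

lemma pair_power_at_atom:
  assumes "x \<in> space S" "y \<in> space S"
  shows "emeasure (kernel_power (S \<Otimes>\<^sub>M S) pair_kernel n (x, y)) {(a, a)}
    = emeasure (kernel_power S K n x) {a} * emeasure (kernel_power S K n y) {a}"
  using assms
proof (induction n arbitrary: x y)
  case 0
  have "{(a, a)} \<in> sets (S \<Otimes>\<^sub>M S)"
    using pair_measureI[OF atom(2) atom(2)] by simp
  then show ?case
    using atom by (auto split: split_indicator)
next
  case (Suc n)
  let ?f = "\<lambda>x. emeasure (kernel_power S K n x) {a}"
  have A: "{(a, a)} \<in> sets (S \<Otimes>\<^sub>M S)"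
    using pair_measureI[OF atom(2) atom(2)] by simp
  have f [measurable]: "?f \<in> borel_measurable S"
    using atom(2) by measurable
  have fx: "?f \<in> borel_measurable (K x)" "?f \<in> borel_measurable (K y)"
    using Suc.prems f by (auto intro: measurable_K)
  interpret Ky: prob_space "K y"
    using Suc.prems by (intro prob_space_K)
  have "emeasure (kernel_power (S \<Otimes>\<^sub>M S) pair_kernel (Suc n) (x, y)) {(a, a)}
      = (\<integral>\<^sup>+z. emeasure (kernel_power (S \<Otimes>\<^sub>M S) pair_kernel n z) {(a, a)} \<partial>pair_kernel (x, y))"
    using Suc.prems A by (intro pair.emeasure_kernel_power_Suc) (simp_all add: space_pair_measure)
  also have "\<dots> = (\<integral>\<^sup>+z. ?f (fst z) * ?f (snd z) \<partial>pair_kernel (x, y))"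
    using Suc pair.space_K[of "(x, y)"]
    by (intro nn_integral_cong) (auto simp: space_pair_measure)
  also have "\<dots> = (\<integral>\<^sup>+x'. \<integral>\<^sup>+y'. ?f x' * ?f y' \<partial>K y \<partial>K x)"
    unfolding pair_kernel_def fst_conv snd_conv
    using fx by (subst Ky.nn_integral_fst[symmetric]) simp_all
  also have "\<dots> = (\<integral>\<^sup>+x'. ?f x' \<partial>K x) * (\<integral>\<^sup>+y'. ?f y' \<partial>K y)"
    using fx by (simp add: nn_integral_cmult nn_integral_multc)
  finally show ?case
    using Suc.prems atom by (simp add: emeasure_kernel_power_Suc del: kernel_power.simps)
qed

sublocale pair: atom_kernel "S \<Otimes>\<^sub>M S" pair_kernel "(a, a)"
proof
  show "(a, a) \<in> space (S \<Otimes>\<^sub>M S)"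
    using atom by (simp add: space_pair_measure)
  show "{(a, a)} \<in> sets (S \<Otimes>\<^sub>M S)"
    using pair_measureI[OF atom(2) atom(2)] by simp
  fix z assume "z \<in> space (S \<Otimes>\<^sub>M S)"
  then obtain x y where z: "z = (x, y)" "x \<in> space S" "y \<in> space S"
    by (auto simp: space_pair_measure)
  obtain N M where "\<forall>n\<ge>N. emeasure (kernel_power S K n x) {a} > 0"
    "\<forall>n\<ge>M. emeasure (kernel_power S K n y) {a} > 0"
    using eventually_at_atom z by meson
  then have "emeasure (kernel_power S K (max N M) x) {a} > 0" "emeasure (kernel_power S K (max N M) y) {a} > 0"
    by auto
  then show "\<exists>n. emeasure (kernel_power (S \<Otimes>\<^sub>M S) pair_kernel n z) {(a, a)} > 0"
    unfolding z(1) using z(2,3)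
    by (intro exI[of _ "max N M"]) (simp add: pair_power_at_atom ennreal_zero_less_mult_iff)
qed

text \<open>The probability that two independent copies started in \<open>z\<close> have not been in the atom at the same
  time up to time \<open>n\<close>.\<close>

primrec unmet :: "nat \<Rightarrow> 'a \<times> 'a \<Rightarrow> real" where
  "unmet 0 z = (if z = (a, a) then 0 else 1)"
| "unmet (Suc n) z = (if z = (a, a) then 0 else \<integral>w. unmet n w \<partial>pair_kernel z)"

lemma measurable_unmet [measurable]: "unmet n \<in> borel_measurable (S \<Otimes>\<^sub>M S)"
proof (induction n)
  have "{z \<in> space (S \<Otimes>\<^sub>M S). z = (a, a)} = {(a, a)}"
    using pair.atom(1) by auto
  then have [measurable]: "Measurable.pred (S \<Otimes>\<^sub>M S) (\<lambda>z. z = (a, a))"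
    using pair.atom(2) by (simp add: pred_def)
  {
    case 0
    have "unmet 0 = (\<lambda>z. if z = (a, a) then 0 else 1)" by auto
    then show ?case by simp
  next
    case (Suc n)
    have [measurable]: "(\<lambda>z. \<integral>w. unmet n w \<partial>pair_kernel z) \<in> borel_measurable (S \<Otimes>\<^sub>M S)"
      using Suc by (rule pair.measurable_integral_kernel[OF pair.K])
    have "unmet (Suc n) = (\<lambda>z. if z = (a, a) then 0 else \<integral>w. unmet n w \<partial>pair_kernel z)" by auto
    then show ?case by simp
  }
qed

lemma unmet_bounds: "z \<in> space (S \<Otimes>\<^sub>M S) \<Longrightarrow> 0 \<le> unmet n z \<and> unmet n z \<le> 1"
proof (induction n arbitrary: z)
  case (Suc n)
  then show ?case
    using pair.integral_kernel_bounds[OF pair.K _ measurable_unmet, of z n] by simp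
qed simp

lemma integrable_unmet: "z \<in> space (S \<Otimes>\<^sub>M S) \<Longrightarrow> integrable (pair_kernel z) (unmet n)"
  using unmet_bounds
  by (intro pair.integrable_kernel[where B = 1, OF pair.K]) auto

lemma unmet_Suc_le: "z \<in> space (S \<Otimes>\<^sub>M S) \<Longrightarrow> unmet (Suc n) z \<le> unmet n z"
proof (induction n arbitrary: z)
  case 0
  then show ?case
    using unmet_bounds[of z "Suc 0"] by (cases "z = (a, a)") simp_all
next
  case (Suc n)
  have "(\<integral>w. unmet (Suc n) w \<partial>pair_kernel z) \<le> (\<integral>w. unmet n w \<partial>pair_kernel z)"
    using Suc by (intro integral_mono integrable_unmet) (simp_all add: pair.space_K del: unmet.simps)
  then show ?case
    by (simp only: unmet.simps(2) split: if_split) simp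
qed

text \<open>After a common visit to the atom both copies have the same law, so the difference is zero; before
  it, the bound is propagated by one step of the product chain.\<close>

lemma coupling_inequality:
  assumes "x \<in> space S" "y \<in> space S" and C: "C \<in> sets S"
  shows "\<bar>measure (kernel_power S K n x) C - measure (kernel_power S K n y) C\<bar> \<le> unmet n (x, y)"
  using assms(1,2)
proof (induction n arbitrary: x y)
  case 0
  then show ?case
    using C by (simp add: measure_return split: split_indicator)
next
  case (Suc n)
  let ?m = "\<lambda>x. measure (kernel_power S K n x) C"
  have m [measurable]: "?m \<in> borel_measurable S"
    using C by measurable
  have m1: "\<bar>?m x\<bar> \<le> 1" if "x \<in> space S" for x
    using prob_space.prob_le_1[OF prob_space_kernel_power[OF that]] by (simp add: measure_nonneg)
  have step: "measure (kernel_power S K (Suc n) x) C = (\<integral>y. ?m y \<partial>K x)" if x: "x \<in> space S" for x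
    unfolding kernel_power_first_step[OF x]
  proof (rule subprob_space.measure_bind)
    show "subprob_space (K x)"
      using prob_space_K[OF x] by (rule prob_space_imp_subprob_space)
    show "kernel_power S K n \<in> K x \<rightarrow>\<^sub>M subprob_algebra S"
      using x kernel_power_subprob by (rule measurable_K)
  qed fact
  show ?case
  proof (cases "x = a \<and> y = a")
    case False
    interpret Kx: prob_space "K x" using Suc.prems by (intro prob_space_K)
    interpret Ky: prob_space "K y" using Suc.prems by (intro prob_space_K)
    have z: "(x, y) \<in> space (S \<Otimes>\<^sub>M S)"
      using Suc.prems by (simp add: space_pair_measure)
    have i: "integrable (pair_kernel (x, y)) (\<lambda>w. ?m (fst w))" "integrable (pair_kernel (x, y)) (\<lambda>w. ?m (snd w))"
      using z m1 by (auto intro!: pair.integrable_kernel[where B = 1, OF pair.K] simp: space_pair_measure)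
    have "(\<integral>y. ?m y \<partial>K x) = (\<integral>y. ?m y \<partial>distr (K x \<Otimes>\<^sub>M K y) (K x) fst)"
      by (simp add: Ky.distr_pair_fst)
    also have "\<dots> = (\<integral>w. ?m (fst w) \<partial>pair_kernel (x, y))"
      using measurable_K[OF _ m] Suc.prems by (subst integral_distr) (simp_all add: pair_kernel_def)
    finally have 1: "(\<integral>y. ?m y \<partial>K x) = (\<integral>w. ?m (fst w) \<partial>pair_kernel (x, y))" .
    have "(\<integral>y. ?m y \<partial>K y) = (\<integral>y. ?m y \<partial>distr (K x \<Otimes>\<^sub>M K y) (K y) snd)"
      by (simp add: distr_pair_snd Kx.prob_space_axioms Ky.prob_space_axioms)
    also have "\<dots> = (\<integral>w. ?m (snd w) \<partial>pair_kernel (x, y))"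
      using measurable_K[OF _ m] Suc.prems by (subst integral_distr) (simp_all add: pair_kernel_def)
    finally have 2: "(\<integral>y. ?m y \<partial>K y) = (\<integral>w. ?m (snd w) \<partial>pair_kernel (x, y))" .
    have "\<bar>(\<integral>y. ?m y \<partial>K x) - (\<integral>z. ?m z \<partial>K y)\<bar> = \<bar>\<integral>w. ?m (fst w) - ?m (snd w) \<partial>pair_kernel (x, y)\<bar>"
      unfolding 1 2 using i by simp
    also have "\<dots> \<le> (\<integral>w. \<bar>?m (fst w) - ?m (snd w)\<bar> \<partial>pair_kernel (x, y))"
      by (rule integral_abs_bound)
    also have "\<dots> \<le> (\<integral>w. unmet n w \<partial>pair_kernel (x, y))"
    proof (rule integral_mono)
      show "integrable (pair_kernel (x, y)) (\<lambda>w. \<bar>?m (fst w) - ?m (snd w)\<bar>)"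
        using i by simp
      show "\<bar>?m (fst w) - ?m (snd w)\<bar> \<le> unmet n w" if "w \<in> space (pair_kernel (x, y))" for w
        using that Suc.IH[of "fst w" "snd w"] z by (auto simp: pair.space_K space_pair_measure)
    qed (use z integrable_unmet in simp)
    finally show ?thesis
      using False Suc.prems by (simp add: step del: kernel_power.simps)
  qed simp
qed

end

locale stationary_strong_atom = stationary_kernel + strong_atom
begin

sublocale stationary_atom ..

sublocale pair: stationary_atom "S \<Otimes>\<^sub>M S" pair_kernel "\<mu> \<Otimes>\<^sub>M \<mu>" "(a, a)"
proof
  have pp: "prob_space (\<mu> \<Otimes>\<^sub>M \<mu>)"
    using \<mu>.prob_space_axioms \<mu>.prob_space_axioms by (rule prob_space_pair)
  have sets [simp]: "sets (\<mu> \<Otimes>\<^sub>M \<mu>) = sets (S \<Otimes>\<^sub>M S)"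
    by (intro sets_pair_measure_cong) simp_all
  have k: "pair_kernel \<in> \<mu> \<Otimes>\<^sub>M \<mu> \<rightarrow>\<^sub>M subprob_algebra (S \<Otimes>\<^sub>M S)"
    using pair.K_subprob by (simp add: measurable_cong_sets[OF sets refl])
  have ne: "space (\<mu> \<Otimes>\<^sub>M \<mu>) \<noteq> {}"
    using pp by (rule prob_space.not_empty)
  have "\<mu> \<Otimes>\<^sub>M \<mu> = (\<mu> \<Otimes>\<^sub>M \<mu>) \<bind> pair_kernel"
  proof (rule pair_measure_eqI)
    have "sets ((\<mu> \<Otimes>\<^sub>M \<mu>) \<bind> pair_kernel) = sets (S \<Otimes>\<^sub>M S)"
      using ne by (intro sets_bind) (auto simp: pair.sets_K sets_eq_imp_space_eq[OF sets])
    then show "sets (\<mu> \<Otimes>\<^sub>M \<mu>) = sets ((\<mu> \<Otimes>\<^sub>M \<mu>) \<bind> pair_kernel)"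
      by simp
    fix A B assume "A \<in> sets \<mu>" "B \<in> sets \<mu>"
    then have AB: "A \<in> sets S" "B \<in> sets S" by simp_all
    have [measurable]: "(\<lambda>x. emeasure (K x) A) \<in> borel_measurable S" "(\<lambda>x. emeasure (K x) B) \<in> borel_measurable S"
      using AB by measurable
    have "emeasure ((\<mu> \<Otimes>\<^sub>M \<mu>) \<bind> pair_kernel) (A \<times> B) = (\<integral>\<^sup>+z. emeasure (pair_kernel z) (A \<times> B) \<partial>(\<mu> \<Otimes>\<^sub>M \<mu>))"
      using AB by (intro emeasure_bind[OF ne k]) simp
    also have "\<dots> = (\<integral>\<^sup>+z. emeasure (K (fst z)) A * emeasure (K (snd z)) B \<partial>(\<mu> \<Otimes>\<^sub>M \<mu>))"
    proof (rule nn_integral_cong)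
      fix z assume "z \<in> space (\<mu> \<Otimes>\<^sub>M \<mu>)"
      then have z: "fst z \<in> space S" "snd z \<in> space S"
        by (auto simp: space_pair_measure)
      then interpret prob_space "K (snd z)" by (intro prob_space_K)
      show "emeasure (pair_kernel z) (A \<times> B) = emeasure (K (fst z)) A * emeasure (K (snd z)) B"
        unfolding pair_kernel_def using z AB by (intro emeasure_pair_measure_Times) (simp_all add: sets_K)
    qed
    also have "\<dots> = (\<integral>\<^sup>+x. \<integral>\<^sup>+y. emeasure (K x) A * emeasure (K y) B \<partial>\<mu> \<partial>\<mu>)"
      by (subst \<mu>.nn_integral_fst[symmetric]) simp_all
    also have "\<dots> = (\<integral>\<^sup>+x. emeasure (K x) A \<partial>\<mu>) * (\<integral>\<^sup>+y. emeasure (K y) B \<partial>\<mu>)"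
      by (simp add: nn_integral_cmult nn_integral_multc)
    finally show "emeasure \<mu> A * emeasure \<mu> B = emeasure ((\<mu> \<Otimes>\<^sub>M \<mu>) \<bind> pair_kernel) (A \<times> B)"
      using invariant AB by (simp add: invariant_distribution_def)
  qed (simp_all add: \<mu>.sigma_finite_measure_axioms)
  then have "emeasure (\<mu> \<Otimes>\<^sub>M \<mu>) B = (\<integral>\<^sup>+z. emeasure (pair_kernel z) B \<partial>(\<mu> \<Otimes>\<^sub>M \<mu>))" if "B \<in> sets (S \<Otimes>\<^sub>M S)" for B
    using emeasure_bind[OF ne k that] by simp
  then show "invariant_distribution (S \<Otimes>\<^sub>M S) pair_kernel (\<mu> \<Otimes>\<^sub>M \<mu>)"
    using pp by (simp add: invariant_distribution_def)
qed

text \<open>The probability of never meeting is harmonic away from the pair of atoms and zero there, hence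
  subharmonic, and so it is almost everywhere equal to its value at the pair of atoms.\<close>

lemma AE_unmet_tendsto_0: "AE z in \<mu> \<Otimes>\<^sub>M \<mu>. (\<lambda>n. unmet n z) \<longlonglongrightarrow> 0"
proof -
  define u where "u z = lim (\<lambda>n. unmet n z)" for z
  have conv: "(\<lambda>n. unmet n z) \<longlonglongrightarrow> u z" if z: "z \<in> space (S \<Otimes>\<^sub>M S)" for z
  proof -
    have "Bseq (\<lambda>n. unmet n z)"
      using unmet_bounds[OF z] by (intro BseqI'[of _ 1]) auto
    moreover have "decseq (\<lambda>n. unmet n z)"
      using unmet_Suc_le[OF z] by (rule decseq_SucI)
    ultimately show ?thesis
      unfolding u_def by (intro convergent_LIMSEQ_iff[THEN iffD1] Bseq_monoseq_convergent decseq_imp_monoseq)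
  qed
  have u [measurable]: "u \<in> borel_measurable (S \<Otimes>\<^sub>M S)"
    by (rule borel_measurable_LIMSEQ_metric[OF measurable_unmet conv])
  have bd: "0 \<le> u z \<and> u z \<le> 1" if z: "z \<in> space (S \<Otimes>\<^sub>M S)" for z
    using unmet_bounds[OF z] conv[OF z] by (auto intro: LIMSEQ_le_const LIMSEQ_le_const2)
  have u_aa: "u (a, a) = 0"
  proof -
    have "unmet n (a, a) = 0" for n by (cases n) auto
    then show ?thesis by (simp add: u_def)
  qed
  have "u z \<le> (\<integral>w. u w \<partial>pair_kernel z)" if z: "z \<in> space (S \<Otimes>\<^sub>M S)" for z
  proof (cases "z = (a, a)")
    case True
    then show ?thesis
      using pair.integral_kernel_bounds(1)[OF pair.K z u bd] u_aa by simp
  next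
    case False
    interpret Q: prob_space "pair_kernel z" using z by (rule pair.prob_space_K)
    have "(\<lambda>n. \<integral>w. unmet n w \<partial>pair_kernel z) \<longlonglongrightarrow> (\<integral>w. u w \<partial>pair_kernel z)"
      using unmet_bounds conv z
      by (intro integral_dominated_convergence[where w = "\<lambda>_. 1"] pair.measurable_K[OF z] u measurable_unmet AE_I2)
        (auto simp: pair.space_K)
    moreover have "(\<lambda>n. \<integral>w. unmet n w \<partial>pair_kernel z) \<longlonglongrightarrow> u z"
      using LIMSEQ_Suc[OF conv[OF z]] False by simp
    ultimately have "u z = (\<integral>w. u w \<partial>pair_kernel z)"
      by (rule LIMSEQ_unique[rotated])
    then show ?thesis
      by simp
  qed
  from pair.subharmonic_constant[OF u bd this] have "AE z in \<mu> \<Otimes>\<^sub>M \<mu>. u z = 0"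
    by (simp add: u_aa)
  then show ?thesis
  proof (rule AE_mp, intro AE_I2 impI)
    fix z assume "z \<in> space (\<mu> \<Otimes>\<^sub>M \<mu>)" "u z = 0"
    then show "(\<lambda>n. unmet n z) \<longlonglongrightarrow> 0"
      using conv[of z] by simp
  qed
qed

definition tv_dist :: "nat \<Rightarrow> 'a \<Rightarrow> real" where
  "tv_dist n x = (SUP C\<in>sets S. \<bar>measure (kernel_power S K n x) C - measure \<mu> C\<bar>)"

lemma
  assumes x: "x \<in> space S"
  shows setwise_le_tv_dist: "C \<in> sets S \<Longrightarrow> \<bar>measure (kernel_power S K n x) C - measure \<mu> C\<bar> \<le> tv_dist n x"
    and tv_dist_le_unmet: "tv_dist n x \<le> (\<integral>y. unmet n (x, y) \<partial>\<mu>)"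
proof -
  have xy: "(\<lambda>y. (x, y)) \<in> S \<rightarrow>\<^sub>M S \<Otimes>\<^sub>M S"
    using x by simp
  have i: "integrable \<mu> (\<lambda>y. unmet n (x, y))"
    using x unmet_bounds measurable_compose[OF xy measurable_unmet]
    by (intro \<mu>.integrable_const_bound[where B = 1]) (auto simp: space_pair_measure)
  have le: "\<bar>measure (kernel_power S K n x) C - measure \<mu> C\<bar> \<le> (\<integral>y. unmet n (x, y) \<partial>\<mu>)" if C: "C \<in> sets S" for C
  proof -
    have C' [measurable]: "(\<lambda>y. measure (kernel_power S K n y) C) \<in> borel_measurable S"
      using C by measurable
    have iC: "integrable \<mu> (\<lambda>y. measure (kernel_power S K n y) C)"
      using prob_space.prob_le_1[OF prob_space_kernel_power]
      by (intro \<mu>.integrable_const_bound[where B = 1]) (auto simp: measure_nonneg)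
    have "measure \<mu> C = measure (\<mu> \<bind> kernel_power S K n) C"
      by (simp add: bind_stationary)
    also have "\<dots> = (\<integral>y. measure (kernel_power S K n y) C \<partial>\<mu>)"
      using C kernel_power_subprob
      by (intro subprob_space.measure_bind[where N = S]) (simp_all add: prob_space_imp_subprob_space \<mu>.prob_space_axioms)
    finally have "measure (kernel_power S K n x) C - measure \<mu> C
        = (\<integral>y. measure (kernel_power S K n x) C - measure (kernel_power S K n y) C \<partial>\<mu>)"
      using iC \<mu>.prob_space by simp
    also have "\<bar>\<dots>\<bar> \<le> (\<integral>y. \<bar>measure (kernel_power S K n x) C - measure (kernel_power S K n y) C\<bar> \<partial>\<mu>)"
      by (rule integral_abs_bound)
    also have "\<dots> \<le> (\<integral>y. unmet n (x, y) \<partial>\<mu>)"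
      using coupling_inequality[OF x _ C] iC i by (intro integral_mono) simp_all
    finally show ?thesis .
  qed
  have "bdd_above ((\<lambda>C. \<bar>measure (kernel_power S K n x) C - measure \<mu> C\<bar>) ` sets S)"
    using le by (intro bdd_aboveI2)
  then show "C \<in> sets S \<Longrightarrow> \<bar>measure (kernel_power S K n x) C - measure \<mu> C\<bar> \<le> tv_dist n x"
    unfolding tv_dist_def by (rule cSUP_upper[rotated])
  show "tv_dist n x \<le> (\<integral>y. unmet n (x, y) \<partial>\<mu>)"
    unfolding tv_dist_def using le by (intro cSUP_least) auto
qed

theorem AE_tv_dist_tendsto_0: "AE x in \<mu>. (\<lambda>n. tv_dist n x) \<longlonglongrightarrow> 0"
proof -
  interpret mm: pair_sigma_finite \<mu> \<mu> ..
  have "AE x in \<mu>. AE y in \<mu>. (\<lambda>n. unmet n (x, y)) \<longlonglongrightarrow> 0"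
    using mm.AE_pair[OF AE_unmet_tendsto_0] .
  then show ?thesis
  proof (rule AE_mp, intro AE_I2 impI)
    fix x assume "x \<in> space \<mu>" and AE: "AE y in \<mu>. (\<lambda>n. unmet n (x, y)) \<longlonglongrightarrow> 0"
    then have x: "x \<in> space S" by simp
    have xy: "(\<lambda>y. (x, y)) \<in> S \<rightarrow>\<^sub>M S \<Otimes>\<^sub>M S"
      using x by simp
    have "(\<lambda>n. \<integral>y. unmet n (x, y) \<partial>\<mu>) \<longlonglongrightarrow> (\<integral>y. 0 \<partial>\<mu>)"
      using unmet_bounds x AE measurable_compose[OF xy measurable_unmet]
      by (intro integral_dominated_convergence[where w = "\<lambda>_. 1"]) (auto simp: space_pair_measure)
    then have lim: "(\<lambda>n. \<integral>y. unmet n (x, y) \<partial>\<mu>) \<longlonglongrightarrow> 0"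
      by simp
    have "0 \<le> tv_dist n x" for n
      using setwise_le_tv_dist[OF x, of "{}" n] by simp
    then show "(\<lambda>n. tv_dist n x) \<longlonglongrightarrow> 0"
      using tv_dist_le_unmet[OF x] by (intro tendsto_sandwich[OF _ _ tendsto_const lim]) auto
  qed
qed

text \<open>An almost sure statement holds in the atom, as the atom is not a null set.\<close>

lemma tendsto_from_atom:
  assumes C: "C \<in> sets S"
  shows "(\<lambda>n. measure (kernel_power S K n a) C) \<longlonglongrightarrow> measure \<mu> C"
proof -
  have "(\<lambda>n. tv_dist n a) \<longlonglongrightarrow> 0"
  proof (rule ccontr)
    assume "\<not> (\<lambda>n. tv_dist n a) \<longlonglongrightarrow> 0"
    then have "AE x in \<mu>. x \<noteq> a"
      by - (rule AE_mp[OF AE_tv_dist_tendsto_0], rule AE_I2, auto)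
    then have "emeasure \<mu> {a} = 0"
      using atom by (intro emeasure_singleton_eq_0) simp_all
    with atom_mass show False by simp
  qed
  then have "(\<lambda>n. measure (kernel_power S K n a) C - measure \<mu> C) \<longlonglongrightarrow> 0"
    by (rule Lim_null_comparison[rotated]) (simp add: setwise_le_tv_dist[OF atom(1) C])
  then show ?thesis
    by (simp add: LIM_zero_iff)
qed

text \<open>The limit in \<open>tendsto_from_atom\<close> is the same for every invariant distribution.\<close>

theorem invariant_distribution_unique:
  assumes \<nu>: "invariant_distribution S K \<nu>"
  shows "\<nu> = \<mu>"
proof (rule measure_eqI)
  interpret \<nu>: stationary_strong_atom S K \<nu> a
    using \<nu> by unfold_locales
  show "sets \<nu> = sets \<mu>" by simp
  fix A assume "A \<in> sets \<nu>"
  then have "A \<in> sets S" by simp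
  then have "measure \<nu> A = measure \<mu> A"
    using LIMSEQ_unique[OF \<nu>.tendsto_from_atom tendsto_from_atom] by simp
  then show "emeasure \<nu> A = emeasure \<mu> A"
    by (simp add: \<nu>.\<mu>.emeasure_eq_measure \<mu>.emeasure_eq_measure)
qed

end

subsection \<open>The law of large numbers\<close>

text \<open>The largest of the partial sums of lengths \<open>1\<close> to \<open>n + 1\<close> of \<open>f\<close> along the orbit of \<open>\<omega>\<close>.\<close>

primrec orbit_max :: "('b \<Rightarrow> 'b) \<Rightarrow> ('b \<Rightarrow> real) \<Rightarrow> nat \<Rightarrow> 'b \<Rightarrow> real" where
  "orbit_max T f 0 \<omega> = f \<omega>"
| "orbit_max T f (Suc n) \<omega> = f \<omega> + max 0 (orbit_max T f n (T \<omega>))"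

lemma sum_le_orbit_max: "(\<Sum>i<Suc n. f ((T ^^ i) \<omega>)) \<le> orbit_max T f n \<omega>"
proof (induction n arbitrary: \<omega>)
  case (Suc n)
  have "(\<Sum>i<Suc (Suc n). f ((T ^^ i) \<omega>)) = f \<omega> + (\<Sum>i<Suc n. f ((T ^^ i) (T \<omega>)))"
    by (subst sum.lessThan_Suc_shift) (simp add: funpow_swap1)
  then show ?case
    using Suc[of "T \<omega>"] by simp
qed simp

lemma orbit_max_mono: "orbit_max T f n \<omega> \<le> orbit_max T f (Suc n) \<omega>"
proof (induction n arbitrary: \<omega>)
  case (Suc n)
  have "max 0 (orbit_max T f n (T \<omega>)) \<le> max 0 (orbit_max T f (Suc n) (T \<omega>))"
    using Suc by (rule max.mono[OF order_refl])
  then show ?case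
    by (simp del: orbit_max.simps add: orbit_max.simps(2)[of T f n] orbit_max.simps(2)[of T f "Suc n"])
qed simp

lemma orbit_max_ge: "f \<omega> \<le> orbit_max T f n \<omega>"
  by (cases n) auto

text \<open>Write \<open>M\<^sub>n\<close> for \<open>orbit_max T f n\<close>. As \<open>T\<close> and \<open>A\<close> are invariant, the integral over \<open>A\<close> of
  \<open>M\<^sub>n\<^sub>+\<^sub>1 - M\<^sub>n \<circ> T\<close> equals that of \<open>M\<^sub>n\<^sub>+\<^sub>1 - M\<^sub>n\<close>, which is nonnegative. The recursion identifies the
  first integrand with \<open>f + max 0 (- M\<^sub>n \<circ> T)\<close>, which is eventually \<open>f\<close> on \<open>A\<close>.\<close>

lemma (in prob_space) maximal_ergodic:
  fixes f :: "'a \<Rightarrow> real"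
  assumes T [measurable]: "T \<in> M \<rightarrow>\<^sub>M M" and T_inv: "distr M M T = M"
    and f: "integrable M f"
    and A [measurable]: "A \<in> sets M" and A_inv: "\<And>\<omega>. \<omega> \<in> space M \<Longrightarrow> T \<omega> \<in> A \<longleftrightarrow> \<omega> \<in> A"
    and pos: "\<And>\<omega>. \<omega> \<in> A \<Longrightarrow> \<exists>n. (\<Sum>i<n. f ((T ^^ i) \<omega>)) > 0"
  shows "0 \<le> (\<integral>\<omega>. indicator A \<omega> * f \<omega> \<partial>M)"
proof -
  let ?m = "orbit_max T f"
  have comp: "integrable M (\<lambda>\<omega>. g (T \<omega>))" "(\<integral>\<omega>. g (T \<omega>) \<partial>M) = (\<integral>\<omega>. g \<omega> \<partial>M)"
    if "integrable M g" for g :: "'a \<Rightarrow> real"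
    using that integrable_distr_eq[OF T, of g] integral_distr[OF T, of g] by (simp_all add: T_inv)
  have m_int: "integrable M (?m n)" for n
  proof (induction n)
    case 0
    have "?m 0 = f" by auto
    then show ?case using f by simp
  next
    case (Suc n)
    have "?m (Suc n) = (\<lambda>\<omega>. f \<omega> + max 0 (?m n (T \<omega>)))" by auto
    then show ?case using f comp(1)[OF Suc] by simp
  qed
  have ind: "integrable M (\<lambda>\<omega>. indicator A \<omega> * g \<omega>)" if "integrable M g" for g :: "'a \<Rightarrow> real"
    using integrable_mult_indicator[OF A that] by simp
  let ?d = "\<lambda>n \<omega>. ?m (Suc n) \<omega> - ?m n (T \<omega>)"
  have "0 \<le> (\<integral>\<omega>. indicator A \<omega> * ?d n \<omega> \<partial>M)" for n
  proof -
    have "(\<integral>\<omega>. indicator A \<omega> * ?m n (T \<omega>) \<partial>M) = (\<integral>\<omega>. indicator A (T \<omega>) * ?m n (T \<omega>) \<partial>M)"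
      using A_inv by (intro Bochner_Integration.integral_cong) (auto simp: indicator_def)
    also have "\<dots> = (\<integral>\<omega>. indicator A \<omega> * ?m n \<omega> \<partial>M)"
      using comp(2)[OF ind[OF m_int]] .
    also have "\<dots> \<le> (\<integral>\<omega>. indicator A \<omega> * ?m (Suc n) \<omega> \<partial>M)"
      by (intro integral_mono ind m_int mult_left_mono orbit_max_mono) simp
    finally show ?thesis
      using ind[OF comp(1)[OF m_int[of n]]] ind[OF m_int[of "Suc n"]]
      by (simp add: right_diff_distrib del: orbit_max.simps)
  qed
  moreover have "(\<lambda>n. \<integral>\<omega>. indicator A \<omega> * ?d n \<omega> \<partial>M) \<longlonglongrightarrow> (\<integral>\<omega>. indicator A \<omega> * f \<omega> \<partial>M)"
  proof (rule integral_dominated_convergence[where w = "\<lambda>\<omega>. \<bar>f \<omega>\<bar> + \<bar>f (T \<omega>)\<bar>"])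
    show "(\<lambda>\<omega>. indicator A \<omega> * f \<omega>) \<in> borel_measurable M"
      using ind[OF f] by (rule borel_measurable_integrable)
    show "(\<lambda>\<omega>. indicator A \<omega> * ?d n \<omega>) \<in> borel_measurable M" for n
      by (intro borel_measurable_integrable ind Bochner_Integration.integrable_diff m_int comp)
    show "integrable M (\<lambda>\<omega>. \<bar>f \<omega>\<bar> + \<bar>f (T \<omega>)\<bar>)"
      using f comp(1)[OF f] by simp
    show "AE \<omega> in M. norm (indicator A \<omega> * ?d n \<omega>) \<le> \<bar>f \<omega>\<bar> + \<bar>f (T \<omega>)\<bar>" for n
    proof (rule AE_I2)
      fix \<omega>
      show "norm (indicator A \<omega> * ?d n \<omega>) \<le> \<bar>f \<omega>\<bar> + \<bar>f (T \<omega>)\<bar>"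
        using orbit_max_ge[of f "T \<omega>" T n] by (auto simp: indicator_def)
    qed
    show "AE \<omega> in M. (\<lambda>n. indicator A \<omega> * ?d n \<omega>) \<longlonglongrightarrow> indicator A \<omega> * f \<omega>"
    proof (rule AE_I2)
      fix \<omega> assume \<omega>: "\<omega> \<in> space M"
      show "(\<lambda>n. indicator A \<omega> * ?d n \<omega>) \<longlonglongrightarrow> indicator A \<omega> * f \<omega>"
      proof (cases "\<omega> \<in> A")
        case True
        then have "T \<omega> \<in> A" using A_inv \<omega> by simp
        from pos[OF this] obtain k where k: "(\<Sum>i<k. f ((T ^^ i) (T \<omega>))) > 0" by blast
        then obtain k' where "k = Suc k'" by (cases k) auto
        with k have "?m k' (T \<omega>) > 0"
          using sum_le_orbit_max[of f T "T \<omega>" k'] by simp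
        moreover have "incseq (\<lambda>n. ?m n (T \<omega>))"
          by (intro incseq_SucI orbit_max_mono)
        ultimately have "?m n (T \<omega>) > 0" if "n \<ge> k'" for n
          using that by (meson incseqD less_le_trans)
        \<comment> \<open>once a maximum is positive, the correction \<open>max 0 (- M\<^sub>n (T \<omega>))\<close> is zero for good\<close>
        then have "\<forall>\<^sub>F n in sequentially. indicator A \<omega> * ?d n \<omega> = indicator A \<omega> * f \<omega>"
          unfolding eventually_sequentially by (intro exI[of _ k']) (simp add: less_imp_le max_absorb2)
        then show ?thesis
          by (rule tendsto_eventually)
      qed simp
    qed
  qed
  ultimately show ?thesis
    by (intro LIMSEQ_le_const) auto
qed

lemma averages_tendsto_0:
  fixes a :: "nat \<Rightarrow> real"
  assumes up: "\<And>k. bdd_above (range (\<lambda>n. \<Sum>i<n. a i - 1 / real (Suc k)))"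
    and lo: "\<And>k. bdd_above (range (\<lambda>n. \<Sum>i<n. - a i - 1 / real (Suc k)))"
  shows "(\<lambda>n. (\<Sum>j=1..n. a j) / real n) \<longlonglongrightarrow> 0"
proof (rule LIMSEQ_I)
  fix e :: real assume e: "e > 0"
  obtain k where k: "inverse (real (Suc k)) < e / 2"
    using reals_Archimedean[of "e / 2"] e by auto
  obtain C1 where C1: "\<And>n. (\<Sum>i<n. a i - 1 / real (Suc k)) \<le> C1"
    using up[of k] by (auto simp: bdd_above_def)
  obtain C2 where C2: "\<And>n. (\<Sum>i<n. - a i - 1 / real (Suc k)) \<le> C2"
    using lo[of k] by (auto simp: bdd_above_def)
  \<comment> \<open>The hypotheses sum from index 0, the averages from 1: the term \<open>a 0\<close> and one more copy of the slack,
    at most 1, go into the constant.\<close>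
  define C where "C = max C1 C2 + \<bar>a 0\<bar> + 1"
  have shift: "(\<Sum>i<Suc n. a i) = a 0 + (\<Sum>j=1..n. a j)" for n
    by (simp only: sum.lessThan_Suc_shift sum.atLeast1_atMost_eq One_nat_def)
  have "\<bar>\<Sum>j=1..n. a j\<bar> \<le> C + real n * inverse (real (Suc k))" for n
  proof -
    have "(\<Sum>i<Suc n. a i) - real (Suc n) / real (Suc k) \<le> C1" "- (\<Sum>i<Suc n. a i) - real (Suc n) / real (Suc k) \<le> C2"
      using C1[of "Suc n"] C2[of "Suc n"] by (simp_all add: sum_subtractf sum_negf del: sum.lessThan_Suc of_nat_Suc)
    moreover have "real (Suc n) / real (Suc k) = real n * inverse (real (Suc k)) + inverse (real (Suc k))"
      by (simp add: field_simps)
    moreover have "inverse (real (Suc k)) \<le> 1"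
      by (simp add: field_simps)
    ultimately show ?thesis
      unfolding shift C_def by linarith
  qed
  note bound = this
  obtain n0 :: nat where n0: "2 * C / e < real n0"
    using reals_Archimedean2 by blast
  show "\<exists>no. \<forall>n\<ge>no. norm ((\<Sum>j=1..n. a j) / real n - 0) < e"
  proof (intro exI allI impI)
    fix n assume n: "n \<ge> Suc n0"
    then have "2 * C / e < real n" using n0 by linarith
    then have "C < real n * (e / 2)"
      using e by (simp add: field_simps)
    moreover have "real n * inverse (real (Suc k)) \<le> real n * (e / 2)"
      using k by (intro mult_left_mono) auto
    ultimately have "\<bar>\<Sum>j=1..n. a j\<bar> < real n * e"
      using bound[of n] by linarith
    then show "norm ((\<Sum>j=1..n. a j) / real n - 0) < e"
      using n by (simp add: abs_divide field_simps)
  qed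
qed

text \<open>Convergence in terms of countably many conditions, which exhibits the event as measurable.\<close>

lemma LIMSEQ_countable_iff:
  fixes X :: "nat \<Rightarrow> real"
  shows "X \<longlonglongrightarrow> L \<longleftrightarrow> (\<forall>k. \<exists>N. \<forall>n\<ge>N. \<bar>X n - L\<bar> < inverse (real (Suc k)))"
proof
  assume "X \<longlonglongrightarrow> L"
  then show "\<forall>k. \<exists>N. \<forall>n\<ge>N. \<bar>X n - L\<bar> < inverse (real (Suc k))"
    by (auto simp: LIMSEQ_iff simp del: of_nat_Suc)
next
  assume *: "\<forall>k. \<exists>N. \<forall>n\<ge>N. \<bar>X n - L\<bar> < inverse (real (Suc k))"
  show "X \<longlonglongrightarrow> L"
  proof (rule LIMSEQ_I)
    fix e :: real assume "e > 0"
    then obtain k where "inverse (real (Suc k)) < e"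
      using reals_Archimedean by blast
    then show "\<exists>N. \<forall>n\<ge>N. norm (X n - L) < e"
      using *[rule_format, of k] by (auto intro: less_trans)
  qed
qed

context kernel
begin

lemma shift_funpow: "(shift ^^ i) \<omega> = (\<lambda>j. \<omega> (i + j))"
  by (induction i arbitrary: \<omega>) (auto simp: funpow_swap1 shift_def simp del: funpow.simps(2) simp add: funpow_Suc_right)

lemma measurable_coordinate [measurable]: "(\<lambda>\<omega>. \<omega> i) \<in> paths \<rightarrow>\<^sub>M S"
  by (rule measurable_component_singleton) simp

definition unbounded_paths :: "('a \<Rightarrow> real) \<Rightarrow> (nat \<Rightarrow> 'a) set" where
  "unbounded_paths f = {\<omega> \<in> space paths. \<forall>N::nat. \<exists>n. (\<Sum>i<n. f (\<omega> i)) > real N}"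

lemma unbounded_paths_sets [measurable]:
  assumes f [measurable]: "f \<in> borel_measurable S"
  shows "unbounded_paths f \<in> sets paths"
  unfolding unbounded_paths_def by measurable

text \<open>Dropping the first term changes all partial sums by the same finite amount.\<close>

lemma shift_unbounded_paths:
  assumes \<omega>: "\<omega> \<in> space paths"
  shows "shift \<omega> \<in> unbounded_paths f \<longleftrightarrow> \<omega> \<in> unbounded_paths f"
proof -
  have eq: "(\<Sum>i<Suc n. f (\<omega> i)) = f (\<omega> 0) + (\<Sum>i<n. f (shift \<omega> i))" for n
    by (simp only: sum.lessThan_Suc_shift shift_def)
  have sp: "shift \<omega> \<in> space paths"
    using measurable_space[OF measurable_shift \<omega>] .
  show ?thesis
  proof
    assume *: "shift \<omega> \<in> unbounded_paths f"
    have "\<exists>n. (\<Sum>i<n. f (\<omega> i)) > real N" for N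
    proof -
      obtain n where "(\<Sum>i<n. f (shift \<omega> i)) > real (nat \<lceil>real N + \<bar>f (\<omega> 0)\<bar>\<rceil>)"
        using * unfolding unbounded_paths_def by blast
      then have "(\<Sum>i<Suc n. f (\<omega> i)) > real N"
        unfolding eq by linarith
      then show ?thesis by blast
    qed
    then show "\<omega> \<in> unbounded_paths f"
      using \<omega> by (simp add: unbounded_paths_def)
  next
    assume *: "\<omega> \<in> unbounded_paths f"
    have "\<exists>n. (\<Sum>i<n. f (shift \<omega> i)) > real N" for N
    proof -
      \<comment> \<open>the level is raised to make up for the dropped term\<close>
      obtain n where n: "(\<Sum>i<n. f (\<omega> i)) > real (nat \<lceil>real N + \<bar>f (\<omega> 0)\<bar>\<rceil>)"
        using * unfolding unbounded_paths_def by blast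
      then obtain m where "n = Suc m"
        by (cases n) auto
      with n have "f (\<omega> 0) + (\<Sum>i<m. f (shift \<omega> i)) > real (nat \<lceil>real N + \<bar>f (\<omega> 0)\<bar>\<rceil>)"
        by (simp only: eq)
      then have "(\<Sum>i<m. f (shift \<omega> i)) > real N"
        by linarith
      then show ?thesis by blast
    qed
    then show "shift \<omega> \<in> unbounded_paths f"
      using sp by (simp add: unbounded_paths_def)
  qed
qed

end

context stationary_kernel
begin

definition stationary_law :: "(nat \<Rightarrow> 'a) measure" where
  "stationary_law = \<mu> \<bind> chain_law S K"

lemma chain_law_measurable_\<mu>: "chain_law S K \<in> \<mu> \<rightarrow>\<^sub>M subprob_algebra paths"
  using measurable_prob_algebraD[OF measurable_chain_law] by (simp add: measurable_cong_sets[OF sets_stationary refl])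

lemma sets_stationary_law [simp]: "sets stationary_law = sets paths"
  unfolding stationary_law_def using \<mu>.not_empty by (intro sets_bind) auto

lemma space_stationary_law [simp]: "space stationary_law = space paths"
  using sets_stationary_law by (rule sets_eq_imp_space_eq)

lemma prob_space_stationary_law: "prob_space stationary_law"
  unfolding stationary_law_def
  using prob_space_chain_law by (intro \<mu>.prob_space_bind[OF _ chain_law_measurable_\<mu>] AE_I2) simp

lemma emeasure_stationary_law:
  "X \<in> sets paths \<Longrightarrow> emeasure stationary_law X = (\<integral>\<^sup>+x. emeasure (chain_law S K x) X \<partial>\<mu>)"
  unfolding stationary_law_def by (intro emeasure_bind[OF \<mu>.not_empty chain_law_measurable_\<mu>])

lemma nn_integral_stationary:
  assumes f [measurable]: "f \<in> borel_measurable S"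
  shows "(\<integral>\<^sup>+x. \<integral>\<^sup>+y. f y \<partial>K x \<partial>\<mu>) = (\<integral>\<^sup>+x. f x \<partial>\<mu>)"
proof -
  have "(\<integral>\<^sup>+x. \<integral>\<^sup>+y. f y \<partial>K x \<partial>\<mu>) = (\<integral>\<^sup>+x. \<integral>\<^sup>+y. f y \<partial>kernel_power S K 1 x \<partial>\<mu>)"
    using bind_return[OF K_subprob] by (intro nn_integral_cong) simp
  also have "\<dots> = (\<integral>\<^sup>+x. f x \<partial>(\<mu> \<bind> kernel_power S K 1))"
    using kernel_power_subprob by (intro nn_integral_bind[symmetric, where B = S])
      (simp_all only: f measurable_cong_sets[OF sets_stationary refl])
  finally show ?thesis
    by (simp only: bind_stationary)
qed

lemma shift_stationary_law: "distr stationary_law paths shift = stationary_law"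
proof (rule measure_eqI)
  fix X assume "X \<in> sets (distr stationary_law paths shift)"
  then have X [measurable]: "X \<in> sets paths" by simp
  have meas: "shift \<in> stationary_law \<rightarrow>\<^sub>M paths"
    using measurable_shift by (simp add: measurable_cong_sets[OF sets_stationary_law refl])
  have X': "{\<omega> \<in> space paths. shift \<omega> \<in> X} \<in> sets paths"
    by measurable
  have "shift -` X \<inter> space stationary_law = {\<omega> \<in> space paths. shift \<omega> \<in> X}"
    by auto
  then have "emeasure (distr stationary_law paths shift) X = emeasure stationary_law {\<omega> \<in> space paths. shift \<omega> \<in> X}"
    by (simp add: emeasure_distr[OF meas X])
  also have "\<dots> = (\<integral>\<^sup>+x. \<integral>\<^sup>+y. emeasure (chain_law S K y) X \<partial>K x \<partial>\<mu>)"
    unfolding emeasure_stationary_law[OF X'] using X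
    by (intro nn_integral_cong emeasure_chain_law_shift) simp_all
  also have "\<dots> = (\<integral>\<^sup>+x. emeasure (chain_law S K x) X \<partial>\<mu>)"
    using measurable_emeasure_kernel[OF measurable_prob_algebraD[OF measurable_chain_law] X] by (rule nn_integral_stationary)
  finally show "emeasure (distr stationary_law paths shift) X = emeasure stationary_law X"
    by (simp add: emeasure_stationary_law[OF X])
qed simp

lemma stationary_law_start: "distr stationary_law S (\<lambda>\<omega>. \<omega> 0) = \<mu>"
proof (rule measure_eqI)
  fix B assume "B \<in> sets (distr stationary_law S (\<lambda>\<omega>. \<omega> 0))"
  then have B [measurable]: "B \<in> sets S" by simp
  have meas: "(\<lambda>\<omega>. \<omega> 0) \<in> stationary_law \<rightarrow>\<^sub>M S"
    using measurable_coordinate by (simp add: measurable_cong_sets[OF sets_stationary_law refl])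
  have B': "{\<omega> \<in> space paths. \<omega> 0 \<in> B} \<in> sets paths"
    by measurable
  have "(\<lambda>\<omega>. \<omega> 0) -` B \<inter> space stationary_law = {\<omega> \<in> space paths. \<omega> 0 \<in> B}"
    by auto
  then have "emeasure (distr stationary_law S (\<lambda>\<omega>. \<omega> 0)) B = emeasure stationary_law {\<omega> \<in> space paths. \<omega> 0 \<in> B}"
    by (simp add: emeasure_distr[OF meas B])
  also have "\<dots> = (\<integral>\<^sup>+x. indicator B x \<partial>\<mu>)"
    unfolding emeasure_stationary_law[OF B'] using B
    by (intro nn_integral_cong) (simp add: emeasure_chain_law_at[where n = 0, simplified])
  finally show "emeasure (distr stationary_law S (\<lambda>\<omega>. \<omega> 0)) B = emeasure \<mu> B"
    using B by simp
qed simp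

text \<open>Given its starting point \<open>x\<close>, a path almost surely starts in \<open>x\<close>, so an indicator of the starting
  point can be taken out of the inner integral.\<close>

lemma emeasure_stationary_law_start:
  assumes B [measurable]: "B \<in> sets S" and X [measurable]: "X \<in> sets paths"
  shows "emeasure stationary_law {\<omega> \<in> X. \<omega> 0 \<in> B} = (\<integral>\<^sup>+x. indicator B x * emeasure (chain_law S K x) X \<partial>\<mu>)"
proof -
  have eq: "{\<omega> \<in> X. \<omega> 0 \<in> B} = {\<omega> \<in> space paths. \<omega> \<in> X \<and> \<omega> 0 \<in> B}"
    using sets.sets_into_space[OF X] by auto
  have XB: "{\<omega> \<in> X. \<omega> 0 \<in> B} \<in> sets paths"
    unfolding eq by measurable
  have "emeasure (chain_law S K x) {\<omega> \<in> X. \<omega> 0 \<in> B} = indicator B x * emeasure (chain_law S K x) X"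
    if x: "x \<in> space S" for x
  proof -
    have "AE \<omega> in chain_law S K x. indicator B (\<omega> 0) = (indicator B x :: real)"
      using x by (rule AE_chain_law_start) measurable
    then have "AE \<omega> in chain_law S K x. \<omega> \<in> {\<omega> \<in> X. \<omega> 0 \<in> B} \<longleftrightarrow> \<omega> \<in> (if x \<in> B then X else {})"
      by eventually_elim (auto simp: indicator_def split: if_splits)
    then have "emeasure (chain_law S K x) {\<omega> \<in> X. \<omega> 0 \<in> B} = emeasure (chain_law S K x) (if x \<in> B then X else {})"
      using x XB X by (intro emeasure_eq_AE) auto
    then show ?thesis by simp
  qed
  then show ?thesis
    unfolding emeasure_stationary_law[OF XB] by (intro nn_integral_cong) simp
qed

end

context stationary_atom
begin

text \<open>The probability \<open>h x\<close> that the sums are unbounded above is harmonic, hence almost everywhere equal to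
  \<open>h a\<close>. Therefore the integral of \<open>f (\<omega> 0)\<close> over that event factors as \<open>h a\<close> times the mean of \<open>f\<close>;
  it is nonnegative by \<open>maximal_ergodic\<close>, which forces \<open>h a = 0\<close>.\<close>

lemma AE_sums_bounded:
  fixes f :: "'a \<Rightarrow> real"
  assumes f [measurable]: "f \<in> borel_measurable S" and f_int: "integrable \<mu> f"
    and neg: "(\<integral>x. f x \<partial>\<mu>) < 0"
  shows "AE x in \<mu>. AE \<omega> in chain_law S K x. bdd_above (range (\<lambda>n. \<Sum>i<n. f (\<omega> i)))"
proof -
  let ?A = "unbounded_paths f"
  interpret P: prob_space stationary_law
    by (rule prob_space_stationary_law)
  define h where "h x = measure (chain_law S K x) ?A" for x
  have A: "?A \<in> sets paths"
    by measurable
  have h_em: "emeasure (chain_law S K x) ?A = ennreal (h x)" if "x \<in> space S" for x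
    using prob_space_chain_law[OF that] unfolding h_def
    by (simp add: finite_measure.emeasure_eq_measure prob_space.finite_measure)
  have h [measurable]: "h \<in> borel_measurable S"
    using measurable_compose[OF measurable_prob_algebraD[OF measurable_chain_law] measurable_measure_subprob_algebra[OF A]]
    unfolding h_def .
  have h_bd: "0 \<le> h x \<and> h x \<le> 1" if "x \<in> space S" for x
    using prob_space.prob_le_1[OF prob_space_chain_law[OF that]] by (simp add: h_def)
  have "h x \<le> (\<integral>y. h y \<partial>K x)" if x: "x \<in> space S" for x
  proof -
    have "{\<omega> \<in> space paths. shift \<omega> \<in> ?A} = ?A"
      using shift_unbounded_paths sets.sets_into_space[OF A] by auto
    then have "ennreal (h x) = (\<integral>\<^sup>+y. emeasure (chain_law S K y) ?A \<partial>K x)"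
      using emeasure_chain_law_shift[OF x A] h_em[OF x] by simp
    also have "\<dots> = (\<integral>\<^sup>+y. ennreal (h y) \<partial>K x)"
      using x by (intro nn_integral_cong h_em) (simp add: space_K)
    also have "\<dots> = ennreal (\<integral>y. h y \<partial>K x)"
      using x h_bd integrable_kernel[OF K x h, of 1]
      by (intro nn_integral_eq_integral AE_I2) (auto simp: space_K)
    finally show ?thesis
      using integral_kernel_bounds(1)[OF K x h h_bd] h_bd[OF x] by simp
  qed
  from subharmonic_constant[OF h h_bd this] have h_const: "AE x in \<mu>. h x = h a" .
  have start: "(\<lambda>\<omega>. \<omega> 0) \<in> stationary_law \<rightarrow>\<^sub>M S"
    using measurable_coordinate by (simp add: measurable_cong_sets[OF sets_stationary_law refl])
  have "0 \<le> (\<integral>\<omega>. indicator ?A \<omega> * f (\<omega> 0) \<partial>stationary_law)"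
  proof (rule P.maximal_ergodic[where T = shift])
    show "shift \<in> stationary_law \<rightarrow>\<^sub>M stationary_law"
      using measurable_shift by (simp add: measurable_cong_sets[OF sets_stationary_law sets_stationary_law])
    show "distr stationary_law stationary_law shift = stationary_law"
      using shift_stationary_law by (simp add: distr_cong[OF refl sets_stationary_law refl])
    show "integrable stationary_law (\<lambda>\<omega>. f (\<omega> 0))"
      using f_int integrable_distr_eq[OF start f] by (simp add: stationary_law_start)
    show "?A \<in> sets stationary_law"
      using A by simp
    show "shift \<omega> \<in> ?A \<longleftrightarrow> \<omega> \<in> ?A" if "\<omega> \<in> space stationary_law" for \<omega>
      using that by (intro shift_unbounded_paths) simp
    show "\<exists>n. (\<Sum>i<n. f ((shift ^^ i) \<omega> 0)) > 0" if "\<omega> \<in> ?A" for \<omega>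
    proof -
      have "\<exists>n. (\<Sum>i<n. f (\<omega> i)) > real 0"
        using that unfolding unbounded_paths_def by blast
      then obtain n where "(\<Sum>i<n. f (\<omega> i)) > 0"
        by auto
      then show ?thesis
        by (intro exI[of _ n]) (simp add: shift_funpow)
    qed
  qed
  also have "(\<integral>\<omega>. indicator ?A \<omega> * f (\<omega> 0) \<partial>stationary_law) = h a * (\<integral>x. f x \<partial>\<mu>)"
  proof -
    have Am: "(\<lambda>\<omega>. indicator ?A \<omega> :: real) \<in> borel_measurable stationary_law"
      using A by (intro borel_measurable_indicator) simp
    let ?R = "distr (density stationary_law (\<lambda>\<omega>. ennreal (indicator ?A \<omega>))) S (\<lambda>\<omega>. \<omega> 0)"
    have "?R = density \<mu> (\<lambda>_. ennreal (h a))"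
    proof (rule measure_eqI)
      fix B assume "B \<in> sets (?R)"
      then have B [measurable]: "B \<in> sets S" by simp
      have B': "(\<lambda>\<omega>. \<omega> 0) -` B \<inter> space stationary_law \<in> sets stationary_law"
        using start B by (rule measurable_sets)
      have "emeasure (?R) B
          = (\<integral>\<^sup>+\<omega>. ennreal (indicator ?A \<omega>) * indicator ((\<lambda>\<omega>. \<omega> 0) -` B \<inter> space stationary_law) \<omega> \<partial>stationary_law)"
        using start B B' Am by (simp add: emeasure_distr emeasure_density)
      also have "\<dots> = (\<integral>\<^sup>+\<omega>. indicator {\<omega> \<in> ?A. \<omega> 0 \<in> B} \<omega> \<partial>stationary_law)"
        by (intro nn_integral_cong) (auto simp: indicator_def)
      also have "\<dots> = emeasure stationary_law {\<omega> \<in> ?A. \<omega> 0 \<in> B}"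
      proof (rule nn_integral_indicator)
        have "{\<omega> \<in> ?A. \<omega> 0 \<in> B} = ?A \<inter> ((\<lambda>\<omega>. \<omega> 0) -` B \<inter> space stationary_law)"
          using sets.sets_into_space[OF A] by auto
        then show "{\<omega> \<in> ?A. \<omega> 0 \<in> B} \<in> sets stationary_law"
          using A B' by simp
      qed
      also have "\<dots> = (\<integral>\<^sup>+x. indicator B x * ennreal (h x) \<partial>\<mu>)"
        unfolding emeasure_stationary_law_start[OF B A] by (intro nn_integral_cong) (simp add: h_em)
      also have "\<dots> = (\<integral>\<^sup>+x. ennreal (h a) * indicator B x \<partial>\<mu>)"
        using h_const by (intro nn_integral_cong_AE) (auto simp: mult.commute)
      also have "\<dots> = emeasure (density \<mu> (\<lambda>_. ennreal (h a))) B"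
        using B by (simp add: emeasure_density)
      finally show "emeasure (?R) B
          = emeasure (density \<mu> (\<lambda>_. ennreal (h a))) B" .
    qed simp
    then have "(\<integral>x. f x \<partial>?R)
        = (\<integral>x. f x \<partial>density \<mu> (\<lambda>_. ennreal (h a)))"
      by simp
    moreover have "(\<integral>x. f x \<partial>density \<mu> (\<lambda>_. ennreal (h a))) = h a * (\<integral>x. f x \<partial>\<mu>)"
    proof -
      have "f \<in> borel_measurable \<mu>"
        using f by (simp add: measurable_cong_sets[OF sets_stationary refl])
      then show ?thesis
        using h_bd[OF atom(1)] by (subst integral_density) simp_all
    qed
    moreover have "(\<integral>x. f x \<partial>?R)
        = (\<integral>\<omega>. indicator ?A \<omega> * f (\<omega> 0) \<partial>stationary_law)"
    proof -
      have "(\<lambda>\<omega>. f (\<omega> 0)) \<in> borel_measurable stationary_law"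
        using start f by (rule measurable_compose)
      then show ?thesis
        using start Am by (subst integral_distr) (simp_all add: integral_density)
    qed
    ultimately show ?thesis by simp
  qed
  finally have "h a = 0"
    using neg h_bd[OF atom(1)] by (auto simp: zero_le_mult_iff)
  with h_const have "AE x in \<mu>. h x = 0" by simp
  then show ?thesis
  proof (rule AE_mp[OF _ AE_I2[OF impI]])
    fix x assume "x \<in> space \<mu>" and "h x = 0"
    then have x: "x \<in> space S" and "emeasure (chain_law S K x) ?A = 0"
      using h_em by simp_all
    then have "AE \<omega> in chain_law S K x. \<omega> \<notin> ?A"
      using A by (intro AE_not_in null_setsI) simp_all
    then show "AE \<omega> in chain_law S K x. bdd_above (range (\<lambda>n. \<Sum>i<n. f (\<omega> i)))"
    proof (rule AE_mp, intro AE_I2 impI)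
      fix \<omega> assume "\<omega> \<in> space (chain_law S K x)" "\<omega> \<notin> ?A"
      then obtain N :: nat where "\<And>n. (\<Sum>i<n. f (\<omega> i)) \<le> real N"
        using x by (auto simp: unbounded_paths_def not_less)
      then show "bdd_above (range (\<lambda>n. \<Sum>i<n. f (\<omega> i)))"
        by (intro bdd_aboveI2)
    qed
  qed
qed

text \<open>Boundedness above of the sums of \<open>\<plusminus>(f - m) - 1 / (k + 1)\<close> for all \<open>k\<close> squeezes the averages of
  \<open>f - m\<close> to zero.\<close>

theorem law_of_large_numbers:
  fixes f :: "'a \<Rightarrow> real"
  assumes f [measurable]: "f \<in> borel_measurable S" and f_int: "integrable \<mu> f"
  shows "AE x in \<mu>. \<P>(\<omega> in chain_law S K x.
    (\<lambda>n. (\<Sum>j=1..n. f (\<omega> j)) / real n) \<longlonglongrightarrow> (\<integral>y. f y \<partial>\<mu>)) = 1"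
proof -
  define m where "m = (\<integral>y. f y \<partial>\<mu>)"
  let ?bd = "\<lambda>c k \<omega>. bdd_above (range (\<lambda>n. \<Sum>i<n. c * (f (\<omega> i) - m) - 1 / real (Suc k)))"
  have *: "AE x in \<mu>. AE \<omega> in chain_law S K x. ?bd c k \<omega>"
    for c :: real and k
  proof (rule AE_sums_bounded)
    show "(\<lambda>x. c * (f x - m) - 1 / real (Suc k)) \<in> borel_measurable S"
      by measurable
    show "integrable \<mu> (\<lambda>x. c * (f x - m) - 1 / real (Suc k))"
      using f_int by simp
    have "(\<integral>x. c * (f x - m) - 1 / real (Suc k) \<partial>\<mu>) = - (1 / real (Suc k))"
      using f_int \<mu>.prob_space by (simp add: m_def)
    then show "(\<integral>x. c * (f x - m) - 1 / real (Suc k) \<partial>\<mu>) < 0"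
      by simp
  qed
  have "AE x in \<mu>. \<forall>k. AE \<omega> in chain_law S K x. ?bd c k \<omega>"
    for c :: real
    using * by (subst AE_all_countable) blast
  from AE_conjI[OF this[of 1] this[of "-1"]] show ?thesis
  proof (rule AE_mp, intro AE_I2 impI, elim conjE)
    fix x assume "x \<in> space \<mu>"
      and up: "\<forall>k. AE \<omega> in chain_law S K x. ?bd 1 k \<omega>"
      and lo: "\<forall>k. AE \<omega> in chain_law S K x. ?bd (- 1) k \<omega>"
    then have x: "x \<in> space S" by simp
    interpret P: prob_space "chain_law S K x"
      using x by (rule prob_space_chain_law)
    have "{\<omega> \<in> space paths. (\<lambda>n. (\<Sum>j=1..n. f (\<omega> j)) / real n) \<longlonglongrightarrow> m} \<in> sets paths"
      unfolding LIMSEQ_countable_iff by measurable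
    moreover have "AE \<omega> in chain_law S K x. (\<lambda>n. (\<Sum>j=1..n. f (\<omega> j)) / real n) \<longlonglongrightarrow> m"
    proof -
      have "AE \<omega> in chain_law S K x. (\<forall>k. ?bd 1 k \<omega>)
        \<and> (\<forall>k. ?bd (- 1) k \<omega>)"
        using up lo by (simp only: AE_conj_iff AE_all_countable) blast
      then show ?thesis
      proof (rule AE_mp, intro AE_I2 impI)
        fix \<omega> :: "nat \<Rightarrow> 'a"
        assume "(\<forall>k. ?bd 1 k \<omega>)
          \<and> (\<forall>k. ?bd (- 1) k \<omega>)"
        then have "(\<lambda>n. (\<Sum>j=1..n. (f (\<omega> j) - m)) / real n) \<longlonglongrightarrow> 0"
          by (intro averages_tendsto_0) simp_all
        then have "(\<lambda>n. (\<Sum>j=1..n. (f (\<omega> j) - m)) / real n + m) \<longlonglongrightarrow> 0 + m"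
          by (intro tendsto_intros)
        moreover have "\<forall>\<^sub>F n in sequentially. (\<Sum>j=1..n. (f (\<omega> j) - m)) / real n + m = (\<Sum>j=1..n. f (\<omega> j)) / real n"
          using eventually_gt_at_top[of 0]
          by eventually_elim (simp add: sum_subtractf diff_divide_distrib)
        ultimately show "(\<lambda>n. (\<Sum>j=1..n. f (\<omega> j)) / real n) \<longlonglongrightarrow> m"
          by (simp add: filterlim_cong)
      qed
    qed
    ultimately show "\<P>(\<omega> in chain_law S K x. (\<lambda>n. (\<Sum>j=1..n. f (\<omega> j)) / real n) \<longlonglongrightarrow> (\<integral>y. f y \<partial>\<mu>)) = 1"
      using x unfolding m_def by (subst P.prob_Collect_eq_1) simp_all
  qed
qed

end

context stationary_strong_atom
begin

text \<open>The small set is the atom itself, so one step suffices in the minorization and no gcd condition is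
  left; the atom is hit with positive probability from every state, not only from almost every one.\<close>

lemma ADS_conditions_atom:
  assumes e: "0 < e" and minor: "ennreal e \<le> emeasure (K a) {a}"
  shows "ADS_conditions S K \<mu>"
  unfolding ADS_conditions_def
proof (intro conjI exI[of _ "{a}"] exI[of _ "return S a"] exI[of _ e] exI[of _ "1::nat"] invariant)
  show "{a} \<in> sets S" "sets (return S a) = sets S" "prob_space (return S a)" "emeasure (return S a) {a} = 1"
    using atom by (simp_all add: prob_space_return)
  have "measure (chain_law S K x) {\<omega> \<in> space (chain_law S K x). \<exists>m\<ge>1. \<omega> m \<in> {a}} > 0" if x: "x \<in> space S" for x
  proof -
    interpret P: prob_space "chain_law S K x"
      using x by (rule prob_space_chain_law)
    obtain N where N: "\<forall>n\<ge>N. emeasure (kernel_power S K n x) {a} > 0"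
      using eventually_at_atom[OF x] by blast
    \<comment> \<open>time 0 does not count as a visit\<close>
    let ?n = "max 1 N"
    have [measurable]: "{a} \<in> sets S" by (rule atom)
    have m: "{\<omega> \<in> space paths. \<exists>m\<ge>1. \<omega> m \<in> {a}} \<in> sets paths"
      by measurable
    have "0 < emeasure (chain_law S K x) {\<omega> \<in> space paths. \<omega> ?n \<in> {a}}"
      using N emeasure_chain_law_at[OF x atom(2), of ?n] by simp
    also have "\<dots> \<le> emeasure (chain_law S K x) {\<omega> \<in> space paths. \<exists>m\<ge>1. \<omega> m \<in> {a}}"
      using x m by (intro emeasure_mono) (auto intro!: exI[of _ ?n])
    finally show ?thesis
      using x by (simp add: P.emeasure_eq_measure)
  qed
  then have "{x \<in> space S. measure (chain_law S K x) {\<omega> \<in> space (chain_law S K x). \<exists>m\<ge>1. \<omega> m \<in> {a}} > 0} = space \<mu>"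
    by auto
  then show "emeasure \<mu> {x \<in> space S. measure (chain_law S K x) {\<omega> \<in> space (chain_law S K x). \<exists>m\<ge>1. \<omega> m \<in> {a}} > 0} = 1"
    by (simp only: \<mu>.emeasure_space_1)
  have K1: "kernel_power S K 1 a = K a"
    using bind_return[OF K_subprob atom(1)] by simp
  show "minorized S (kernel_power S K 1) {a} e (return S a)"
    unfolding minorized_def
  proof (intro ballI)
    fix x C assume "x \<in> {a}" and C: "C \<in> sets S"
    show "ennreal e * emeasure (return S a) C \<le> emeasure (kernel_power S K 1 x) C"
    proof (cases "a \<in> C")
      case True
      have "emeasure (K a) {a} \<le> emeasure (K a) C"
        using True C atom by (intro emeasure_mono) (simp_all add: sets_K)
      then show ?thesis
        using True C \<open>x \<in> {a}\<close> minor K1 by (simp add: order_trans del: kernel_power.simps One_nat_def)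
    qed (use C in simp)
  qed
qed (use e in simp_all)

end

section \<open>The state space\<close>

lemma prob_space_unit_leb: "prob_space unit_leb"
  by (rule prob_spaceI) (simp add: emeasure_restrict_space space_restrict_space)

interpretation unit_leb: product_sigma_finite "\<lambda>_::nat. unit_leb"
  by (rule product_sigma_finite.intro) (intro prob_space_imp_sigma_finite prob_space_unit_leb)

lemma measurable_Pair_layer: "k \<ge> 1 \<Longrightarrow> Pair k \<in> cube k \<rightarrow>\<^sub>M SX"
proof (rule measurableI)
  assume k: "k \<ge> 1"
  show "(k, v) \<in> space SX" if "v \<in> space (cube k)" for v
    using k that by (auto simp: space_SX layer_def)
  show "Pair k -` A \<inter> space (cube k) \<in> sets (cube k)" if A: "A \<in> sets SX" for A
  proof -
    have "Pair k -` A = {v. (k, v) \<in> A}" by auto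
    then show ?thesis using section_sets[OF A, of k] by auto
  qed
qed

lemma measurable_SX_I:
  assumes "\<And>k. k \<ge> 1 \<Longrightarrow> (\<lambda>v. f (k, v)) \<in> cube k \<rightarrow>\<^sub>M N"
  shows "f \<in> SX \<rightarrow>\<^sub>M N"
proof (rule measurableI)
  show "f x \<in> space N" if "x \<in> space SX" for x
    using that measurable_space[OF assms] by (auto simp: space_SX layer_def)
  fix B assume B: "B \<in> sets N"
  have "f -` B \<inter> space SX = (\<Union>k\<in>{1..}. {k} \<times> ((\<lambda>v. f (k, v)) -` B \<inter> space (cube k)))"
    by (auto simp: space_SX layer_def)
  also have "\<dots> \<in> sets SX"
    using measurable_sets[OF assms B] by (intro sets.countable_UN'') (auto intro: Times_sets_SX)
  finally show "f -` B \<inter> space SX \<in> sets SX" .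
qed

lemma measurable_fst_SX [measurable]: "fst \<in> SX \<rightarrow>\<^sub>M count_space UNIV"
  by (rule measurable_SX_I) simp

lemma measurable_by_layer:
  assumes "\<And>k. k \<ge> 1 \<Longrightarrow> f k \<in> SX \<rightarrow>\<^sub>M N"
  shows "(\<lambda>x. f (fst x) x) \<in> SX \<rightarrow>\<^sub>M N"
proof (rule measurable_SX_I)
  show "(\<lambda>v. f (fst (k, v)) (k, v)) \<in> cube k \<rightarrow>\<^sub>M N" if "k \<ge> 1" for k
    using measurable_compose[OF measurable_Pair_layer assms] that by simp
qed

lemma space_SX_cases:
  assumes "x \<in> space SX"
  obtains k v where "x = (k, v)" "k \<ge> 1" "v \<in> space (cube k)"
  using assms by (auto simp: space_SX layer_def)

lemma layer_sets: "k \<ge> 1 \<Longrightarrow> layer k \<in> sets SX"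
  unfolding layer_def by (rule Times_sets_SX) auto

definition layer_measure :: "nat \<Rightarrow> state measure" where
  "layer_measure k = distr (cube k) SX (Pair k)"

lemma sets_layer_measure [simp]: "sets (layer_measure k) = sets SX"
  by (simp add: layer_measure_def)

lemma nn_integral_layer_measure:
  "k \<ge> 1 \<Longrightarrow> f \<in> borel_measurable SX \<Longrightarrow> (\<integral>\<^sup>+x. f x \<partial>layer_measure k) = (\<integral>\<^sup>+v. f (k, v) \<partial>cube k)"
  by (simp add: layer_measure_def nn_integral_distr measurable_Pair_layer)

lemma AE_layer_measure: "k \<ge> 1 \<Longrightarrow> AE x in layer_measure k. x \<in> layer k"
  unfolding layer_measure_def using layer_sets[of k]
  by (subst AE_distr_iff) (auto simp: measurable_Pair_layer layer_def Int_def[symmetric])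

lemma layer_measure_kernel: "(\<lambda>k. layer_measure (Suc k)) \<in> count_space UNIV \<rightarrow>\<^sub>M subprob_algebra SX"
  by (auto simp: layer_measure_def space_subprob_algebra intro!: prob_space_imp_subprob_space
      prob_space.prob_space_distr prob_space_cube measurable_Pair_layer)

text \<open>Writing \<open>\<tau>\<close> as a mixture over the counting measure reduces integrals with respect to \<open>\<tau>\<close> to sums over the
  layers.\<close>

lemma tau_eq_bind: "tau = count_space UNIV \<bind> (\<lambda>k. layer_measure (Suc k))"
proof (rule measure_eqI)
  show "sets tau = sets (count_space UNIV \<bind> (\<lambda>k. layer_measure (Suc k)))"
    by (subst sets_bind[where N = SX]) auto
  fix A assume "A \<in> sets tau"
  then have A: "A \<in> sets SX" by simp
  have "emeasure (layer_measure (Suc k)) A = emeasure (cube (Suc k)) {v. (Suc k, v) \<in> A}" for k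
  proof -
    have "Pair (Suc k) -` A \<inter> space (cube (Suc k)) = {v. (Suc k, v) \<in> A}"
      using sets.sets_into_space[OF section_sets[OF A]] by auto
    then show ?thesis
      using A measurable_Pair_layer[of "Suc k"] by (simp add: layer_measure_def emeasure_distr)
  qed
  then show "emeasure tau A = emeasure (count_space UNIV \<bind> (\<lambda>k. layer_measure (Suc k))) A"
    using A by (subst emeasure_bind[OF _ layer_measure_kernel]) (simp_all add: emeasure_tau nn_integral_count_space_nat)
qed

lemma nn_integral_tau_layers:
  "f \<in> borel_measurable SX \<Longrightarrow> (\<integral>\<^sup>+x. f x \<partial>tau) = (\<Sum>k. \<integral>\<^sup>+x. f x \<partial>layer_measure (Suc k))"
  unfolding tau_eq_bind
  by (subst nn_integral_bind[OF _ layer_measure_kernel]) (simp_all add: nn_integral_count_space_nat)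

lemma nn_integral_tau:
  "f \<in> borel_measurable SX \<Longrightarrow> (\<integral>\<^sup>+x. f x \<partial>tau) = (\<Sum>k. \<integral>\<^sup>+v. f (Suc k, v) \<partial>cube (Suc k))"
  by (simp add: nn_integral_tau_layers nn_integral_layer_measure)

lemma sigma_finite_tau: "sigma_finite_measure tau"
proof
  let ?A = "range (\<lambda>k. layer (Suc k))"
  show "\<exists>A. countable A \<and> A \<subseteq> sets tau \<and> \<Union> A = space tau \<and> (\<forall>a\<in>A. emeasure tau a \<noteq> \<infinity>)"
  proof (intro exI[of _ ?A] conjI ballI)
    show "?A \<subseteq> sets tau"
      by (auto intro: layer_sets)
    show "\<Union> ?A = space tau"
      by (auto simp: space_SX image_iff) (metis Suc_le_D atLeast_iff)
    fix a assume "a \<in> ?A"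
    then obtain k where "a = layer (Suc k)" by auto
    then show "emeasure tau a \<noteq> \<infinity>"
      using emeasure_tau_Times[of "Suc k" "space (cube (Suc k))"] prob_space.emeasure_space_1[OF prob_space_cube]
      by (simp add: layer_def)
  qed simp
qed

lemma cube_Suc: "k \<ge> 1 \<Longrightarrow> cube (Suc k) = PiM (insert k {1..<k}) (\<lambda>_. unit_leb)"
  by (simp add: cube_def atLeastLessThanSuc)

lemma nn_integral_cube_Suc:
  assumes k: "k \<ge> 1" and f: "f \<in> borel_measurable (cube (Suc k))"
  shows "(\<integral>\<^sup>+v. f v \<partial>cube (Suc k)) = (\<integral>\<^sup>+v. \<integral>\<^sup>+u. f (v(k := u)) \<partial>unit_leb \<partial>cube k)"
  using f unfolding cube_Suc[OF k] by (simp add: unit_leb.product_nn_integral_insert cube_def)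

lemma nn_integral_cube_coord:
  assumes i: "i \<in> {1..<k}" and f: "f \<in> borel_measurable (cube k)"
  shows "(\<integral>\<^sup>+v. f v \<partial>cube k) = (\<integral>\<^sup>+v. \<integral>\<^sup>+u. f (v(i := u)) \<partial>unit_leb \<partial>PiM ({1..<k} - {i}) (\<lambda>_. unit_leb))"
proof -
  have "{1..<k} = insert i ({1..<k} - {i})"
    using i by auto
  then have eq: "cube k = PiM (insert i ({1..<k} - {i})) (\<lambda>_. unit_leb)"
    by (simp add: cube_def)
  show ?thesis
    using f unfolding eq by (subst unit_leb.product_nn_integral_insert) simp_all
qed

lemma measurable_update:
  assumes "{1..<m} = {1..<k} \<union> {i}"
  shows "(\<lambda>(v, u). v(i := u)) \<in> cube k \<Otimes>\<^sub>M unit_leb \<rightarrow>\<^sub>M cube m"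
  unfolding cube_def split_beta'
  by (rule measurable_fun_upd[OF assms]) simp_all

lemma measurable_update_SX:
  assumes "{1..<m} = {1..<k} \<union> {i}" "m \<ge> 1"
  shows "(\<lambda>(v, u). (m, v(i := u))) \<in> cube k \<Otimes>\<^sub>M unit_leb \<rightarrow>\<^sub>M SX"
  using measurable_compose[OF measurable_update[OF assms(1)] measurable_Pair_layer[OF assms(2)]]
  by (simp add: split_beta')

lemma measurable_update_section:
  assumes "{1..<m} = {1..<k} \<union> {i}" "m \<ge> 1" "v \<in> space (cube k)"
  shows "(\<lambda>u. (m, v(i := u))) \<in> unit_leb \<rightarrow>\<^sub>M SX"
  using measurable_compose[OF measurable_Pair1'[OF assms(3)] measurable_update_SX[OF assms(1,2)]] by simp

lemma cube_update_undefined: "v \<in> space (cube k) \<Longrightarrow> v(k := undefined) = v"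
  by (auto simp: space_cube PiE_def extensional_def fun_eq_iff)

section \<open>Reversible proposals\<close>

text \<open>The measures \<open>M(dx) K(x, dy)\<close> and \<open>M(dx) L(x, dy)\<close> are images of each other under exchange of the
  coordinates. Testing with functions rather than rectangles allows a symmetric weight to be absorbed in
  \<open>F\<close>, and kernels to be composed.\<close>

definition reverses :: "state measure \<Rightarrow> (state \<Rightarrow> state measure) \<Rightarrow> (state \<Rightarrow> state measure) \<Rightarrow> bool" where
  "reverses M K L \<longleftrightarrow> (\<forall>F\<in>borel_measurable (SX \<Otimes>\<^sub>M SX).
     (\<integral>\<^sup>+x. \<integral>\<^sup>+y. F (x, y) \<partial>K x \<partial>M) = (\<integral>\<^sup>+x. \<integral>\<^sup>+y. F (y, x) \<partial>L x \<partial>M))"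

lemma reversesD:
  "reverses M K L \<Longrightarrow> F \<in> borel_measurable (SX \<Otimes>\<^sub>M SX) \<Longrightarrow>
    (\<integral>\<^sup>+x. \<integral>\<^sup>+y. F (x, y) \<partial>K x \<partial>M) = (\<integral>\<^sup>+x. \<integral>\<^sup>+y. F (y, x) \<partial>L x \<partial>M)"
  by (simp add: reverses_def)

abbreviation SX_kernel :: "(state \<Rightarrow> state measure) \<Rightarrow> bool" where
  "SX_kernel K \<equiv> K \<in> SX \<rightarrow>\<^sub>M prob_algebra SX"

lemma nn_integral_kernel_measurable [measurable (raw)]:
  assumes "SX_kernel K" "F \<in> borel_measurable (SX \<Otimes>\<^sub>M SX)"
  shows "(\<lambda>x. \<integral>\<^sup>+y. F (x, y) \<partial>K x) \<in> borel_measurable SX"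
  using nn_integral_measurable_subprob_algebra2[OF _ measurable_prob_algebraD[OF assms(1)], of "\<lambda>x y. F (x, y)"] assms(2)
  by simp

lemma measurable_swapped: "F \<in> borel_measurable (SX \<Otimes>\<^sub>M SX) \<Longrightarrow> (\<lambda>(x, y). F (y, x)) \<in> borel_measurable (SX \<Otimes>\<^sub>M SX)"
  by (rule measurable_pair_swap)

lemma measurable_section:
  "F \<in> borel_measurable (SX \<Otimes>\<^sub>M SX) \<Longrightarrow> x \<in> space SX \<Longrightarrow> (\<lambda>y. F (x, y)) \<in> borel_measurable SX"
  "F \<in> borel_measurable (SX \<Otimes>\<^sub>M SX) \<Longrightarrow> x \<in> space SX \<Longrightarrow> (\<lambda>y. F (y, x)) \<in> borel_measurable SX"
  by (rule measurable_compose[OF measurable_Pair1']; assumption)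
    (rule measurable_compose[OF measurable_Pair2']; assumption)

subsection \<open>Adding and deleting the last coordinate\<close>

lemma law_up_kernel: "SX_kernel law_up"
proof (rule measurable_SX_I)
  fix k :: nat assume k: "k \<ge> 1"
  have "(\<lambda>v. distr unit_leb SX (\<lambda>u. (k + 1, v(k := u)))) \<in> cube k \<rightarrow>\<^sub>M prob_algebra SX"
  proof (rule measurable_distr_prob_space2)
    show "(\<lambda>_. unit_leb) \<in> cube k \<rightarrow>\<^sub>M prob_algebra unit_leb"
      using prob_space_unit_leb by (intro measurable_const) (simp add: space_prob_algebra)
    show "(\<lambda>(v, u). (k + 1, v(k := u))) \<in> cube k \<Otimes>\<^sub>M unit_leb \<rightarrow>\<^sub>M SX"
      using k by (intro measurable_update_SX) auto
  qed
  then show "(\<lambda>v. law_up (k, v)) \<in> cube k \<rightarrow>\<^sub>M prob_algebra SX"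
    by (simp add: law_up_def)
qed

definition drop_last :: "state \<Rightarrow> state" where
  "drop_last = (\<lambda>(k, v). if k = 1 then (k, v) else (k - 1, v(k - 1 := undefined)))"

lemma law_down_eq: "law_down x = return SX (drop_last x)"
  by (simp add: law_down_def drop_last_def split: prod.splits)

lemma measurable_drop_last [measurable]: "drop_last \<in> SX \<rightarrow>\<^sub>M SX"
proof (rule measurable_SX_I)
  fix k :: nat assume k: "k \<ge> 1"
  show "(\<lambda>v. drop_last (k, v)) \<in> cube k \<rightarrow>\<^sub>M SX"
  proof (cases "k = 1")
    case True
    then show ?thesis
      using measurable_Pair_layer[OF k] by (simp add: drop_last_def)
  next
    case False
    have "(\<lambda>v. restrict v {1..<k - 1}) \<in> cube k \<rightarrow>\<^sub>M cube (k - 1)"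
      unfolding cube_def by (rule measurable_restrict_subset) auto
    then have "(\<lambda>v. (k - 1, restrict v {1..<k - 1})) \<in> cube k \<rightarrow>\<^sub>M SX"
      using False k by (intro measurable_compose[OF _ measurable_Pair_layer]) auto
    moreover have "drop_last (k, v) = (k - 1, restrict v {1..<k - 1})" if "v \<in> space (cube k)" for v
      using False k that
      by (auto simp: drop_last_def space_cube PiE_def extensional_def restrict_def fun_eq_iff)
    ultimately show ?thesis
      by (simp cong: measurable_cong)
  qed
qed

lemma law_down_kernel: "SX_kernel law_down"
proof -
  have "(\<lambda>x. return SX (drop_last x)) \<in> SX \<rightarrow>\<^sub>M prob_algebra SX"
    by measurable
  then show ?thesis
    by (simp add: law_down_eq[abs_def])
qed

lemma prop1_kernel: "SX_kernel prop1"
proof -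
  have "1 / 2 + 1 / 2 = (1 :: ennreal)"
    by (simp add: add_divide_distrib_ennreal[symmetric])
  then have "SX_kernel (\<lambda>x. mixture SX (map (\<lambda>(c, K). (c, K x)) [(1/2, law_up), (1/2, law_down)]))"
    using law_up_kernel law_down_kernel by (intro mixture_kernel) auto
  then show ?thesis
    by (simp add: prop1_def[abs_def])
qed

lemma nn_integral_prop1:
  assumes x: "x \<in> space SX" and f: "f \<in> borel_measurable SX"
  shows "(\<integral>\<^sup>+y. f y \<partial>prop1 x) = (\<integral>\<^sup>+y. f y \<partial>law_up x) / 2 + (\<integral>\<^sup>+y. f y \<partial>law_down x) / 2"
  unfolding prop1_def using x f
  by (subst nn_integral_mixture)
    (auto simp: sets_kernel_prob[OF law_up_kernel] sets_kernel_prob[OF law_down_kernel] ennreal_times_divide mult.commute divide_ennreal_def)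

lemma nn_integral_law_up:
  assumes "k \<ge> 1" "v \<in> space (cube k)" "f \<in> borel_measurable SX"
  shows "(\<integral>\<^sup>+y. f y \<partial>law_up (k, v)) = (\<integral>\<^sup>+u. f (Suc k, v(k := u)) \<partial>unit_leb)"
proof -
  have "(\<lambda>u. (Suc k, v(k := u))) \<in> unit_leb \<rightarrow>\<^sub>M SX"
    using assms by (intro measurable_update_section) auto
  then show ?thesis
    using assms by (simp add: law_up_def nn_integral_distr)
qed

text \<open>Deleting undoes appending, since \<open>cube (k + 1)\<close> is the product of \<open>cube k\<close> with the unit interval.
  The extra term comes from the layer of \<open>x\<^sub>0\<close>, where deleting does nothing.\<close>

lemma flow_down_eq_flow_up:
  assumes F [measurable]: "F \<in> borel_measurable (SX \<Otimes>\<^sub>M SX)"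
  shows "(\<integral>\<^sup>+x. \<integral>\<^sup>+y. F (x, y) \<partial>law_down x \<partial>tau) = F (x\<^sub>0, x\<^sub>0) + (\<integral>\<^sup>+x. \<integral>\<^sup>+y. F (y, x) \<partial>law_up x \<partial>tau)"
proof -
  have m: "(\<lambda>x. F (x, drop_last x)) \<in> borel_measurable SX"
    by measurable
  have step: "(\<integral>\<^sup>+v. F ((Suc (Suc k), v), drop_last (Suc (Suc k), v)) \<partial>cube (Suc (Suc k)))
      = (\<integral>\<^sup>+v. \<integral>\<^sup>+y. F (y, (Suc k, v)) \<partial>law_up (Suc k, v) \<partial>cube (Suc k))" for k
  proof -
    have "(\<lambda>v. F ((Suc (Suc k), v), drop_last (Suc (Suc k), v))) \<in> borel_measurable (cube (Suc (Suc k)))"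
      using measurable_compose[OF measurable_Pair_layer m, of "Suc (Suc k)"] by simp
    then have "(\<integral>\<^sup>+v. F ((Suc (Suc k), v), drop_last (Suc (Suc k), v)) \<partial>cube (Suc (Suc k)))
        = (\<integral>\<^sup>+v. \<integral>\<^sup>+u. F ((Suc (Suc k), v(Suc k := u)), drop_last (Suc (Suc k), v(Suc k := u))) \<partial>unit_leb \<partial>cube (Suc k))"
      by (intro nn_integral_cube_Suc) simp_all
    also have "\<dots> = (\<integral>\<^sup>+v. \<integral>\<^sup>+u. F ((Suc (Suc k), v(Suc k := u)), (Suc k, v)) \<partial>unit_leb \<partial>cube (Suc k))"
      by (intro nn_integral_cong) (simp add: drop_last_def cube_update_undefined)
    also have "\<dots> = (\<integral>\<^sup>+v. \<integral>\<^sup>+y. F (y, (Suc k, v)) \<partial>law_up (Suc k, v) \<partial>cube (Suc k))"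
    proof (rule nn_integral_cong)
      fix v assume v: "v \<in> space (cube (Suc k))"
      then have "(Suc k, v) \<in> space SX"
        by (auto simp: space_SX layer_def)
      from nn_integral_law_up[OF _ v measurable_section(2)[OF F this]]
      show "(\<integral>\<^sup>+u. F ((Suc (Suc k), v(Suc k := u)), (Suc k, v)) \<partial>unit_leb) = (\<integral>\<^sup>+y. F (y, (Suc k, v)) \<partial>law_up (Suc k, v))"
        by simp
    qed
    finally show ?thesis .
  qed
  have "(\<integral>\<^sup>+x. \<integral>\<^sup>+y. F (x, y) \<partial>law_down x \<partial>tau) = (\<integral>\<^sup>+x. F (x, drop_last x) \<partial>tau)"
    using measurable_space[OF measurable_drop_last]
    by (intro nn_integral_cong) (simp add: law_down_eq nn_integral_return measurable_section)
  also have "\<dots> = (\<Sum>k. \<integral>\<^sup>+v. F ((Suc k, v), drop_last (Suc k, v)) \<partial>cube (Suc k))"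
    by (rule nn_integral_tau[OF m])
  also have "\<dots> = (\<integral>\<^sup>+v. F ((Suc 0, v), drop_last (Suc 0, v)) \<partial>cube (Suc 0))
      + (\<Sum>k. \<integral>\<^sup>+v. F ((Suc (Suc k), v), drop_last (Suc (Suc k), v)) \<partial>cube (Suc (Suc k)))"
    by (subst suminf_offset[where i = 1]) (simp_all add: add.commute)
  also have "(\<integral>\<^sup>+v. F ((Suc 0, v), drop_last (Suc 0, v)) \<partial>cube (Suc 0)) = (\<integral>\<^sup>+v. F (x\<^sub>0, x\<^sub>0) \<partial>cube (Suc 0))"
    by (intro nn_integral_cong) (auto simp: space_cube drop_last_def x\<^sub>0_def)
  also have "\<dots> = F (x\<^sub>0, x\<^sub>0)"
    using prob_space.emeasure_space_1[OF prob_space_cube] by simp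
  also have "(\<Sum>k. \<integral>\<^sup>+v. F ((Suc (Suc k), v), drop_last (Suc (Suc k), v)) \<partial>cube (Suc (Suc k)))
      = (\<integral>\<^sup>+x. \<integral>\<^sup>+y. F (y, x) \<partial>law_up x \<partial>tau)"
    unfolding step using nn_integral_kernel_measurable[OF law_up_kernel measurable_swapped[OF F]]
    by (simp add: nn_integral_tau)
  finally show ?thesis .
qed

lemma reverses_prop1: "reverses tau prop1 prop1"
  unfolding reverses_def
proof
  fix F :: "state \<times> state \<Rightarrow> ennreal" assume F: "F \<in> borel_measurable (SX \<Otimes>\<^sub>M SX)"
  note F' = measurable_swapped[OF F]
  have split: "(\<integral>\<^sup>+x. \<integral>\<^sup>+y. G (x, y) \<partial>prop1 x \<partial>tau)
      = ((\<integral>\<^sup>+x. \<integral>\<^sup>+y. G (x, y) \<partial>law_up x \<partial>tau) + (\<integral>\<^sup>+x. \<integral>\<^sup>+y. G (x, y) \<partial>law_down x \<partial>tau)) / 2"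
    if G: "G \<in> borel_measurable (SX \<Otimes>\<^sub>M SX)" for G
  proof -
    have m [measurable]: "(\<lambda>x. \<integral>\<^sup>+y. G (x, y) \<partial>law_up x) \<in> borel_measurable tau"
      "(\<lambda>x. \<integral>\<^sup>+y. G (x, y) \<partial>law_down x) \<in> borel_measurable tau"
      using nn_integral_kernel_measurable[OF law_up_kernel G] nn_integral_kernel_measurable[OF law_down_kernel G]
      by (simp_all add: measurable_cong_sets[OF sets_tau refl])
    have "(\<integral>\<^sup>+x. \<integral>\<^sup>+y. G (x, y) \<partial>prop1 x \<partial>tau)
        = (\<integral>\<^sup>+x. ((\<integral>\<^sup>+y. G (x, y) \<partial>law_up x) + (\<integral>\<^sup>+y. G (x, y) \<partial>law_down x)) / 2 \<partial>tau)"
      using measurable_section(1)[OF G]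
      by (intro nn_integral_cong) (simp add: nn_integral_prop1 add_divide_distrib_ennreal)
    also have "\<dots> = (\<integral>\<^sup>+x. (\<integral>\<^sup>+y. G (x, y) \<partial>law_up x) + (\<integral>\<^sup>+y. G (x, y) \<partial>law_down x) \<partial>tau) / 2"
      by (rule nn_integral_divide) measurable
    finally show ?thesis
      by (simp add: nn_integral_add)
  qed
  show "(\<integral>\<^sup>+x. \<integral>\<^sup>+y. F (x, y) \<partial>prop1 x \<partial>tau) = (\<integral>\<^sup>+x. \<integral>\<^sup>+y. F (y, x) \<partial>prop1 x \<partial>tau)"
    using split[OF F] split[OF F'] flow_down_eq_flow_up[OF F] flow_down_eq_flow_up[OF F']
    by (simp add: ac_simps)
qed

subsection \<open>Combining reversible kernels\<close>

lemma reverses_tau_by_layer: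
  assumes K: "SX_kernel K" "SX_kernel L" and rev: "\<And>k. k \<ge> 1 \<Longrightarrow> reverses (layer_measure k) K L"
  shows "reverses tau K L"
  unfolding reverses_def
proof
  fix F :: "state \<times> state \<Rightarrow> ennreal" assume F: "F \<in> borel_measurable (SX \<Otimes>\<^sub>M SX)"
  show "(\<integral>\<^sup>+x. \<integral>\<^sup>+y. F (x, y) \<partial>K x \<partial>tau) = (\<integral>\<^sup>+x. \<integral>\<^sup>+y. F (y, x) \<partial>L x \<partial>tau)"
    using nn_integral_kernel_measurable[OF K(1) F] nn_integral_kernel_measurable[OF K(2) measurable_swapped[OF F]]
      reversesD[OF rev F]
    by (simp add: nn_integral_tau_layers)
qed

lemma reverses_cong_AE:
  assumes "reverses M K L" "AE x in M. K x = K' x" "AE x in M. L x = L' x"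
  shows "reverses M K' L'"
  unfolding reverses_def
proof
  fix F :: "state \<times> state \<Rightarrow> ennreal" assume F: "F \<in> borel_measurable (SX \<Otimes>\<^sub>M SX)"
  have "(\<integral>\<^sup>+x. \<integral>\<^sup>+y. F (x, y) \<partial>K' x \<partial>M) = (\<integral>\<^sup>+x. \<integral>\<^sup>+y. F (x, y) \<partial>K x \<partial>M)"
    using assms(2) by (intro nn_integral_cong_AE) (auto elim!: eventually_mono)
  moreover have "(\<integral>\<^sup>+x. \<integral>\<^sup>+y. F (y, x) \<partial>L' x \<partial>M) = (\<integral>\<^sup>+x. \<integral>\<^sup>+y. F (y, x) \<partial>L x \<partial>M)"
    using assms(3) by (intro nn_integral_cong_AE) (auto elim!: eventually_mono)
  ultimately show "(\<integral>\<^sup>+x. \<integral>\<^sup>+y. F (x, y) \<partial>K' x \<partial>M) = (\<integral>\<^sup>+x. \<integral>\<^sup>+y. F (y, x) \<partial>L' x \<partial>M)"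
    using reversesD[OF assms(1) F] by simp
qed

lemma reverses_return:
  assumes M: "sets M = sets SX"
  shows "reverses M (return SX) (return SX)"
proof -
  have "space M = space SX"
    using M by (rule sets_eq_imp_space_eq)
  then show ?thesis
    unfolding reverses_def
    by - (rule ballI, rule nn_integral_cong,
      simp add: nn_integral_return[OF _ measurable_section(1)] nn_integral_return[OF _ measurable_section(2)])
qed

lemma SX_kernel_bind:
  "SX_kernel K \<Longrightarrow> SX_kernel L \<Longrightarrow> SX_kernel (\<lambda>x. K x \<bind> L)"
  by (rule measurable_bind_prob_space)

lemma nn_integral_SX_bind:
  assumes K: "SX_kernel K" and L: "SX_kernel L" and x: "x \<in> space SX" and f: "f \<in> borel_measurable SX"
  shows "(\<integral>\<^sup>+y. f y \<partial>(K x \<bind> L)) = (\<integral>\<^sup>+z. \<integral>\<^sup>+y. f y \<partial>L z \<partial>K x)"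
proof (rule nn_integral_bind[OF f])
  show "L \<in> K x \<rightarrow>\<^sub>M subprob_algebra SX"
    using measurable_prob_algebraD[OF L] by (simp add: measurable_cong_sets[OF sets_kernel_prob[OF K x] refl])
qed

text \<open>The intermediate state is given the role of the starting point by reversing the first kernel;
  then the second kernel can be reversed.\<close>

lemma reverses_bind:
  assumes K: "SX_kernel K" "SX_kernel K'" and L: "SX_kernel L" "SX_kernel L'" and M: "sets M = sets SX"
    and rev: "reverses M K K'" "reverses M L L'"
  shows "reverses M (\<lambda>x. K x \<bind> L) (\<lambda>x. L' x \<bind> K')"
  unfolding reverses_def
proof
  fix F :: "state \<times> state \<Rightarrow> ennreal" assume F [measurable]: "F \<in> borel_measurable (SX \<Otimes>\<^sub>M SX)"
  have sp: "space M = space SX"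
    using M by (rule sets_eq_imp_space_eq)
  note [measurable] = measurable_prob_algebraD[OF K(2)] measurable_prob_algebraD[OF L(1)]
  let ?G = "\<lambda>(x, z). \<integral>\<^sup>+y. F (x, y) \<partial>L z"
  let ?H = "\<lambda>(z, y). \<integral>\<^sup>+x. F (x, y) \<partial>K' z"
  have G: "?G \<in> borel_measurable (SX \<Otimes>\<^sub>M SX)"
    unfolding split_beta' by (rule nn_integral_measurable_subprob_algebra2[where N = SX]) measurable
  have H: "?H \<in> borel_measurable (SX \<Otimes>\<^sub>M SX)"
    unfolding split_beta' by (rule nn_integral_measurable_subprob_algebra2[where N = SX]) measurable
  have "(\<integral>\<^sup>+x. \<integral>\<^sup>+y. F (x, y) \<partial>(K x \<bind> L) \<partial>M) = (\<integral>\<^sup>+x. \<integral>\<^sup>+z. ?G (x, z) \<partial>K x \<partial>M)"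
    using sp by (intro nn_integral_cong) (simp add: nn_integral_SX_bind[OF K(1) L(1)] measurable_section[OF F])
  also have "\<dots> = (\<integral>\<^sup>+z. \<integral>\<^sup>+x. ?G (x, z) \<partial>K' z \<partial>M)"
    using reversesD[OF rev(1) G] .
  also have "\<dots> = (\<integral>\<^sup>+z. \<integral>\<^sup>+y. ?H (z, y) \<partial>L z \<partial>M)"
  proof (rule nn_integral_cong)
    fix z assume "z \<in> space M"
    then have z: "z \<in> space SX" by (simp add: sp)
    interpret K': prob_space "K' z" using K(2) z by (rule prob_space_kernel_prob)
    interpret L: prob_space "L z" using L(1) z by (rule prob_space_kernel_prob)
    interpret pair_prob_space "K' z" "L z" ..
    have "F \<in> borel_measurable (K' z \<Otimes>\<^sub>M L z)"
      using F by (simp add: measurable_cong_sets[OF sets_pair_measure_cong[OF sets_kernel_prob[OF K(2) z] sets_kernel_prob[OF L(1) z]] refl])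
    then have "(\<lambda>(x, y). F (x, y)) \<in> borel_measurable (K' z \<Otimes>\<^sub>M L z)"
      by simp
    from Fubini'[OF this] show "(\<integral>\<^sup>+x. ?G (x, z) \<partial>K' z) = (\<integral>\<^sup>+y. ?H (z, y) \<partial>L z)"
      by simp
  qed
  also have "\<dots> = (\<integral>\<^sup>+y. \<integral>\<^sup>+z. ?H (z, y) \<partial>L' y \<partial>M)"
    using reversesD[OF rev(2) H] .
  also have "\<dots> = (\<integral>\<^sup>+y. \<integral>\<^sup>+x. F (x, y) \<partial>(L' y \<bind> K') \<partial>M)"
    using sp by (intro nn_integral_cong) (simp add: nn_integral_SX_bind[OF L(2) K(2)] measurable_section[OF F])
  finally show "(\<integral>\<^sup>+x. \<integral>\<^sup>+y. F (x, y) \<partial>(K x \<bind> L) \<partial>M) = (\<integral>\<^sup>+x. \<integral>\<^sup>+y. F (y, x) \<partial>(L' x \<bind> K') \<partial>M)" .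
qed

lemma kernel_seq_kernel: "(\<And>K. K \<in> set Ks \<Longrightarrow> SX_kernel K) \<Longrightarrow> SX_kernel (kernel_seq SX Ks)"
proof (induction Ks)
  case Nil
  have "kernel_seq SX [] = return SX" by auto
  then show ?case by simp
next
  case (Cons K Ks)
  have "kernel_seq SX (K # Ks) = (\<lambda>x. K x \<bind> kernel_seq SX Ks)" by auto
  then show ?case using Cons by (simp add: SX_kernel_bind)
qed

lemma kernel_seq_snoc:
  assumes "\<And>K. K \<in> set Ks \<Longrightarrow> SX_kernel K" "SX_kernel K" "x \<in> space SX"
  shows "kernel_seq SX (Ks @ [K]) x = kernel_seq SX Ks x \<bind> K"
  using assms
proof (induction Ks arbitrary: x)
  case Nil
  have "kernel_seq SX [] = return SX" by auto
  moreover have "return SX x \<bind> K = K x"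
    using Nil by (intro bind_return measurable_prob_algebraD)
  moreover have "K x \<bind> return SX = K x"
    using Nil by (intro bind_return'' sets_kernel_prob)
  ultimately show ?case by simp
next
  case (Cons L Ks)
  have L: "SX_kernel L" and Ks: "SX_kernel (kernel_seq SX Ks)"
    using Cons.prems by (auto intro: kernel_seq_kernel)
  have "L x \<bind> kernel_seq SX (Ks @ [K]) = L x \<bind> (\<lambda>y. kernel_seq SX Ks y \<bind> K)"
    using Cons.prems space_kernel_prob[OF L Cons.prems(3)] by (intro bind_cong refl Cons.IH) auto
  then have "kernel_seq SX ((L # Ks) @ [K]) x = L x \<bind> (\<lambda>y. kernel_seq SX Ks y \<bind> K)"
    by simp
  also have "\<dots> = (L x \<bind> kernel_seq SX Ks) \<bind> K"
  proof (rule bind_assoc[symmetric])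
    show "kernel_seq SX Ks \<in> L x \<rightarrow>\<^sub>M subprob_algebra SX"
      using measurable_prob_algebraD[OF Ks]
      by (simp add: measurable_cong_sets[OF sets_kernel_prob[OF L Cons.prems(3)] refl])
    show "K \<in> SX \<rightarrow>\<^sub>M subprob_algebra SX"
      using Cons.prems(2) by (rule measurable_prob_algebraD)
  qed
  finally show ?case by simp
qed

lemma reverses_kernel_seq:
  assumes M: "sets M = sets SX" and "\<And>K. K \<in> set Ks \<Longrightarrow> SX_kernel K" "\<And>K. K \<in> set Ks \<Longrightarrow> reverses M K K"
  shows "reverses M (kernel_seq SX Ks) (kernel_seq SX (rev Ks))"
  using assms(2,3)
proof (induction Ks)
  case Nil
  have "kernel_seq SX [] = return SX" by auto
  then show ?case using reverses_return[OF M] by simp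
next
  case (Cons K Ks)
  have sp: "space M = space SX"
    using M by (rule sets_eq_imp_space_eq)
  have "reverses M (\<lambda>x. K x \<bind> kernel_seq SX Ks) (\<lambda>x. kernel_seq SX (rev Ks) x \<bind> K)"
    using Cons M by (intro reverses_bind kernel_seq_kernel) auto
  then show ?case
  proof (rule reverses_cong_AE)
    show "AE x in M. kernel_seq SX (rev Ks) x \<bind> K = kernel_seq SX (rev (K # Ks)) x"
      using Cons.prems sp kernel_seq_snoc[of "rev Ks" K] by (intro AE_I2) auto
  qed simp
qed

lemma sym_weight_measurable: "sym_weight \<Psi> \<Longrightarrow> (\<lambda>z. ennreal (\<Psi> (fst z) (snd z))) \<in> borel_measurable (SX \<Otimes>\<^sub>M SX)"
  unfolding sym_weight_def by (auto simp: split_beta')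

lemma nn_integral_weighted:
  assumes L: "SX_kernel L" and \<Psi>: "sym_weight \<Psi>" and x: "x \<in> space SX" and f: "f \<in> borel_measurable SX"
  shows "(\<integral>\<^sup>+y. f y \<partial>weighted \<Psi> h L x) = (\<integral>\<^sup>+y. ennreal (\<Psi> x y) * f y \<partial>L x) + ennreal (h x) * f x"
proof -
  have "(\<lambda>y. ennreal (\<Psi> x y)) \<in> borel_measurable SX"
    using measurable_section(1)[OF sym_weight_measurable[OF \<Psi>] x] by simp
  then have "(\<integral>\<^sup>+y. f y \<partial>density (L x) (\<lambda>y. ennreal (\<Psi> x y))) = (\<integral>\<^sup>+y. ennreal (\<Psi> x y) * f y \<partial>L x)"
    using f by (intro nn_integral_density) (simp_all add: measurable_cong_sets[OF sets_kernel_prob[OF L x] refl])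
  then show ?thesis
    unfolding weighted_def using f x
    by (subst nn_integral_mixture) (auto simp: sets_kernel_prob[OF L x] nn_integral_return)
qed

text \<open>A symmetric weight can be moved into the test function, and the holding part is concentrated on the
  diagonal. The holding probability is replaced by one minus the total weight, which is measurable.\<close>

lemma reverses_weighted:
  assumes L: "SX_kernel L" and \<Psi>: "sym_weight \<Psi>" and M: "sets M = sets SX" and rev: "reverses M L L"
    and mass: "AE x in M. (\<integral>\<^sup>+y. ennreal (\<Psi> x y) \<partial>L x) + ennreal (h x) = 1"
  shows "reverses M (weighted \<Psi> h L) (weighted \<Psi> h L)"
  unfolding reverses_def
proof
  fix F :: "state \<times> state \<Rightarrow> ennreal" assume F [measurable]: "F \<in> borel_measurable (SX \<Otimes>\<^sub>M SX)"
  note \<Psi>m [measurable] = sym_weight_measurable[OF \<Psi>]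
  have sp: "space M = space SX"
    using M by (rule sets_eq_imp_space_eq)
  let ?r = "\<lambda>x. (1 - (\<integral>\<^sup>+y. ennreal (\<Psi> x y) \<partial>L x)) * F (x, x)"
  have r: "?r \<in> borel_measurable SX"
    using nn_integral_kernel_measurable[OF L \<Psi>m] by simp
  have split: "(\<integral>\<^sup>+x. \<integral>\<^sup>+y. G (x, y) \<partial>weighted \<Psi> h L x \<partial>M)
      = (\<integral>\<^sup>+x. \<integral>\<^sup>+y. ennreal (\<Psi> x y) * G (x, y) \<partial>L x \<partial>M) + (\<integral>\<^sup>+x. ?r x \<partial>M)"
    if G [measurable]: "G \<in> borel_measurable (SX \<Otimes>\<^sub>M SX)" and diag: "\<And>x. G (x, x) = F (x, x)" for G
  proof -
    have m: "(\<lambda>x. \<integral>\<^sup>+y. ennreal (\<Psi> x y) * G (x, y) \<partial>L x) \<in> borel_measurable SX"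
      using nn_integral_kernel_measurable[OF L, of "\<lambda>z. ennreal (\<Psi> (fst z) (snd z)) * G z"] by simp
    have "(\<integral>\<^sup>+x. \<integral>\<^sup>+y. G (x, y) \<partial>weighted \<Psi> h L x \<partial>M)
        = (\<integral>\<^sup>+x. (\<integral>\<^sup>+y. ennreal (\<Psi> x y) * G (x, y) \<partial>L x) + ?r x \<partial>M)"
    proof (rule nn_integral_cong_AE, rule AE_mp[OF mass AE_I2[OF impI]])
      fix x assume x: "x \<in> space M" and 1: "(\<integral>\<^sup>+y. ennreal (\<Psi> x y) \<partial>L x) + ennreal (h x) = 1"
      have "(\<integral>\<^sup>+y. ennreal (\<Psi> x y) \<partial>L x) \<noteq> \<top>"
        using 1 by (metis ennreal_add_eq_top ennreal_one_neq_top)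
      then have "ennreal (h x) = 1 - (\<integral>\<^sup>+y. ennreal (\<Psi> x y) \<partial>L x)"
        using 1 by (metis ennreal_add_diff_cancel_left)
      then show "(\<integral>\<^sup>+y. G (x, y) \<partial>weighted \<Psi> h L x) = (\<integral>\<^sup>+y. ennreal (\<Psi> x y) * G (x, y) \<partial>L x) + ?r x"
        using x by (simp add: nn_integral_weighted[OF L \<Psi>] sp measurable_section[OF G] diag)
    qed
    also have "\<dots> = (\<integral>\<^sup>+x. \<integral>\<^sup>+y. ennreal (\<Psi> x y) * G (x, y) \<partial>L x \<partial>M) + (\<integral>\<^sup>+x. ?r x \<partial>M)"
      using m r by (intro nn_integral_add) (simp_all add: measurable_cong_sets[OF M refl])
    finally show ?thesis .
  qed
  have "(\<integral>\<^sup>+x. \<integral>\<^sup>+y. ennreal (\<Psi> x y) * F (x, y) \<partial>L x \<partial>M) = (\<integral>\<^sup>+x. \<integral>\<^sup>+y. ennreal (\<Psi> y x) * F (y, x) \<partial>L x \<partial>M)"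
    using reversesD[OF rev, of "\<lambda>z. ennreal (\<Psi> (fst z) (snd z)) * F z"] by simp
  also have "\<dots> = (\<integral>\<^sup>+x. \<integral>\<^sup>+y. ennreal (\<Psi> x y) * F (y, x) \<partial>L x \<partial>M)"
    using \<Psi> space_kernel_prob[OF L] by (intro nn_integral_cong) (simp add: sym_weight_def sp)
  finally have "(\<integral>\<^sup>+x. \<integral>\<^sup>+y. ennreal (\<Psi> x y) * F (x, y) \<partial>L x \<partial>M) = (\<integral>\<^sup>+x. \<integral>\<^sup>+y. ennreal (\<Psi> x y) * F (y, x) \<partial>L x \<partial>M)" .
  then show "(\<integral>\<^sup>+x. \<integral>\<^sup>+y. F (x, y) \<partial>weighted \<Psi> h L x \<partial>M) = (\<integral>\<^sup>+x. \<integral>\<^sup>+y. F (y, x) \<partial>weighted \<Psi> h L x \<partial>M)"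
    using split[OF F] split[OF measurable_swapped[OF F]] by simp
qed

lemma weighted_kernel:
  assumes L: "SX_kernel L" and \<Psi>: "sym_weight \<Psi>" and A [measurable]: "A \<in> sets SX"
    and mass: "\<And>x. x \<in> A \<Longrightarrow> (\<integral>\<^sup>+y. ennreal (\<Psi> x y) \<partial>L x) + ennreal (h x) = 1"
  shows "SX_kernel (\<lambda>x. if x \<in> A then weighted \<Psi> h L x else return SX x)"
proof -
  note \<Psi>m [measurable] = sym_weight_measurable[OF \<Psi>]
  note Lm [measurable] = nn_integral_kernel_measurable[OF L \<Psi>m, simplified]
  let ?\<Psi> = "\<lambda>x y. if x \<in> A then ennreal (\<Psi> x y) else 0"
  let ?h = "\<lambda>x. if x \<in> A then 1 - (\<integral>\<^sup>+y. ennreal (\<Psi> x y) \<partial>L x) else 1"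
  let ?cs = "[(\<lambda>_. 1, \<lambda>x. density (L x) (?\<Psi> x)), (?h, return SX)]"
  have h: "ennreal (h x) = 1 - (\<integral>\<^sup>+y. ennreal (\<Psi> x y) \<partial>L x)" if "x \<in> A" for x
  proof -
    have "(\<integral>\<^sup>+y. ennreal (\<Psi> x y) \<partial>L x) \<noteq> \<top>"
      using mass[OF that] by (metis ennreal_add_eq_top ennreal_one_neq_top)
    then show ?thesis
      using mass[OF that] by (metis ennreal_add_diff_cancel_left)
  qed
  have le1: "(\<integral>\<^sup>+y. ennreal (\<Psi> x y) \<partial>L x) \<le> 1" if "x \<in> A" for x
    using mass[OF that] by (metis le_iff_add)
  have \<Psi>A [measurable]: "case_prod ?\<Psi> \<in> borel_measurable (SX \<Otimes>\<^sub>M SX)"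
    unfolding split_beta' by measurable
  have dens: "(\<lambda>x. density (L x) (?\<Psi> x)) \<in> SX \<rightarrow>\<^sub>M subprob_algebra SX"
  proof (intro measurable_kernel_density measurable_prob_algebraD[OF L] \<Psi>A)
    show "(\<integral>\<^sup>+y. ?\<Psi> x y \<partial>L x) \<le> 1" for x
      using le1 by (cases "x \<in> A") auto
  qed
  have "(\<lambda>x. mixture SX (map (\<lambda>(c, M). (c x, M x)) ?cs)) \<in> SX \<rightarrow>\<^sub>M prob_algebra SX"
  proof (rule measurable_mixture)
    fix c M assume "(c, M) \<in> set ?cs"
    moreover have "?h \<in> borel_measurable SX"
      by measurable
    ultimately show "c \<in> borel_measurable SX \<and> M \<in> SX \<rightarrow>\<^sub>M subprob_algebra SX"
      using dens by auto
  next
    fix x assume x: "x \<in> space SX"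
    have "?\<Psi> x \<in> borel_measurable (L x)"
      using measurable_section(1)[OF \<Psi>A x] by (simp add: measurable_cong_sets[OF sets_kernel_prob[OF L x] refl])
    then have "emeasure (density (L x) (?\<Psi> x)) (space SX) = (\<integral>\<^sup>+y. ?\<Psi> x y * indicator (space SX) y \<partial>L x)"
      using sets.top[of "L x"] by (intro emeasure_density) (simp_all add: space_kernel_prob[OF L x])
    also have "\<dots> = (\<integral>\<^sup>+y. ?\<Psi> x y \<partial>L x)"
      by (intro nn_integral_cong) (simp add: space_kernel_prob[OF L x])
    finally show "(\<Sum>(c, M)\<leftarrow>?cs. c x * emeasure (M x) (space SX)) = 1"
      using x le1 by (simp add: add_diff_inverse_ennreal)
  qed
  moreover have "mixture SX (map (\<lambda>(c, M). (c x, M x)) ?cs) = (if x \<in> A then weighted \<Psi> h L x else return SX x)"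
    if x: "x \<in> space SX" for x
  proof (cases "x \<in> A")
    case True
    then show ?thesis by (simp add: weighted_def h)
  next
    case False
    show ?thesis
    proof (rule measure_eqI)
      fix B assume "B \<in> sets (mixture SX (map (\<lambda>(c, M). (c x, M x)) ?cs))"
      then have B: "B \<in> sets SX" by simp
      have "mixture SX (map (\<lambda>(c, M). (c x, M x)) ?cs) = mixture SX [(1, density (L x) (\<lambda>_. 0)), (1, return SX x)]"
        using False by simp
      moreover have "emeasure (mixture SX [(1, density (L x) (\<lambda>_. 0)), (1, return SX x)]) B
          = (\<Sum>(c, M)\<leftarrow>[(1, density (L x) (\<lambda>_. 0)), (1, return SX x)]. c * emeasure M B)"
      proof (rule emeasure_mixture[OF _ B])
        fix c M assume "(c, M) \<in> set [(1, density (L x) (\<lambda>_. 0)), (1 :: ennreal, return SX x)]"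
        then have "M = density (L x) (\<lambda>_. 0) \<or> M = return SX x" by auto
        then show "sets M = sets SX"
          using sets_kernel_prob[OF L x] by (elim disjE) simp_all
      qed
      moreover have "emeasure (density (L x) (\<lambda>_. 0)) B = 0"
      proof -
        have "B \<in> sets (L x)"
          using B sets_kernel_prob[OF L x] by simp
        then have "emeasure (density (L x) (\<lambda>_. 0)) B = (\<integral>\<^sup>+y. 0 * indicator B y \<partial>L x)"
          by (rule emeasure_density[OF borel_measurable_const])
        then show ?thesis by simp
      qed
      ultimately show "emeasure (mixture SX (map (\<lambda>(c, M). (c x, M x)) ?cs)) B = emeasure (if x \<in> A then weighted \<Psi> h L x else return SX x) B"
        using False by simp
    qed (use False in simp)
  qed
  ultimately show ?thesis
    by (simp cong: measurable_cong)
qed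

lemma nn_integral_layer:
  assumes L: "SX_kernel L" and x: "x \<in> space SX" and keep: "AE y in L x. fst y = fst x"
  shows "(\<integral>\<^sup>+y\<in>layer (fst x). f y \<partial>L x) = (\<integral>\<^sup>+y. f y \<partial>L x)"
proof (rule nn_integral_cong_AE, rule AE_mp[OF keep AE_I2[OF impI]])
  fix y assume "y \<in> space (L x)" "fst y = fst x"
  then have "y \<in> layer (fst x)"
    by (auto simp: space_kernel_prob[OF L x] space_SX layer_def)
  then show "f y * indicator (layer (fst x)) y = f y"
    by simp
qed

subsection \<open>Resampling single coordinates\<close>

text \<open>Resampling the i-th coordinate, made a transition function on the whole space by doing nothing
  where that coordinate does not exist.\<close>

definition resample :: "nat \<Rightarrow> state \<Rightarrow> state measure" where
  "resample i x = (if i \<in> {1..<fst x} then law_coord i x else return SX x)"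

lemma resample_kernel: "SX_kernel (resample i)"
proof (rule measurable_SX_I)
  fix k :: nat assume k: "k \<ge> 1"
  show "(\<lambda>v. resample i (k, v)) \<in> cube k \<rightarrow>\<^sub>M prob_algebra SX"
  proof (cases "i \<in> {1..<k}")
    case True
    have "(\<lambda>v. distr unit_leb SX (\<lambda>u. (k, v(i := u)))) \<in> cube k \<rightarrow>\<^sub>M prob_algebra SX"
    proof (rule measurable_distr_prob_space2)
      show "(\<lambda>_. unit_leb) \<in> cube k \<rightarrow>\<^sub>M prob_algebra unit_leb"
        using prob_space_unit_leb by (intro measurable_const) (simp add: space_prob_algebra)
      show "(\<lambda>(v, u). (k, v(i := u))) \<in> cube k \<Otimes>\<^sub>M unit_leb \<rightarrow>\<^sub>M SX"
        using k True by (intro measurable_update_SX) auto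
    qed
    then show ?thesis
      using True by (simp add: resample_def law_coord_def)
  next
    case False
    then have "resample i (k, v) = return SX (k, v)" for v
      by (auto simp: resample_def)
    then show ?thesis
      using measurable_compose[OF measurable_Pair_layer[OF k] measurable_return_prob_space] by simp
  qed
qed

lemma nn_integral_resample:
  assumes i: "i \<in> {1..<k}" and v: "v \<in> space (cube k)" and f: "f \<in> borel_measurable SX"
  shows "(\<integral>\<^sup>+y. f y \<partial>resample i (k, v)) = (\<integral>\<^sup>+u. f (k, v(i := u)) \<partial>unit_leb)"
proof -
  have "(\<lambda>u. (k, v(i := u))) \<in> unit_leb \<rightarrow>\<^sub>M SX"
    using i v by (intro measurable_update_section) auto
  then show ?thesis
    using i f by (simp add: resample_def law_coord_def nn_integral_distr)
qed

lemma resample_keeps_layer: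
  assumes x: "x \<in> space SX"
  shows "AE y in resample i x. fst y = fst x"
proof -
  have [measurable]: "Measurable.pred SX (\<lambda>y. fst y = fst x)"
    by measurable
  obtain k v where kv: "x = (k, v)" "k \<ge> 1" "v \<in> space (cube k)"
    using x by (rule space_SX_cases)
  show ?thesis
  proof (cases "i \<in> {1..<k}")
    case True
    then have "(\<lambda>u. (k, v(i := u))) \<in> unit_leb \<rightarrow>\<^sub>M SX"
      using kv by (intro measurable_update_section) auto
    moreover have "{y \<in> space SX. fst y = k} \<in> sets SX"
      by measurable
    moreover have eq: "resample i x = distr unit_leb SX (\<lambda>u. (k, v(i := u)))"
      using True kv by (simp add: resample_def law_coord_def)
    ultimately show ?thesis
      unfolding eq using kv by (simp add: AE_distr_iff)
  next
    case False
    then have eq: "resample i x = return SX x"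
      using kv by (auto simp: resample_def)
    show ?thesis
      unfolding eq using x by (simp add: AE_return)
  qed
qed

text \<open>Given the other coordinates, the old and the new value of the resampled one are independent and
  uniform, so Fubini's theorem exchanges them.\<close>

lemma reverses_resample:
  assumes k: "k \<ge> 1"
  shows "reverses (layer_measure k) (resample i) (resample i)"
proof (cases "i \<in> {1..<k}")
  case False
  have "AE x in layer_measure k. return SX x = resample i x"
    using AE_layer_measure[OF k] False by (auto elim!: eventually_mono simp: resample_def layer_def)
  then show ?thesis
    using reverses_return[OF sets_layer_measure] reverses_cong_AE by blast
next
  case i: True
  show ?thesis
    unfolding reverses_def
  proof
    fix F :: "state \<times> state \<Rightarrow> ennreal" assume F [measurable]: "F \<in> borel_measurable (SX \<Otimes>\<^sub>M SX)"
    let ?R = "PiM ({1..<k} - {i}) (\<lambda>_. unit_leb)"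
    \<comment> \<open>\<open>w\<close> holds the other coordinates, \<open>s\<close> and \<open>u\<close> are the old and the new value\<close>
    have expand: "(\<integral>\<^sup>+x. \<integral>\<^sup>+y. G (x, y) \<partial>resample i x \<partial>layer_measure k)
        = (\<integral>\<^sup>+w. \<integral>\<^sup>+s. \<integral>\<^sup>+u. G ((k, w(i := s)), (k, w(i := u))) \<partial>unit_leb \<partial>unit_leb \<partial>?R)"
      if G: "G \<in> borel_measurable (SX \<Otimes>\<^sub>M SX)" for G
    proof -
      let ?f = "\<lambda>x. \<integral>\<^sup>+y. G (x, y) \<partial>resample i x"
      have f: "?f \<in> borel_measurable SX"
        using nn_integral_kernel_measurable[OF resample_kernel G] .
      have "(\<integral>\<^sup>+x. ?f x \<partial>layer_measure k) = (\<integral>\<^sup>+v. ?f (k, v) \<partial>cube k)"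
        using k f by (rule nn_integral_layer_measure)
      also have "\<dots> = (\<integral>\<^sup>+w. \<integral>\<^sup>+s. ?f (k, w(i := s)) \<partial>unit_leb \<partial>?R)"
        using i measurable_compose[OF measurable_Pair_layer[OF k] f] by (rule nn_integral_cube_coord)
      also have "\<dots> = (\<integral>\<^sup>+w. \<integral>\<^sup>+s. \<integral>\<^sup>+u. G ((k, w(i := s)), (k, w(i := u))) \<partial>unit_leb \<partial>unit_leb \<partial>?R)"
      proof (intro nn_integral_cong)
        fix w s assume "w \<in> space ?R" "s \<in> space unit_leb"
        then have v: "w(i := s) \<in> space (cube k)"
          using i by (auto simp: cube_def space_PiM PiE_iff extensional_def)
        then have x: "(k, w(i := s)) \<in> space SX"
          using k by (auto simp: space_SX layer_def)
        show "?f (k, w(i := s)) = (\<integral>\<^sup>+u. G ((k, w(i := s)), (k, w(i := u))) \<partial>unit_leb)"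
          using nn_integral_resample[OF i v measurable_section(1)[OF G x]] by simp
      qed
      finally show ?thesis .
    qed
    have swap: "(\<integral>\<^sup>+s. \<integral>\<^sup>+u. F ((k, w(i := s)), (k, w(i := u))) \<partial>unit_leb \<partial>unit_leb)
        = (\<integral>\<^sup>+s. \<integral>\<^sup>+u. F ((k, w(i := u)), (k, w(i := s))) \<partial>unit_leb \<partial>unit_leb)" if w: "w \<in> space ?R" for w
    proof -
      interpret prob_space unit_leb by (rule prob_space_unit_leb)
      interpret pair_prob_space unit_leb unit_leb ..
      have "(\<lambda>u. w(i := u)) \<in> unit_leb \<rightarrow>\<^sub>M cube k"
        unfolding cube_def using w i by (intro measurable_fun_upd[where J = "{1..<k} - {i}"]) auto
      then have [measurable]: "(\<lambda>u. (k, w(i := u))) \<in> unit_leb \<rightarrow>\<^sub>M SX"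
        using measurable_Pair_layer[OF k] by (rule measurable_compose)
      have "(\<lambda>(s, u). F ((k, w(i := u)), (k, w(i := s)))) \<in> borel_measurable (unit_leb \<Otimes>\<^sub>M unit_leb)"
        by measurable
      from Fubini'[OF this] show ?thesis
        by simp
    qed
    note expand[OF F]
    also have "(\<integral>\<^sup>+w. \<integral>\<^sup>+s. \<integral>\<^sup>+u. F ((k, w(i := s)), (k, w(i := u))) \<partial>unit_leb \<partial>unit_leb \<partial>?R)
        = (\<integral>\<^sup>+w. \<integral>\<^sup>+s. \<integral>\<^sup>+u. F ((k, w(i := u)), (k, w(i := s))) \<partial>unit_leb \<partial>unit_leb \<partial>?R)"
      by (rule nn_integral_cong) (rule swap)
    also have "\<dots> = (\<integral>\<^sup>+x. \<integral>\<^sup>+y. F (y, x) \<partial>resample i x \<partial>layer_measure k)"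
      using expand[OF measurable_swapped[OF F]] by (simp only: prod.case)
    finally show "(\<integral>\<^sup>+x. \<integral>\<^sup>+y. F (x, y) \<partial>resample i x \<partial>layer_measure k)
        = (\<integral>\<^sup>+x. \<integral>\<^sup>+y. F (y, x) \<partial>resample i x \<partial>layer_measure k)" .
  qed
qed

lemma weights_sum:
  assumes "k \<ge> 2"
  shows "(\<Sum>i\<leftarrow>[1..<k]. 1 / of_nat (k - 1)) = (1 :: ennreal)"
proof -
  have "(\<Sum>i\<leftarrow>[1..<k]. 1 / of_nat (k - 1)) = of_nat (k - 1) * (1 / of_nat (k - 1) :: ennreal)"
    by (simp add: sum_list_triv)
  also have "\<dots> = 1"
    unfolding ennreal_times_divide using assms by (simp add: ennreal_divide_self of_nat_less_top)
  finally show ?thesis .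
qed

definition resample_any :: "nat \<Rightarrow> state \<Rightarrow> state measure" where
  "resample_any k x = (if k = 1 then return SX x
     else mixture SX (map (\<lambda>(c, K). (c, K x)) (map (\<lambda>i. (1 / of_nat (k - 1), resample i)) [1..<k])))"

lemma resample_any_kernel:
  assumes k: "k \<ge> 1"
  shows "SX_kernel (resample_any k)"
proof (cases "k = 1")
  case True
  then have "resample_any k = return SX" by (auto simp: resample_any_def)
  then show ?thesis by simp
next
  case False
  let ?cs = "map (\<lambda>i. (1 / of_nat (k - 1) :: ennreal, resample i)) [1..<k]"
  have "SX_kernel (\<lambda>x. mixture SX (map (\<lambda>(c, K). (c, K x)) ?cs))"
  proof (rule mixture_kernel)
    show "(\<Sum>(c, K)\<leftarrow>?cs. c) = 1"
      using weights_sum[of k] k False by (simp add: o_def)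
  qed (auto intro: resample_kernel)
  moreover have "resample_any k = (\<lambda>x. mixture SX (map (\<lambda>(c, K). (c, K x)) ?cs))"
    using False by (auto simp: resample_any_def)
  ultimately show ?thesis by simp
qed

lemma law_any_eq: "x \<in> space SX \<Longrightarrow> law_any x = resample_any (fst x) x"
  by (auto simp: law_any_def resample_any_def resample_def intro!: arg_cong[where f = "mixture SX"])

lemma law_any_kernel: "SX_kernel law_any"
  using measurable_by_layer[OF resample_any_kernel] by (simp add: law_any_eq cong: measurable_cong)

lemma nn_integral_resample_any:
  assumes x: "x \<in> space SX" and f: "f \<in> borel_measurable SX" and k: "k \<ge> 2"
  shows "(\<integral>\<^sup>+y. f y \<partial>resample_any k x) = (\<Sum>i\<leftarrow>[1..<k]. 1 / of_nat (k - 1) * (\<integral>\<^sup>+y. f y \<partial>resample i x))"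
proof -
  have "resample_any k x = mixture SX (map (\<lambda>i. (1 / of_nat (k - 1), resample i x)) [1..<k])"
    using k by (simp add: resample_any_def o_def)
  moreover have "(\<integral>\<^sup>+y. f y \<partial>mixture SX (map (\<lambda>i. (1 / of_nat (k - 1), resample i x)) [1..<k]))
      = (\<Sum>(c, M)\<leftarrow>map (\<lambda>i. (1 / of_nat (k - 1), resample i x)) [1..<k]. c * (\<integral>\<^sup>+y. f y \<partial>M))"
    using sets_kernel_prob[OF resample_kernel x] by (intro nn_integral_mixture f) auto
  ultimately show ?thesis
    by (simp add: o_def)
qed

lemma law_any_keeps_layer:
  assumes x: "x \<in> space SX"
  shows "AE y in law_any x. fst y = fst x"
proof (cases "fst x \<ge> 2")
  case True
  let ?N = "{y \<in> space SX. fst y \<noteq> fst x}"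
  have N: "?N \<in> sets SX"
    by measurable
  have null: "emeasure (resample i x) ?N = 0" for i
    using resample_keeps_layer[OF x] N
    by (subst AE_iff_measurable[symmetric]) (auto simp: sets_kernel_prob[OF resample_kernel x] space_kernel_prob[OF resample_kernel x])
  have "emeasure (law_any x) ?N = (\<integral>\<^sup>+y. indicator ?N y \<partial>resample_any (fst x) x)"
    using N law_any_eq[OF x] sets_kernel_prob[OF law_any_kernel x] by simp
  also have "\<dots> = (\<Sum>i\<leftarrow>[1..<fst x]. 1 / of_nat (fst x - 1) * (\<integral>\<^sup>+y. indicator ?N y \<partial>resample i x))"
    using x True N by (intro nn_integral_resample_any) auto
  also have "\<dots> = 0"
    using N null by (simp add: sets_kernel_prob[OF resample_kernel x])
  finally have "emeasure (law_any x) ?N = 0" .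
  then show ?thesis
    using N by (intro AE_I[of _ _ ?N]) (auto simp: sets_kernel_prob[OF law_any_kernel x] space_kernel_prob[OF law_any_kernel x])
next
  case False
  moreover have "fst x \<ge> 1"
    using x by (auto simp: space_SX layer_def)
  ultimately have "fst x = 1" by simp
  then have eq: "law_any x = return SX x"
    by (simp add: law_any_def)
  have "Measurable.pred SX (\<lambda>y. fst y = fst x)"
    by measurable
  then show ?thesis
    unfolding eq using x by (simp add: AE_return)
qed

lemma reverses_law_any:
  assumes k: "k \<ge> 1"
  shows "reverses (layer_measure k) law_any law_any"
proof -
  have "reverses (layer_measure k) (resample_any k) (resample_any k)"
  proof (cases "k = 1")
    case True
    then have "resample_any k = return SX" by (auto simp: resample_any_def)
    then show ?thesis using reverses_return[OF sets_layer_measure] by simp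
  next
    case False
    then have k2: "k \<ge> 2" using k by simp
    show ?thesis
      unfolding reverses_def
    proof
      fix F :: "state \<times> state \<Rightarrow> ennreal" assume F: "F \<in> borel_measurable (SX \<Otimes>\<^sub>M SX)"
      have sp: "space (layer_measure k) = space SX"
        by (rule sets_eq_imp_space_eq) simp
      have expand: "(\<integral>\<^sup>+x. \<integral>\<^sup>+y. G (x, y) \<partial>resample_any k x \<partial>layer_measure k)
          = (\<Sum>i\<leftarrow>[1..<k]. 1 / of_nat (k - 1) * (\<integral>\<^sup>+x. \<integral>\<^sup>+y. G (x, y) \<partial>resample i x \<partial>layer_measure k))"
        if G: "G \<in> borel_measurable (SX \<Otimes>\<^sub>M SX)" for G
      proof -
        have m [measurable]: "(\<lambda>x. \<integral>\<^sup>+y. G (x, y) \<partial>resample i x) \<in> borel_measurable (layer_measure k)" for i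
          using nn_integral_kernel_measurable[OF resample_kernel G] by (simp add: measurable_cong_sets[OF sets_layer_measure refl])
        have "(\<integral>\<^sup>+x. \<integral>\<^sup>+y. G (x, y) \<partial>resample_any k x \<partial>layer_measure k)
            = (\<integral>\<^sup>+x. (\<Sum>i\<leftarrow>[1..<k]. 1 / of_nat (k - 1) * (\<integral>\<^sup>+y. G (x, y) \<partial>resample i x)) \<partial>layer_measure k)"
          using k2 by (intro nn_integral_cong) (simp add: nn_integral_resample_any sp measurable_section[OF G])
        also have "\<dots> = (\<integral>\<^sup>+x. (\<Sum>i\<in>{1..<k}. 1 / of_nat (k - 1) * (\<integral>\<^sup>+y. G (x, y) \<partial>resample i x)) \<partial>layer_measure k)"
          by (simp add: sum_list_distinct_conv_sum_set)
        also have "\<dots> = (\<Sum>i\<in>{1..<k}. 1 / of_nat (k - 1) * (\<integral>\<^sup>+x. \<integral>\<^sup>+y. G (x, y) \<partial>resample i x \<partial>layer_measure k))"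
          by (subst nn_integral_sum) (simp_all add: nn_integral_cmult)
        finally show ?thesis
          by (simp add: sum_list_distinct_conv_sum_set)
      qed
      show "(\<integral>\<^sup>+x. \<integral>\<^sup>+y. F (x, y) \<partial>resample_any k x \<partial>layer_measure k)
          = (\<integral>\<^sup>+x. \<integral>\<^sup>+y. F (y, x) \<partial>resample_any k x \<partial>layer_measure k)"
        using expand[OF F] expand[OF measurable_swapped[OF F]] reversesD[OF reverses_resample[OF k] F] by simp
    qed
  qed
  moreover have "AE x in layer_measure k. resample_any k x = law_any x"
    using AE_layer_measure[OF k]
  proof (rule AE_mp[OF _ AE_I2[OF impI]])
    fix x assume "x \<in> space (layer_measure k)" "x \<in> layer k"
    then have "x \<in> space SX" "fst x = k"
      by (auto simp: sets_eq_imp_space_eq[OF sets_layer_measure] layer_def)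
    then show "resample_any k x = law_any x"
      by (simp add: law_any_eq)
  qed
  ultimately show ?thesis
    using reverses_cong_AE by blast
qed

subsection \<open>The sweep\<close>

lemma unit_mass_total:
  assumes "SX_kernel L" "x \<in> space SX" "AE y in L x. fst y = fst x" "unit_mass \<Psi> h L x"
  shows "(\<integral>\<^sup>+y. ennreal (\<Psi> x y) \<partial>L x) + ennreal (h x) = 1"
  using assms(4) nn_integral_layer[OF assms(1-3)] by (simp add: unit_mass_def)

text \<open>The data of a coordinatewise sweep. Its composition of kernels depends on the layer, so reversibility
  is established layer by layer.\<close>

locale sweep =
  fixes \<Psi> :: "state \<Rightarrow> state \<Rightarrow> real" and h :: "nat \<Rightarrow> state \<Rightarrow> real"
  assumes sym: "sym_weight \<Psi>"
    and mass: "x \<in> space SX \<Longrightarrow> i \<in> {1..<fst x} \<Longrightarrow> unit_mass \<Psi> (h i) (law_coord i) x"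
begin

lemma resample_mass:
  assumes "x \<in> space SX" "i \<in> {1..<fst x}"
  shows "(\<integral>\<^sup>+y. ennreal (\<Psi> x y) \<partial>resample i x) + ennreal (h i x) = 1"
proof -
  have "unit_mass \<Psi> (h i) (resample i) x"
    using mass[OF assms] assms(2) by (simp add: unit_mass_def resample_def)
  then show ?thesis
    using assms by (intro unit_mass_total resample_kernel resample_keeps_layer)
qed

lemma prop5_coord_eq:
  "prop5_coord \<Psi> h i x = (if i \<in> {1..<fst x} then weighted \<Psi> (h i) (resample i) x else return SX x)"
  by (simp add: prop5_coord_def resample_def weighted_def)

lemma prop5_coord_kernel: "SX_kernel (prop5_coord \<Psi> h i)"
proof -
  let ?A = "{x \<in> space SX. i \<in> {1..<fst x}}"
  have A: "?A \<in> sets SX"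
    by measurable
  have "SX_kernel (\<lambda>x. if x \<in> ?A then weighted \<Psi> (h i) (resample i) x else return SX x)"
    using resample_mass by (intro weighted_kernel resample_kernel sym A) auto
  then show ?thesis
    by (simp add: prop5_coord_eq cong: measurable_cong)
qed

lemma reverses_prop5_coord:
  assumes k: "k \<ge> 1"
  shows "reverses (layer_measure k) (prop5_coord \<Psi> h i) (prop5_coord \<Psi> h i)"
proof (cases "i \<in> {1..<k}")
  case False
  have "AE x in layer_measure k. return SX x = prop5_coord \<Psi> h i x"
    using AE_layer_measure[OF k] False by (auto elim!: eventually_mono simp: prop5_coord_def layer_def)
  then show ?thesis
    using reverses_return[OF sets_layer_measure] reverses_cong_AE by blast
next
  case True
  have sp: "space (layer_measure k) = space SX"
    by (rule sets_eq_imp_space_eq) simp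
  have "reverses (layer_measure k) (weighted \<Psi> (h i) (resample i)) (weighted \<Psi> (h i) (resample i))"
  proof (rule reverses_weighted[OF resample_kernel sym sets_layer_measure reverses_resample[OF k]])
    show "AE x in layer_measure k. (\<integral>\<^sup>+y. ennreal (\<Psi> x y) \<partial>resample i x) + ennreal (h i x) = 1"
      using AE_layer_measure[OF k]
      by (rule AE_mp[OF _ AE_I2[OF impI]]) (use True in \<open>auto simp: sp layer_def intro!: resample_mass\<close>)
  qed
  moreover have "AE x in layer_measure k. weighted \<Psi> (h i) (resample i) x = prop5_coord \<Psi> h i x"
    using AE_layer_measure[OF k] True by (auto elim!: eventually_mono simp: prop5_coord_eq layer_def)
  ultimately show ?thesis
    using reverses_cong_AE by blast
qed

lemma prop5_kernel: "SX_kernel (prop5 \<Psi> h)"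
  and prop5_reversed_kernel: "SX_kernel (prop5_reversed \<Psi> h)"
proof -
  have "SX_kernel (kernel_seq SX (map (prop5_coord \<Psi> h) is))" for "is"
    by (intro kernel_seq_kernel) (auto intro: prop5_coord_kernel)
  from measurable_by_layer[OF this] show "SX_kernel (prop5 \<Psi> h)" "SX_kernel (prop5_reversed \<Psi> h)"
    by (simp_all add: prop5_def[abs_def] prop5_reversed_def[abs_def])
qed

lemma reverses_prop5: "reverses tau (prop5 \<Psi> h) (prop5_reversed \<Psi> h)"
proof (rule reverses_tau_by_layer[OF prop5_kernel prop5_reversed_kernel])
  fix k :: nat assume k: "k \<ge> 1"
  let ?Ks = "map (prop5_coord \<Psi> h) [1..<k]"
  have "reverses (layer_measure k) (kernel_seq SX ?Ks) (kernel_seq SX (rev ?Ks))"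
    using reverses_prop5_coord[OF k] prop5_coord_kernel
    by (intro reverses_kernel_seq) auto
  then show "reverses (layer_measure k) (prop5 \<Psi> h) (prop5_reversed \<Psi> h)"
  proof (rule reverses_cong_AE)
    show "AE x in layer_measure k. kernel_seq SX ?Ks x = prop5 \<Psi> h x"
      using AE_layer_measure[OF k] by (auto elim!: eventually_mono simp: prop5_def layer_def)
    show "AE x in layer_measure k. kernel_seq SX (rev ?Ks) x = prop5_reversed \<Psi> h x"
      using AE_layer_measure[OF k] by (auto elim!: eventually_mono simp: prop5_reversed_def layer_def rev_map)
  qed
qed

end

section \<open>The target density\<close>

lemma sorted_nth_le_iff:
  fixes xs :: "'a :: linorder list"
  assumes "sorted xs" "m < length xs"
  shows "xs ! m \<le> t \<longleftrightarrow> m < length (filter (\<lambda>y. y \<le> t) xs)"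
  using assms
proof (induction xs arbitrary: m)
  case (Cons x xs)
  show ?case
  proof (cases "x \<le> t")
    case True
    then show ?thesis
      using Cons by (cases m) auto
  next
    case False
    then have "\<forall>y\<in>set xs. \<not> y \<le> t"
      using Cons.prems by auto
    then have "filter (\<lambda>y. y \<le> t) (x # xs) = []"
      using False by simp
    moreover have "(x # xs) ! m \<in> set (x # xs)"
      using Cons.prems by (intro nth_mem)
    ultimately show ?thesis
      using False \<open>\<forall>y\<in>set xs. \<not> y \<le> t\<close> by auto
  qed
qed simp

text \<open>The number of change-points not exceeding \<open>t\<close>. It determines the cell containing \<open>t\<close>, and unlike the
  sorted list of change-points it is visibly measurable.\<close>

definition rank :: "nat \<Rightarrow> (nat \<Rightarrow> real) \<Rightarrow> real \<Rightarrow> nat" where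
  "rank k v t = length (filter (\<lambda>i. v i \<le> t) [1..<k])"

lemma order_stat_le_iff:
  assumes "1 \<le> i" "i < k"
  shows "order_stat k v i \<le> t \<longleftrightarrow> i \<le> rank k v t"
proof -
  have "rank k v t = length (filter (\<lambda>y. y \<le> t) (sort (map v [1..<k])))"
    by (simp add: rank_def filter_sort filter_map o_def)
  moreover have "i - 1 < length (sort (map v [1..<k]))"
    using assms by simp
  ultimately show ?thesis
    using sorted_nth_le_iff[OF sorted_sort, of "i - 1" "map v [1..<k]" t] assms
    by (auto simp: order_stat_def)
qed

lemma rank_le: "rank k v t \<le> k - 1"
  unfolding rank_def using length_filter_le[of "\<lambda>i. v i \<le> t" "[1..<k]"] by simp

lemma mem_cell_iff:
  assumes t: "0 \<le> t" "t \<le> 1" and j: "1 \<le> j" "j \<le> k"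
  shows "t \<in> cell k v j \<longleftrightarrow> rank k v t = j - 1"
proof -
  note stat = order_stat_le_iff[of _ k v t]
  show ?thesis
  proof (cases "k = 1")
    case True
    then show ?thesis
      using t j by (simp add: cell_def rank_def)
  next
    case False
    then consider "j = 1" "1 < k" | "1 < j" "j < k" | "1 < j" "j = k"
      using j by linarith
    then show ?thesis
    proof cases
      case 1
      then show ?thesis
        using t stat[of 1] by (auto simp: cell_def not_le[symmetric])
    next
      case 2
      then show ?thesis
        using t stat[of "j - 1"] stat[of j] by (auto simp: cell_def not_le[symmetric])
    next
      case 3
      then show ?thesis
        using t stat[of "j - 1"] rank_le[of k v t] by (auto simp: cell_def)
    qed
  qed
qed

lemma measurable_length_filter:
  assumes "\<And>x. x \<in> set xs \<Longrightarrow> Measurable.pred M (\<lambda>v. P v x)"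
  shows "(\<lambda>v. length (filter (P v) xs)) \<in> M \<rightarrow>\<^sub>M count_space UNIV"
  using assms
proof (induction xs)
  case (Cons x xs)
  have [measurable]: "Measurable.pred M (\<lambda>v. P v x)"
    and IH [measurable]: "(\<lambda>v. length (filter (P v) xs)) \<in> M \<rightarrow>\<^sub>M count_space UNIV"
    using Cons by auto
  have [measurable]: "(\<lambda>v. Suc (length (filter (P v) xs))) \<in> M \<rightarrow>\<^sub>M count_space UNIV"
    using IH by (rule measurable_compose) simp
  have "(\<lambda>v. length (filter (P v) (x # xs)))
      = (\<lambda>v. if P v x then Suc (length (filter (P v) xs)) else length (filter (P v) xs))"
    by auto
  then show ?case by simp
qed simp

lemma measurable_rank: "(\<lambda>v. rank k v t) \<in> cube k \<rightarrow>\<^sub>M count_space UNIV"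
  unfolding rank_def
proof (rule measurable_length_filter)
  fix i assume "i \<in> set [1..<k]"
  then have "(\<lambda>v. v i) \<in> cube k \<rightarrow>\<^sub>M unit_leb"
    unfolding cube_def by (intro measurable_component_singleton) simp
  moreover have "(\<lambda>x. x) \<in> unit_leb \<rightarrow>\<^sub>M (borel :: real measure)"
    by (intro measurable_restrict_space1) simp
  ultimately have [measurable]: "(\<lambda>v. v i) \<in> cube k \<rightarrow>\<^sub>M (borel :: real measure)"
    by (rule measurable_compose)
  show "Measurable.pred (cube k) (\<lambda>v. v i \<le> t)"
    by measurable
qed

locale posterior =
  fixes D :: data and \<kappa> :: "nat pmf"
  assumes data: "set D \<subseteq> {0..1} \<times> {0, 1}" and support: "set_pmf \<kappa> = {1..}"
begin

lemma measurable_count_cell: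
  assumes "j \<in> {1..k}"
  shows "(\<lambda>v. count_cell D b k v j) \<in> cube k \<rightarrow>\<^sub>M count_space UNIV"
proof -
  have "count_cell D b k v j = length (filter (\<lambda>d. rank k v (fst d) = j - 1 \<and> snd d = b) D)" for v
    unfolding count_cell_def using data assms
    by (intro arg_cong[where f = length] filter_cong) (auto simp: mem_cell_iff)
  moreover have "(\<lambda>v. length (filter (\<lambda>d. rank k v (fst d) = j - 1 \<and> snd d = b) D)) \<in> cube k \<rightarrow>\<^sub>M count_space UNIV"
  proof (rule measurable_length_filter)
    fix d :: "real \<times> nat"
    note [measurable] = measurable_rank[of k "fst d"]
    show "Measurable.pred (cube k) (\<lambda>v. rank k v (fst d) = j - 1 \<and> snd d = b)"
      by measurable
  qed
  ultimately show ?thesis by simp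
qed

lemma measurable_rho [measurable]: "rho D k \<in> borel_measurable (cube k)"
proof -
  let ?g = "\<lambda>a b. fact a * fact b / fact (a + b + 1) :: real"
  have "(\<lambda>v. ?g (count_cell D 1 k v j) (count_cell D 0 k v j)) \<in> borel_measurable (cube k)" if j: "j \<in> {1..k}" for j
  proof (rule measurable_compose_countable[where f = "\<lambda>a v. ?g a (count_cell D 0 k v j)"])
    show "(\<lambda>v. count_cell D 1 k v j) \<in> cube k \<rightarrow>\<^sub>M count_space UNIV"
      using j by (rule measurable_count_cell)
    show "(\<lambda>v. ?g a (count_cell D 0 k v j)) \<in> borel_measurable (cube k)" for a
      by (rule measurable_compose[OF measurable_count_cell[OF j]]) simp
  qed
  then show ?thesis
    unfolding rho_def[abs_def] by (intro borel_measurable_prod) auto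
qed

lemma rho_pos: "0 < rho D k v"
  unfolding rho_def by (intro prod_pos) simp

lemma rho_le_1: "rho D k v \<le> 1"
  unfolding rho_def
proof (intro prod_le_1 conjI)
  fix j
  let ?a = "count_cell D 1 k v j" and ?b = "count_cell D 0 k v j"
  have "fact ?a * fact ?b \<le> (fact (?a + ?b) :: nat)"
    by (intro dvd_imp_le fact_fact_dvd_fact) simp
  also have "\<dots> \<le> fact (?a + ?b + 1)"
    by (intro fact_mono_nat) simp
  finally have "real (fact ?a * fact ?b) \<le> real (fact (?a + ?b + 1))"
    by (simp only: of_nat_le_iff)
  then show "fact ?a * fact ?b / fact (?a + ?b + 1) \<le> (1 :: real)"
    by (simp only: of_nat_mult of_nat_fact divide_le_eq_1_pos fact_gt_zero)
qed simp

lemma integrable_rho: "integrable (cube k) (rho D k)"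
proof -
  interpret prob_space "cube k" by (rule prob_space_cube)
  show ?thesis
    using rho_pos rho_le_1 by (intro integrable_const_bound[where B = 1]) (auto simp: less_imp_le abs_of_pos)
qed

lemma rho_total_eq: "rho_total D k = (\<integral>v. rho D k v \<partial>cube k)"
proof (cases "k = 1")
  case True
  interpret prob_space "cube k" by (rule prob_space_cube)
  have "(\<integral>v. rho D k v \<partial>cube k) = (\<integral>v. rho D 1 (snd x\<^sub>0) \<partial>cube k)"
    using True by (intro Bochner_Integration.integral_cong) (auto simp: space_cube x\<^sub>0_def)
  then show ?thesis
    using True prob_space by (simp add: rho_total_def)
qed (simp add: rho_total_def)

lemma rho_total_bounds: "0 \<le> rho_total D k" "rho_total D k \<le> 1"
proof -
  interpret prob_space "cube k" by (rule prob_space_cube)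
  show "0 \<le> rho_total D k"
    unfolding rho_total_eq using rho_pos by (intro Bochner_Integration.integral_nonneg) (simp add: less_imp_le)
  have "(\<integral>v. rho D k v \<partial>cube k) \<le> (\<integral>v. 1 \<partial>cube k)"
    using integrable_rho rho_le_1 by (intro integral_mono) simp_all
  then show "rho_total D k \<le> 1"
    by (simp add: rho_total_eq prob_space)
qed

lemma summable_weights: "summable (\<lambda>k. pmf \<kappa> (Suc k) * rho_total D (Suc k))"
proof (rule summable_comparison_test')
  have "summable (\<lambda>k. pmf \<kappa> k)"
    using integrable_pmf[of UNIV \<kappa>] by (simp add: integrable_count_space_nat_iff)
  then show "summable (\<lambda>k. pmf \<kappa> (Suc k))"
    by (subst summable_Suc_iff)
  show "norm (pmf \<kappa> (Suc k) * rho_total D (Suc k)) \<le> pmf \<kappa> (Suc k)" for k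
    using rho_total_bounds[of "Suc k"] by (simp add: abs_mult mult_left_le)
qed

lemma pmf_pos: "k \<ge> 1 \<Longrightarrow> 0 < pmf \<kappa> k"
  using support by (intro pmf_positive) auto

text \<open>The term of the empty vector is already positive.\<close>

lemma norm_const_pos: "0 < norm_const D \<kappa>"
  unfolding norm_const_def
proof (rule suminf_pos2[OF summable_weights])
  show "0 \<le> pmf \<kappa> (Suc k) * rho_total D (Suc k)" for k
    using rho_total_bounds by simp
  show "0 < pmf \<kappa> (Suc 0) * rho_total D (Suc 0)"
    using pmf_pos[of 1] rho_pos[of 1] by (simp add: rho_total_def)
qed

lemma measurable_phi [measurable]: "phi D \<kappa> \<in> borel_measurable SX"
proof (rule measurable_SX_I)
  show "(\<lambda>v. phi D \<kappa> (k, v)) \<in> borel_measurable (cube k)" for k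
    unfolding phi_def by (simp add: measurable_rho)
qed

lemma phi_pos: "x \<in> space SX \<Longrightarrow> 0 < phi D \<kappa> x"
  using pmf_pos rho_pos norm_const_pos by (auto simp: phi_def space_SX layer_def)

lemma measurable_tau: "f \<in> SX \<rightarrow>\<^sub>M N \<Longrightarrow> f \<in> tau \<rightarrow>\<^sub>M N"
  by (simp add: measurable_cong_sets[OF sets_tau refl])

lemma sets_post [simp]: "sets (post D \<kappa>) = sets SX"
  and space_post [simp]: "space (post D \<kappa>) = space SX"
  by (simp_all add: post_def)

lemma nn_integral_post:
  "f \<in> borel_measurable SX \<Longrightarrow> (\<integral>\<^sup>+x. f x \<partial>post D \<kappa>) = (\<integral>\<^sup>+x. ennreal (phi D \<kappa> x) * f x \<partial>tau)"
  unfolding post_def by (intro nn_integral_density measurable_tau) (auto intro: measurable_compose[OF measurable_phi])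

lemma prob_space_post: "prob_space (post D \<kappa>)"
proof (rule prob_spaceI)
  let ?w = "\<lambda>k. pmf \<kappa> (Suc k) * rho_total D (Suc k)"
  have layer: "(\<integral>\<^sup>+v. ennreal (phi D \<kappa> (Suc k, v)) \<partial>cube (Suc k)) = ennreal (?w k / norm_const D \<kappa>)" for k
  proof -
    have "(\<integral>\<^sup>+v. ennreal (phi D \<kappa> (Suc k, v)) \<partial>cube (Suc k))
        = ennreal (\<integral>v. phi D \<kappa> (Suc k, v) \<partial>cube (Suc k))"
      using integrable_rho[of "Suc k"] rho_pos norm_const_pos
      by (intro nn_integral_eq_integral AE_I2) (simp_all add: phi_def less_imp_le)
    then show ?thesis
      by (simp add: phi_def rho_total_eq)
  qed
  have "emeasure (post D \<kappa>) (space (post D \<kappa>)) = (\<integral>\<^sup>+x. 1 \<partial>post D \<kappa>)"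
    by simp
  also have "\<dots> = (\<integral>\<^sup>+x. ennreal (phi D \<kappa> x) \<partial>tau)"
    by (subst nn_integral_post) simp_all
  also have "\<dots> = (\<Sum>k. ennreal (?w k / norm_const D \<kappa>))"
    by (subst nn_integral_tau) (simp_all add: layer)
  also have "\<dots> = ennreal (\<Sum>k. ?w k / norm_const D \<kappa>)"
    using rho_total_bounds norm_const_pos summable_weights
    by (intro suminf_ennreal2 summable_divide) simp_all
  also have "(\<Sum>k. ?w k / norm_const D \<kappa>) = 1"
    using suminf_divide[OF summable_weights, of "norm_const D \<kappa>"] norm_const_pos
    by (simp add: norm_const_def[symmetric])
  finally show "emeasure (post D \<kappa>) (space (post D \<kappa>)) = 1"
    by simp
qed

end

section \<open>Metropolis--Hastings kernels\<close>

lemma measurable_acceptance: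
  assumes "case_prod \<alpha> \<in> borel_measurable (SX \<Otimes>\<^sub>M SX)"
  shows "(\<lambda>z. ennreal (\<alpha> (fst z) (snd z))) \<in> borel_measurable (SX \<Otimes>\<^sub>M SX)"
  using assms by (simp add: split_beta')

lemma emeasure_accepted:
  assumes K: "SX_kernel K" and \<alpha>: "case_prod \<alpha> \<in> borel_measurable (SX \<Otimes>\<^sub>M SX)"
    and x: "x \<in> space SX" and B: "B \<in> sets SX"
  shows "emeasure (density (K x) (\<lambda>y. ennreal (\<alpha> x y))) B = (\<integral>\<^sup>+y. ennreal (\<alpha> x y) * indicator B y \<partial>K x)"
proof (rule emeasure_density)
  show "(\<lambda>y. ennreal (\<alpha> x y)) \<in> borel_measurable (K x)"
    using measurable_section(1)[OF measurable_acceptance[OF \<alpha>] x]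
    by (simp add: measurable_cong_sets[OF sets_kernel_prob[OF K x] refl])
qed (use B sets_kernel_prob[OF K x] in simp)

lemma emeasure_accept_reject:
  assumes K: "SX_kernel K" and \<alpha>: "case_prod \<alpha> \<in> borel_measurable (SX \<Otimes>\<^sub>M SX)"
    and x: "x \<in> space SX" and B: "B \<in> sets SX"
  shows "emeasure (accept_reject SX \<alpha> K x) B
    = (\<integral>\<^sup>+y. ennreal (\<alpha> x y) * indicator B y \<partial>K x)
      + (1 - (\<integral>\<^sup>+y. ennreal (\<alpha> x y) \<partial>K x)) * indicator B x"
proof -
  let ?Q = "density (K x) (\<lambda>y. ennreal (\<alpha> x y))"
  have "emeasure (accept_reject SX \<alpha> K x) B
      = (\<Sum>(c, M)\<leftarrow>[(1, ?Q), (1 - emeasure ?Q (space SX), return SX x)]. c * emeasure M B)"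
    unfolding accept_reject_def Let_def
  proof (rule emeasure_mixture[OF _ B])
    fix c M assume "(c, M) \<in> set [(1, ?Q), (1 - emeasure ?Q (space SX), return SX x)]"
    then have "M = ?Q \<or> M = return SX x" by auto
    then show "sets M = sets SX"
      using sets_kernel_prob[OF K x] by (elim disjE) simp_all
  qed
  moreover have "emeasure ?Q (space SX) = (\<integral>\<^sup>+y. ennreal (\<alpha> x y) \<partial>K x)"
    unfolding emeasure_accepted[OF K \<alpha> x sets.top]
    by (intro nn_integral_cong) (simp add: space_kernel_prob[OF K x])
  ultimately show ?thesis
    using B by (simp add: emeasure_accepted[OF K \<alpha> x B])
qed

lemma accept_reject_kernel:
  assumes K: "SX_kernel K" and \<alpha>: "case_prod \<alpha> \<in> borel_measurable (SX \<Otimes>\<^sub>M SX)"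
    and le1: "\<And>x y. x \<in> space SX \<Longrightarrow> y \<in> space SX \<Longrightarrow> \<alpha> x y \<le> 1"
  shows "SX_kernel (accept_reject SX \<alpha> K)"
proof -
  let ?Q = "\<lambda>x. density (K x) (\<lambda>y. ennreal (\<alpha> x y))"
  let ?cs = "[(\<lambda>_. 1, ?Q), (\<lambda>x. 1 - emeasure (?Q x) (space SX), return SX)]"
  have le: "(\<integral>\<^sup>+y. ennreal (\<alpha> x y) \<partial>K x) \<le> 1" if x: "x \<in> space SX" for x
  proof -
    have "(\<integral>\<^sup>+y. ennreal (\<alpha> x y) \<partial>K x) \<le> (\<integral>\<^sup>+y. 1 \<partial>K x)"
      using le1[OF x] by (intro nn_integral_mono) (simp add: space_kernel_prob[OF K x])
    then show ?thesis
      using prob_space.emeasure_space_1[OF prob_space_kernel_prob[OF K x]] by simp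
  qed
  have Q: "?Q \<in> SX \<rightarrow>\<^sub>M subprob_algebra SX"
    using le \<alpha> by (intro measurable_kernel_density measurable_prob_algebraD[OF K]) (simp_all add: split_beta')
  have Q1: "(\<lambda>x. emeasure (?Q x) (space SX)) \<in> borel_measurable SX"
    using measurable_emeasure_kernel[OF Q sets.top] .
  have "(\<lambda>x. mixture SX (map (\<lambda>(c, M). (c x, M x)) ?cs)) \<in> SX \<rightarrow>\<^sub>M prob_algebra SX"
  proof (rule measurable_mixture)
    fix c M assume "(c, M) \<in> set ?cs"
    then have "(c = (\<lambda>_. 1) \<and> M = ?Q) \<or> (c = (\<lambda>x. 1 - emeasure (?Q x) (space SX)) \<and> M = return SX)"
      by auto
    then show "c \<in> borel_measurable SX \<and> M \<in> SX \<rightarrow>\<^sub>M subprob_algebra SX"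
      using Q Q1 by (elim disjE conjE) simp_all
  next
    fix x assume x: "x \<in> space SX"
    have "emeasure (?Q x) (space SX) \<le> 1"
      using le[OF x] unfolding emeasure_accepted[OF K \<alpha> x sets.top]
      by (rule order_trans[rotated]) (intro nn_integral_mono, simp split: split_indicator)
    then show "(\<Sum>(c, M)\<leftarrow>?cs. c x * emeasure (M x) (space SX)) = 1"
      using x by (simp add: add_diff_inverse_ennreal)
  qed
  then show ?thesis
    by (simp add: accept_reject_def[abs_def] Let_def)
qed

text \<open>Rejection leaves the state unchanged, so it contributes the same amount to both sides; only the flow of
  accepted moves has to be symmetric.\<close>

lemma detailed_balance_accept_reject:
  assumes K: "SX_kernel K" and \<alpha>: "case_prod \<alpha> \<in> borel_measurable (SX \<Otimes>\<^sub>M SX)"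
    and \<mu>: "sets \<mu> = sets SX"
    and flow: "\<And>F. F \<in> borel_measurable (SX \<Otimes>\<^sub>M SX) \<Longrightarrow>
      (\<integral>\<^sup>+x. \<integral>\<^sup>+y. ennreal (\<alpha> x y) * F (x, y) \<partial>K x \<partial>\<mu>) = (\<integral>\<^sup>+x. \<integral>\<^sup>+y. ennreal (\<alpha> x y) * F (y, x) \<partial>K x \<partial>\<mu>)"
  shows "detailed_balance SX (accept_reject SX \<alpha> K) \<mu>"
  unfolding detailed_balance_def
proof (intro ballI)
  fix A B assume AB [measurable]: "A \<in> sets SX" "B \<in> sets SX"
  note \<alpha>m [measurable] = measurable_acceptance[OF \<alpha>]
  have sp: "space \<mu> = space SX"
    using \<mu> by (rule sets_eq_imp_space_eq)
  let ?r = "\<lambda>x. (1 - (\<integral>\<^sup>+y. ennreal (\<alpha> x y) \<partial>K x)) * indicator (A \<inter> B) x"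
  have r: "?r \<in> borel_measurable SX"
    using nn_integral_kernel_measurable[OF K \<alpha>m] by simp
  have split: "(\<integral>\<^sup>+x\<in>A'. emeasure (accept_reject SX \<alpha> K x) B' \<partial>\<mu>)
      = (\<integral>\<^sup>+x. \<integral>\<^sup>+y. ennreal (\<alpha> x y) * (indicator A' x * indicator B' y) \<partial>K x \<partial>\<mu>) + (\<integral>\<^sup>+x. ?r x \<partial>\<mu>)"
    if AB' [measurable]: "A' \<in> sets SX" "B' \<in> sets SX" and int: "A' \<inter> B' = A \<inter> B" for A' B'
  proof -
    have m: "(\<lambda>x. \<integral>\<^sup>+y. ennreal (\<alpha> x y) * (indicator A' x * indicator B' y) \<partial>K x) \<in> borel_measurable SX"
      using nn_integral_kernel_measurable[OF K, of "\<lambda>z. ennreal (\<alpha> (fst z) (snd z)) * (indicator A' (fst z) * indicator B' (snd z))"]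
      by simp
    have "(\<integral>\<^sup>+x\<in>A'. emeasure (accept_reject SX \<alpha> K x) B' \<partial>\<mu>)
        = (\<integral>\<^sup>+x. (\<integral>\<^sup>+y. ennreal (\<alpha> x y) * (indicator A' x * indicator B' y) \<partial>K x) + ?r x \<partial>\<mu>)"
    proof (rule nn_integral_cong)
      fix x assume "x \<in> space \<mu>"
      then have x: "x \<in> space SX" by (simp add: sp)
      have "indicator A' x * indicator B' x = (indicator (A \<inter> B) x :: ennreal)"
        unfolding int[symmetric] by (simp add: indicator_inter_arith)
      then show "emeasure (accept_reject SX \<alpha> K x) B' * indicator A' x
          = (\<integral>\<^sup>+y. ennreal (\<alpha> x y) * (indicator A' x * indicator B' y) \<partial>K x) + ?r x"
        unfolding emeasure_accept_reject[OF K \<alpha> x AB'(2)]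
        by (cases "x \<in> A'") (simp_all add: mult_ac)
    qed
    also have "\<dots> = (\<integral>\<^sup>+x. \<integral>\<^sup>+y. ennreal (\<alpha> x y) * (indicator A' x * indicator B' y) \<partial>K x \<partial>\<mu>) + (\<integral>\<^sup>+x. ?r x \<partial>\<mu>)"
      using m r by (intro nn_integral_add) (simp_all add: measurable_cong_sets[OF \<mu> refl])
    finally show ?thesis .
  qed
  show "(\<integral>\<^sup>+x\<in>A. emeasure (accept_reject SX \<alpha> K x) B \<partial>\<mu>) = (\<integral>\<^sup>+x\<in>B. emeasure (accept_reject SX \<alpha> K x) A \<partial>\<mu>)"
    unfolding split[OF AB refl] split[OF AB(2,1) Int_commute]
    using flow[of "\<lambda>z. indicator A (fst z) * indicator B (snd z)"] by (simp add: mult.commute)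
qed

lemma detailed_balance_mixture:
  assumes \<mu>: "sets \<mu> = sets SX"
    and K: "\<And>c K. (c, K) \<in> set cs \<Longrightarrow> SX_kernel K"
    and bal: "\<And>c K. (c, K) \<in> set cs \<Longrightarrow> detailed_balance SX K \<mu>"
  shows "detailed_balance SX (\<lambda>x. mixture SX (map (\<lambda>(c, K). (c, K x)) cs)) \<mu>"
  unfolding detailed_balance_def
proof (intro ballI)
  fix A B assume AB: "A \<in> sets SX" "B \<in> sets SX"
  have sp: "space \<mu> = space SX"
    using \<mu> by (rule sets_eq_imp_space_eq)
  have expand: "(\<integral>\<^sup>+x\<in>A. emeasure (mixture SX (map (\<lambda>(c, K). (c, K x)) cs)) B \<partial>\<mu>)
      = (\<Sum>(c, K)\<leftarrow>cs. c * (\<integral>\<^sup>+x\<in>A. emeasure (K x) B \<partial>\<mu>))"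
    if A [measurable]: "A \<in> sets SX" and B: "B \<in> sets SX" for A B
  proof -
    have "(\<integral>\<^sup>+x\<in>A. emeasure (mixture SX (map (\<lambda>(c, K). (c, K x)) cs)) B \<partial>\<mu>)
        = (\<integral>\<^sup>+x. (\<Sum>(c, K)\<leftarrow>cs. c * emeasure (K x) B) * indicator A x \<partial>\<mu>)"
      by (rule nn_integral_cong) (simp add: sp emeasure_mixture_kernels[OF K _ B])
    moreover have "(\<integral>\<^sup>+x. (\<Sum>(c, K)\<leftarrow>cs. c * emeasure (K x) B) * indicator A x \<partial>\<mu>) = (\<Sum>(c, K)\<leftarrow>cs. c * (\<integral>\<^sup>+x\<in>A. emeasure (K x) B \<partial>\<mu>))
        \<and> (\<lambda>x. \<Sum>(c, K)\<leftarrow>cs. c * emeasure (K x) B) \<in> borel_measurable \<mu>"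
      using K
    proof (induction cs)
      case (Cons z cs)
      obtain c K where z: "z = (c, K)" by force
      have "(\<lambda>x. emeasure (K x) B) \<in> borel_measurable SX"
        using measurable_emeasure_kernel[OF measurable_prob_algebraD B] Cons.prems z by auto
      then have [measurable]: "(\<lambda>x. emeasure (K x) B) \<in> borel_measurable \<mu>" "A \<in> sets \<mu>"
        using A by (simp_all add: measurable_cong_sets[OF \<mu> refl] \<mu>)
      have IH: "(\<integral>\<^sup>+x. (\<Sum>(c, K)\<leftarrow>cs. c * emeasure (K x) B) * indicator A x \<partial>\<mu>) = (\<Sum>(c, K)\<leftarrow>cs. c * (\<integral>\<^sup>+x\<in>A. emeasure (K x) B \<partial>\<mu>))"
        and [measurable]: "(\<lambda>x. \<Sum>(c, K)\<leftarrow>cs. c * emeasure (K x) B) \<in> borel_measurable \<mu>"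
        using Cons by auto
      show ?case
        by (simp add: z IH distrib_right mult.assoc nn_integral_add nn_integral_cmult)
    qed simp
    ultimately show ?thesis by simp
  qed
  show "(\<integral>\<^sup>+x\<in>A. emeasure (mixture SX (map (\<lambda>(c, K). (c, K x)) cs)) B \<partial>\<mu>)
      = (\<integral>\<^sup>+x\<in>B. emeasure (mixture SX (map (\<lambda>(c, K). (c, K x)) cs)) A \<partial>\<mu>)"
    unfolding expand[OF AB] expand[OF AB(2,1)] using bal AB
    by (intro arg_cong[where f = sum_list] map_cong refl) (auto simp: detailed_balance_def)
qed

context posterior
begin

lemma measurable_alpha_ratio: "case_prod (alpha_ratio D \<kappa>) \<in> borel_measurable (SX \<Otimes>\<^sub>M SX)"
  unfolding alpha_ratio_def split_beta' by measurable

lemma alpha_ratio_bounds: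
  assumes "x \<in> space SX" "y \<in> space SX"
  shows "0 < alpha_ratio D \<kappa> x y" "alpha_ratio D \<kappa> x y \<le> 1"
  using phi_pos[OF assms(1)] phi_pos[OF assms(2)] by (auto simp: alpha_ratio_def)

lemma ratio_kernel: "SX_kernel K \<Longrightarrow> SX_kernel (accept_reject SX (alpha_ratio D \<kappa>) K)"
  using alpha_ratio_bounds(2) by (intro accept_reject_kernel measurable_alpha_ratio)

lemma phi_times_alpha_ratio:
  assumes "x \<in> space SX" "y \<in> space SX"
  shows "ennreal (phi D \<kappa> x) * ennreal (alpha_ratio D \<kappa> x y) = ennreal (min (phi D \<kappa> x) (phi D \<kappa> y))"
proof -
  have "phi D \<kappa> x * alpha_ratio D \<kappa> x y = min (phi D \<kappa> x) (phi D \<kappa> y)"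
    using phi_pos[OF assms(1)] by (simp add: alpha_ratio_def min_def field_simps)
  then show ?thesis
    using phi_pos[OF assms(1)] alpha_ratio_bounds[OF assms] by (simp add: ennreal_mult[symmetric])
qed

lemma detailed_balance_ratio:
  assumes K: "SX_kernel K" and rev: "reverses tau K K"
  shows "detailed_balance SX (accept_reject SX (alpha_ratio D \<kappa>) K) (post D \<kappa>)"
proof (rule detailed_balance_accept_reject[OF K measurable_alpha_ratio sets_post])
  fix F :: "state \<times> state \<Rightarrow> ennreal" assume F [measurable]: "F \<in> borel_measurable (SX \<Otimes>\<^sub>M SX)"
  note \<alpha>m [measurable] = measurable_acceptance[OF measurable_alpha_ratio]
  let ?m = "\<lambda>z. ennreal (min (phi D \<kappa> (fst z)) (phi D \<kappa> (snd z)))"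
  have expand: "(\<integral>\<^sup>+x. \<integral>\<^sup>+y. ennreal (alpha_ratio D \<kappa> x y) * G (x, y) \<partial>K x \<partial>post D \<kappa>)
      = (\<integral>\<^sup>+x. \<integral>\<^sup>+y. ?m (x, y) * G (x, y) \<partial>K x \<partial>tau)"
    if G [measurable]: "G \<in> borel_measurable (SX \<Otimes>\<^sub>M SX)" for G
  proof -
    have aG: "(\<lambda>z. ennreal (alpha_ratio D \<kappa> (fst z) (snd z)) * G z) \<in> borel_measurable (SX \<Otimes>\<^sub>M SX)"
      by measurable
    have "(\<integral>\<^sup>+x. \<integral>\<^sup>+y. ennreal (alpha_ratio D \<kappa> x y) * G (x, y) \<partial>K x \<partial>post D \<kappa>)
        = (\<integral>\<^sup>+x. ennreal (phi D \<kappa> x) * (\<integral>\<^sup>+y. ennreal (alpha_ratio D \<kappa> x y) * G (x, y) \<partial>K x) \<partial>tau)"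
      using nn_integral_kernel_measurable[OF K aG] by (intro nn_integral_post) simp
    also have "\<dots> = (\<integral>\<^sup>+x. \<integral>\<^sup>+y. ?m (x, y) * G (x, y) \<partial>K x \<partial>tau)"
    proof (rule nn_integral_cong)
      fix x assume "x \<in> space tau"
      then have x: "x \<in> space SX" by simp
      have "(\<lambda>y. ennreal (alpha_ratio D \<kappa> x y) * G (x, y)) \<in> borel_measurable (K x)"
        using measurable_section(1)[OF aG x] by (simp add: measurable_cong_sets[OF sets_kernel_prob[OF K x] refl])
      then have "ennreal (phi D \<kappa> x) * (\<integral>\<^sup>+y. ennreal (alpha_ratio D \<kappa> x y) * G (x, y) \<partial>K x)
          = (\<integral>\<^sup>+y. ennreal (phi D \<kappa> x) * (ennreal (alpha_ratio D \<kappa> x y) * G (x, y)) \<partial>K x)"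
        by (rule nn_integral_cmult[symmetric])
      also have "\<dots> = (\<integral>\<^sup>+y. ?m (x, y) * G (x, y) \<partial>K x)"
        using phi_times_alpha_ratio[OF x]
        by (intro nn_integral_cong) (simp add: space_kernel_prob[OF K x] mult.assoc[symmetric])
      finally show "ennreal (phi D \<kappa> x) * (\<integral>\<^sup>+y. ennreal (alpha_ratio D \<kappa> x y) * G (x, y) \<partial>K x)
          = (\<integral>\<^sup>+y. ?m (x, y) * G (x, y) \<partial>K x)" .
    qed
    finally show ?thesis .
  qed
  have "(\<integral>\<^sup>+x. \<integral>\<^sup>+y. ?m (x, y) * F (x, y) \<partial>K x \<partial>tau) = (\<integral>\<^sup>+x. \<integral>\<^sup>+y. ?m (x, y) * F (y, x) \<partial>K x \<partial>tau)"
    using reversesD[OF rev, of "\<lambda>z. ?m z * F z"] by (simp add: min.commute)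
  then show "(\<integral>\<^sup>+x. \<integral>\<^sup>+y. ennreal (alpha_ratio D \<kappa> x y) * F (x, y) \<partial>K x \<partial>post D \<kappa>)
      = (\<integral>\<^sup>+x. \<integral>\<^sup>+y. ennreal (alpha_ratio D \<kappa> x y) * F (y, x) \<partial>K x \<partial>post D \<kappa>)"
    using expand[OF F] expand[OF measurable_swapped[OF F]] by simp
qed

end

locale independent_density =
  fixes \<xi> :: "state \<Rightarrow> state \<Rightarrow> real"
  assumes \<xi>: "case_prod \<xi> \<in> borel_measurable (SX \<Otimes>\<^sub>M SX)"
    and \<xi>_nonneg: "\<And>x y. x \<in> space SX \<Longrightarrow> y \<in> space SX \<Longrightarrow> \<xi> x y \<ge> 0"
    and \<xi>_mass: "\<And>x. x \<in> space SX \<Longrightarrow> (\<integral>\<^sup>+y. ennreal (\<xi> x y) \<partial>tau) = 1"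
begin

lemma \<xi>_section: "x \<in> space SX \<Longrightarrow> (\<lambda>y. ennreal (\<xi> x y)) \<in> borel_measurable tau"
  using measurable_section(1)[OF measurable_acceptance[OF \<xi>]]
  by (simp add: measurable_cong_sets[OF sets_tau refl])

lemma prop4_kernel: "SX_kernel (prop4 \<xi>)"
proof (rule measurable_prob_algebraI)
  interpret tau: sigma_finite_measure tau by (rule sigma_finite_tau)
  show prob: "prob_space (prop4 \<xi> x)" if x: "x \<in> space SX" for x
  proof (rule prob_spaceI)
    have "emeasure (prop4 \<xi> x) (space SX) = (\<integral>\<^sup>+y. ennreal (\<xi> x y) * indicator (space SX) y \<partial>tau)"
      unfolding prop4_def using \<xi>_section[OF x] by (intro emeasure_density) simp_all
    also have "\<dots> = (\<integral>\<^sup>+y. ennreal (\<xi> x y) \<partial>tau)"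
      by (intro nn_integral_cong) simp
    finally show "emeasure (prop4 \<xi> x) (space (prop4 \<xi> x)) = 1"
      using \<xi>_mass[OF x] by (simp add: prop4_def)
  qed
  show "prop4 \<xi> \<in> SX \<rightarrow>\<^sub>M subprob_algebra SX"
  proof (rule measurable_subprob_algebra)
    fix A assume A [measurable]: "A \<in> sets SX"
    note [measurable] = measurable_acceptance[OF \<xi>]
    have "(\<lambda>(x, y). ennreal (\<xi> x y) * indicator A y) \<in> borel_measurable (SX \<Otimes>\<^sub>M SX)"
      unfolding split_beta' by measurable
    moreover have "sets (SX \<Otimes>\<^sub>M tau) = sets (SX \<Otimes>\<^sub>M SX)"
      by (intro sets_pair_measure_cong) simp_all
    ultimately have "(\<lambda>(x, y). ennreal (\<xi> x y) * indicator A y) \<in> borel_measurable (SX \<Otimes>\<^sub>M tau)"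
      by (subst measurable_cong_sets[OF _ refl])
    then have "(\<lambda>x. \<integral>\<^sup>+y. ennreal (\<xi> x y) * indicator A y \<partial>tau) \<in> borel_measurable SX"
      by (rule tau.borel_measurable_nn_integral)
    moreover have "emeasure (prop4 \<xi> x) A = (\<integral>\<^sup>+y. ennreal (\<xi> x y) * indicator A y \<partial>tau)" if "x \<in> space SX" for x
      unfolding prop4_def using \<xi>_section[OF that] A by (intro emeasure_density) simp_all
    ultimately show "(\<lambda>x. emeasure (prop4 \<xi> x) A) \<in> borel_measurable SX"
      by (simp cong: measurable_cong)
  qed (use prob in \<open>auto intro: prob_space_imp_subprob_space simp: prop4_def\<close>)
qed

end

locale posterior_independent = posterior + independent_density
begin

lemma measurable_alpha4: "case_prod (alpha4 D \<kappa> \<xi>) \<in> borel_measurable (SX \<Otimes>\<^sub>M SX)"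
proof -
  have [measurable]: "(\<lambda>z. \<xi> (fst z) (snd z)) \<in> borel_measurable (SX \<Otimes>\<^sub>M SX)"
    using \<xi> by (simp add: split_beta')
  have [measurable]: "(\<lambda>z. \<xi> (snd z) (fst z)) \<in> borel_measurable (SX \<Otimes>\<^sub>M SX)"
    using measurable_pair_swap[OF \<xi>] by (simp add: split_beta')
  show ?thesis
    unfolding alpha4_def split_beta' by measurable
qed

text \<open>Where the proposal density vanishes, the second argument of the minimum may be positive, but the first
  is zero, as is the left-hand side.\<close>

lemma prop4_flow:
  assumes "x \<in> space SX" "y \<in> space SX"
  shows "ennreal (phi D \<kappa> x) * (ennreal (\<xi> x y) * ennreal (alpha4 D \<kappa> \<xi> x y))
    = ennreal (min (phi D \<kappa> x * \<xi> x y) (phi D \<kappa> y * \<xi> y x))"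
proof -
  have pos: "0 < phi D \<kappa> x" "0 < phi D \<kappa> y" "0 \<le> \<xi> x y" "0 \<le> \<xi> y x"
    using assms phi_pos \<xi>_nonneg by auto
  have "0 \<le> alpha4 D \<kappa> \<xi> x y"
    using pos by (simp add: alpha4_def)
  moreover have "phi D \<kappa> x * (\<xi> x y * alpha4 D \<kappa> \<xi> x y) = min (phi D \<kappa> x * \<xi> x y) (phi D \<kappa> y * \<xi> y x)"
  proof (cases "\<xi> x y = 0")
    case True
    then show ?thesis using pos by simp
  next
    case False
    then have a: "0 < phi D \<kappa> x * \<xi> x y"
      using pos by simp
    have "a * min 1 (b / a) = min a b" if "0 < a" for a b :: real
      using that by (simp add: min_def field_simps)
    from this[OF a, of "phi D \<kappa> y * \<xi> y x"] show ?thesis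
      using a by (simp add: alpha4_def mult.assoc)
  qed
  ultimately show ?thesis
    using pos by (simp add: ennreal_mult[symmetric])
qed

lemma detailed_balance_prop4:
  "detailed_balance SX (accept_reject SX (alpha4 D \<kappa> \<xi>) (prop4 \<xi>)) (post D \<kappa>)"
proof (rule detailed_balance_accept_reject[OF prop4_kernel measurable_alpha4 sets_post])
  fix F :: "state \<times> state \<Rightarrow> ennreal" assume F [measurable]: "F \<in> borel_measurable (SX \<Otimes>\<^sub>M SX)"
  interpret tau: sigma_finite_measure tau by (rule sigma_finite_tau)
  interpret tt: pair_sigma_finite tau tau ..
  note \<alpha>m [measurable] = measurable_acceptance[OF measurable_alpha4]
  let ?m = "\<lambda>x y. ennreal (min (phi D \<kappa> x * \<xi> x y) (phi D \<kappa> y * \<xi> y x))"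
  have tt_sets: "sets (tau \<Otimes>\<^sub>M tau) = sets (SX \<Otimes>\<^sub>M SX)"
    by (intro sets_pair_measure_cong) simp_all
  have expand: "(\<integral>\<^sup>+x. \<integral>\<^sup>+y. ennreal (alpha4 D \<kappa> \<xi> x y) * G (x, y) \<partial>prop4 \<xi> x \<partial>post D \<kappa>)
      = (\<integral>\<^sup>+x. \<integral>\<^sup>+y. ?m x y * G (x, y) \<partial>tau \<partial>tau)"
    if G [measurable]: "G \<in> borel_measurable (SX \<Otimes>\<^sub>M SX)" for G
  proof -
    have aG: "(\<lambda>z. ennreal (alpha4 D \<kappa> \<xi> (fst z) (snd z)) * G z) \<in> borel_measurable (SX \<Otimes>\<^sub>M SX)"
      by measurable
    have "(\<integral>\<^sup>+x. \<integral>\<^sup>+y. ennreal (alpha4 D \<kappa> \<xi> x y) * G (x, y) \<partial>prop4 \<xi> x \<partial>post D \<kappa>)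
        = (\<integral>\<^sup>+x. ennreal (phi D \<kappa> x) * (\<integral>\<^sup>+y. ennreal (alpha4 D \<kappa> \<xi> x y) * G (x, y) \<partial>prop4 \<xi> x) \<partial>tau)"
      using nn_integral_kernel_measurable[OF prop4_kernel aG] by (intro nn_integral_post) simp
    also have "\<dots> = (\<integral>\<^sup>+x. \<integral>\<^sup>+y. ?m x y * G (x, y) \<partial>tau \<partial>tau)"
    proof (rule nn_integral_cong)
      fix x assume "x \<in> space tau"
      then have x: "x \<in> space SX" by simp
      have aGx: "(\<lambda>y. ennreal (alpha4 D \<kappa> \<xi> x y) * G (x, y)) \<in> borel_measurable tau"
        using measurable_section(1)[OF aG x] by (simp add: measurable_cong_sets[OF sets_tau refl])
      have "(\<integral>\<^sup>+y. ennreal (alpha4 D \<kappa> \<xi> x y) * G (x, y) \<partial>prop4 \<xi> x)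
          = (\<integral>\<^sup>+y. ennreal (\<xi> x y) * (ennreal (alpha4 D \<kappa> \<xi> x y) * G (x, y)) \<partial>tau)"
        unfolding prop4_def by (rule nn_integral_density[OF \<xi>_section[OF x] aGx])
      then have "ennreal (phi D \<kappa> x) * (\<integral>\<^sup>+y. ennreal (alpha4 D \<kappa> \<xi> x y) * G (x, y) \<partial>prop4 \<xi> x)
          = (\<integral>\<^sup>+y. ennreal (phi D \<kappa> x) * (ennreal (\<xi> x y) * (ennreal (alpha4 D \<kappa> \<xi> x y) * G (x, y))) \<partial>tau)"
        using nn_integral_cmult[OF borel_measurable_times_ennreal[OF \<xi>_section[OF x] aGx]] by simp
      also have "\<dots> = (\<integral>\<^sup>+y. ?m x y * G (x, y) \<partial>tau)"
        by (intro nn_integral_cong) (simp add: prop4_flow[OF x, symmetric] mult.assoc)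
      finally show "ennreal (phi D \<kappa> x) * (\<integral>\<^sup>+y. ennreal (alpha4 D \<kappa> \<xi> x y) * G (x, y) \<partial>prop4 \<xi> x)
          = (\<integral>\<^sup>+y. ?m x y * G (x, y) \<partial>tau)" .
    qed
    finally show ?thesis .
  qed
  have [measurable]: "(\<lambda>z. \<xi> (fst z) (snd z)) \<in> borel_measurable (SX \<Otimes>\<^sub>M SX)"
    using \<xi> by (simp add: split_beta')
  have [measurable]: "(\<lambda>z. \<xi> (snd z) (fst z)) \<in> borel_measurable (SX \<Otimes>\<^sub>M SX)"
    using measurable_pair_swap[OF \<xi>] by (simp add: split_beta')
  have "(\<lambda>(x, y). ?m x y * F (x, y)) \<in> borel_measurable (SX \<Otimes>\<^sub>M SX)"
    unfolding split_beta' by measurable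
  then have "(\<lambda>(x, y). ?m x y * F (x, y)) \<in> borel_measurable (tau \<Otimes>\<^sub>M tau)"
    by (subst measurable_cong_sets[OF tt_sets refl])
  from tt.Fubini'[OF this]
  have "(\<integral>\<^sup>+x. \<integral>\<^sup>+y. ?m x y * F (x, y) \<partial>tau \<partial>tau) = (\<integral>\<^sup>+y. \<integral>\<^sup>+x. ?m x y * F (x, y) \<partial>tau \<partial>tau)"
    by simp
  also have "\<dots> = (\<integral>\<^sup>+x. \<integral>\<^sup>+y. ?m x y * F (y, x) \<partial>tau \<partial>tau)"
    by (simp add: min.commute)
  finally show "(\<integral>\<^sup>+x. \<integral>\<^sup>+y. ennreal (alpha4 D \<kappa> \<xi> x y) * F (x, y) \<partial>prop4 \<xi> x \<partial>post D \<kappa>)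
      = (\<integral>\<^sup>+x. \<integral>\<^sup>+y. ennreal (alpha4 D \<kappa> \<xi> x y) * F (y, x) \<partial>prop4 \<xi> x \<partial>post D \<kappa>)"
    using expand[OF F] expand[OF measurable_swapped[OF F]] by simp
qed

end

section \<open>The mixed chain\<close>

lemma emeasure_mixture_ge:
  assumes K: "\<And>c K. (c, K) \<in> set ((c0, K0) # cs) \<Longrightarrow> SX_kernel K" and x: "x \<in> space SX" and B: "B \<in> sets SX"
  shows "c0 * emeasure (K0 x) B \<le> emeasure (mixture SX (map (\<lambda>(c, K). (c, K x)) ((c0, K0) # cs))) B"
proof -
  have "emeasure (mixture SX (map (\<lambda>(c, K). (c, K x)) ((c0, K0) # cs))) B
      = (\<Sum>(c, K)\<leftarrow>(c0, K0) # cs. c * emeasure (K x) B)"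
    using K x B by (rule emeasure_mixture_kernels)
  then show ?thesis
    by simp
qed

lemma invariant_of_detailed_balance:
  assumes K: "SX_kernel K" and \<mu>: "sets \<mu> = sets SX" "prob_space \<mu>" and bal: "detailed_balance SX K \<mu>"
  shows "invariant_distribution SX K \<mu>"
  unfolding invariant_distribution_def
proof (intro conjI ballI \<mu>)
  fix B assume B: "B \<in> sets SX"
  have sp: "space \<mu> = space SX"
    using \<mu>(1) by (rule sets_eq_imp_space_eq)
  have "(\<integral>\<^sup>+x. emeasure (K x) B \<partial>\<mu>) = (\<integral>\<^sup>+x\<in>space SX. emeasure (K x) B \<partial>\<mu>)"
    by (intro nn_integral_cong) (simp add: sp)
  also have "\<dots> = (\<integral>\<^sup>+x\<in>B. emeasure (K x) (space SX) \<partial>\<mu>)"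
    using bal B by (simp add: detailed_balance_def)
  also have "\<dots> = (\<integral>\<^sup>+x. indicator B x \<partial>\<mu>)"
  proof (rule nn_integral_cong)
    fix x assume "x \<in> space \<mu>"
    then have x: "x \<in> space SX" by (simp add: sp)
    show "emeasure (K x) (space SX) * indicator B x = indicator B x"
      using prob_space.emeasure_space_1[OF prob_space_kernel_prob[OF K x]]
      by (simp add: space_kernel_prob[OF K x])
  qed
  finally show "(\<integral>\<^sup>+x. emeasure (K x) B \<partial>\<mu>) = emeasure \<mu> B"
    using B \<mu>(1) by simp
qed

lemma x0_space: "x\<^sub>0 \<in> space SX"
proof -
  have "x\<^sub>0 \<in> layer 1"
    unfolding layer_1 by simp
  then show ?thesis
    unfolding space_SX by blast
qed

lemma x0_sets: "{x\<^sub>0} \<in> sets SX"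
  using layer_sets[of 1] unfolding layer_1 by simp

text \<open>Deleting coordinates one at a time leads from layer \<open>k + 1\<close> to the empty vector in \<open>k\<close> steps, and in
  the empty vector the same move stays put.\<close>

lemma strong_atom_x0:
  assumes P: "SX_kernel P"
    and down: "\<And>x B. x \<in> space SX \<Longrightarrow> B \<in> sets SX \<Longrightarrow> drop_last x \<in> B \<Longrightarrow> 0 < emeasure (P x) B"
  shows "strong_atom SX P x\<^sub>0"
proof -
  interpret kernel SX P
    by standard (rule P)
  have reach: "x \<in> layer (Suc k) \<Longrightarrow> 0 < emeasure (kernel_power SX P k x) {x\<^sub>0}" for k x
  proof (induction k arbitrary: x)
    case 0
    then show ?case
      using x0_sets by (simp add: layer_1[unfolded One_nat_def])
  next
    case (Suc k)
    let ?f = "\<lambda>y. emeasure (kernel_power SX P k y) {x\<^sub>0}"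
    \<comment> \<open>one move down leads into the set of states from which \<open>x\<^sub>0\<close> is reached in \<open>k\<close> steps\<close>
    let ?B = "{y \<in> space SX. ?f y \<noteq> 0}"
    have f: "?f \<in> borel_measurable SX"
      using x0_sets by measurable
    have B: "?B \<in> sets SX"
      using f by measurable
    obtain v where v: "x = (Suc (Suc k), v)" "v \<in> space (cube (Suc (Suc k)))"
      using Suc.prems by (auto simp: layer_def)
    have x: "x \<in> space SX"
      using Suc.prems by (auto simp: space_SX)
    have d: "drop_last x \<in> space SX"
      using measurable_space[OF measurable_drop_last x] .
    moreover have "fst (drop_last x) = Suc k"
      by (simp add: v drop_last_def)
    ultimately have "drop_last x \<in> layer (Suc k)"
      by (auto simp: space_SX layer_def)
    from Suc.IH[OF this] have "0 < emeasure (P x) ?B"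
      using d by (intro down x B) simp
    moreover have fx: "?f \<in> borel_measurable (P x)"
      using x f by (rule measurable_K)
    ultimately have "(\<integral>\<^sup>+y. ?f y \<partial>P x) \<noteq> 0"
      using x by (subst nn_integral_0_iff[OF fx]) (simp add: space_K)
    then show ?case
      using emeasure_kernel_power_Suc[OF x x0_sets] by (simp add: zero_less_iff_neq_zero del: kernel_power.simps)
  qed
  show ?thesis
  proof
    show "x\<^sub>0 \<in> space SX" "{x\<^sub>0} \<in> sets SX"
      by (rule x0_space x0_sets)+
    show "\<exists>n. 0 < emeasure (kernel_power SX P n x) {x\<^sub>0}" if x: "x \<in> space SX" for x
    proof -
      obtain k where "k \<ge> 1" "x \<in> layer k"
        using x by (auto simp: space_SX)
      then show ?thesis
        using reach[of x "k - 1"] by auto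
    qed
    show "0 < emeasure (P x\<^sub>0) {x\<^sub>0}"
      using down[OF x0_space x0_sets] by (simp add: drop_last_def x\<^sub>0_def)
  qed
qed

context posterior
begin

text \<open>Only the proposal that deletes the last coordinate is counted; it is made with probability one half.\<close>

lemma down_move:
  assumes x: "x \<in> space SX" and B: "B \<in> sets SX" and d: "drop_last x \<in> B"
  shows "ennreal (alpha_ratio D \<kappa> x (drop_last x) / 2) \<le> emeasure (accept_reject SX (alpha_ratio D \<kappa>) prop1 x) B"
proof -
  let ?f = "\<lambda>y. ennreal (alpha_ratio D \<kappa> x y) * indicator B y"
  have f: "?f \<in> borel_measurable SX"
    using measurable_section(1)[OF measurable_acceptance[OF measurable_alpha_ratio] x] B by simp
  have dx: "drop_last x \<in> space SX"
    using measurable_space[OF measurable_drop_last x] .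
  have "ennreal (alpha_ratio D \<kappa> x (drop_last x) / 2) = ennreal (alpha_ratio D \<kappa> x (drop_last x)) / 2"
    using alpha_ratio_bounds(1)[OF x dx] by (simp add: ennreal_divide_numeral less_imp_le)
  also have "\<dots> = (\<integral>\<^sup>+y. ?f y \<partial>law_down x) / 2"
    using d by (simp add: law_down_eq nn_integral_return[OF dx f])
  also have "\<dots> \<le> (\<integral>\<^sup>+y. ?f y \<partial>prop1 x)"
    using nn_integral_prop1[OF x f] by simp
  also have "\<dots> \<le> emeasure (accept_reject SX (alpha_ratio D \<kappa>) prop1 x) B"
    unfolding emeasure_accept_reject[OF prop1_kernel measurable_alpha_ratio x B] by simp
  finally show ?thesis .
qed

end

theorem mainTheorem2:
  fixes dat :: data
    and \<kappa> :: "nat pmf"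
    and \<Psi>\<^sub>3 \<Psi>\<^sub>5 \<xi> :: "state \<Rightarrow> state \<Rightarrow> real"
    and h\<^sub>3 :: "state \<Rightarrow> real"
    and h\<^sub>5 :: "nat \<Rightarrow> state \<Rightarrow> real"
    and p :: "nat \<Rightarrow> real"
    and \<pi> :: "state measure"
    and \<alpha> :: "state \<Rightarrow> state \<Rightarrow> real"
    and P\<^sub>1 P\<^sub>2 P\<^sub>3 P\<^sub>4 P\<^sub>5 P :: "state \<Rightarrow> state measure"
  assumes data: "set dat \<subseteq> {0..1} \<times> {0, 1}"
    and kappa: "set_pmf \<kappa> = {1..}"
    and Psi3: "sym_weight \<Psi>\<^sub>3" "\<And>x. x \<in> space SX \<Longrightarrow> unit_mass \<Psi>\<^sub>3 h\<^sub>3 law_any x"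
    and xi: "case_prod \<xi> \<in> borel_measurable (SX \<Otimes>\<^sub>M SX)"
      "\<And>x y. x \<in> space SX \<Longrightarrow> y \<in> space SX \<Longrightarrow> \<xi> x y \<ge> 0"
      "\<And>x. x \<in> space SX \<Longrightarrow> (\<integral>\<^sup>+y. ennreal (\<xi> x y) \<partial>tau) = 1"
    and Psi5: "sym_weight \<Psi>\<^sub>5"
      "\<And>x i. x \<in> space SX \<Longrightarrow> i \<in> {1..<fst x} \<Longrightarrow> unit_mass \<Psi>\<^sub>5 (h\<^sub>5 i) (law_coord i) x"
    \<comment> \<open>Not a hypothesis of the source. Detailed balance is false without it, because a composition of
      reversible kernels need not be reversible. It holds when, for moves of a single coordinate,
      \<open>\<Psi>\<^sub>5\<close> depends only on the old and new values of that coordinate, as in the Gaussian example.\<close>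
    and sweep: "AE x in tau. prop5 \<Psi>\<^sub>5 h\<^sub>5 x = prop5_reversed \<Psi>\<^sub>5 h\<^sub>5 x"
    and p: "\<And>j. j \<in> {1..5} \<Longrightarrow> p j > 0" "(\<Sum>j=1..5. p j) = 1"
    and target: "\<pi> = post dat \<kappa>"
    and ratio: "\<alpha> = alpha_ratio dat \<kappa>"
    and P1: "P\<^sub>1 = accept_reject SX \<alpha> prop1"
    and P2: "P\<^sub>2 = accept_reject SX \<alpha> law_any"
    and P3: "P\<^sub>3 = accept_reject SX \<alpha> (weighted \<Psi>\<^sub>3 h\<^sub>3 law_any)"
    and P4: "P\<^sub>4 = accept_reject SX (alpha4 dat \<kappa> \<xi>) (prop4 \<xi>)"
    and P5: "P\<^sub>5 = accept_reject SX \<alpha> (prop5 \<Psi>\<^sub>5 h\<^sub>5)"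
    and P: "P = (\<lambda>x. mixture SX [(ennreal (p 1), P\<^sub>1 x), (ennreal (p 2), P\<^sub>2 x),
                   (ennreal (p 3), P\<^sub>3 x), (ennreal (p 4), P\<^sub>4 x), (ennreal (p 5), P\<^sub>5 x)])"
  shows "detailed_balance SX P \<pi>
    \<and> ADS_conditions SX P \<pi>
    \<and> (\<forall>\<nu>. invariant_distribution SX P \<nu> \<longleftrightarrow> \<nu> = \<pi>)
    \<and> (\<exists>D\<in>sets SX. emeasure \<pi> D = 1 \<and> (\<forall>x\<in>D.
         (\<lambda>n. SUP C\<in>sets SX. \<bar>measure (kernel_power SX P n x) C - measure \<pi> C\<bar>) \<longlonglongrightarrow> 0))
    \<and> (\<forall>f. f \<in> borel_measurable SX \<and> (\<integral>\<^sup>+y. ennreal \<bar>f y\<bar> \<partial>\<pi>) < \<infinity> \<longrightarrow>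
         (AE x in \<pi>. \<P>(\<omega> in chain_law SX P x.
            (\<lambda>n. (\<Sum>j=1..n. f (\<omega> j)) / real n) \<longlonglongrightarrow> (LINT y|\<pi>. f y)) = 1))"
proof -
  interpret posterior_independent dat \<kappa> \<xi>
    using data kappa xi by unfold_locales
  interpret sweep \<Psi>\<^sub>5 h\<^sub>5
    using Psi5 by unfold_locales
  have any: "reverses tau law_any law_any"
    by (intro reverses_tau_by_layer law_any_kernel reverses_law_any)
  have mass3: "(\<integral>\<^sup>+y. ennreal (\<Psi>\<^sub>3 x y) \<partial>law_any x) + ennreal (h\<^sub>3 x) = 1" if "x \<in> space SX" for x
    using Psi3(2) law_any_keeps_layer that by (intro unit_mass_total law_any_kernel)
  have "SX_kernel (\<lambda>x. if x \<in> space SX then weighted \<Psi>\<^sub>3 h\<^sub>3 law_any x else return SX x)"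
    using mass3 by (intro weighted_kernel law_any_kernel Psi3(1)) auto
  then have prop3: "SX_kernel (weighted \<Psi>\<^sub>3 h\<^sub>3 law_any)"
    by (simp cong: measurable_cong)
  have rev3: "reverses tau (weighted \<Psi>\<^sub>3 h\<^sub>3 law_any) (weighted \<Psi>\<^sub>3 h\<^sub>3 law_any)"
    using mass3 by (intro reverses_weighted law_any_kernel Psi3(1) any AE_I2) simp_all
  have rev5: "reverses tau (prop5 \<Psi>\<^sub>5 h\<^sub>5) (prop5 \<Psi>\<^sub>5 h\<^sub>5)"
    using sweep by (intro reverses_cong_AE[OF reverses_prop5]) auto
  let ?cs = "[(ennreal (p 1), P\<^sub>1), (ennreal (p 2), P\<^sub>2), (ennreal (p 3), P\<^sub>3), (ennreal (p 4), P\<^sub>4), (ennreal (p 5), P\<^sub>5)]"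
  have P_eq: "P = (\<lambda>x. mixture SX (map (\<lambda>(c, K). (c, K x)) ?cs))"
    by (simp add: P)
  have kernels: "SX_kernel P\<^sub>1" "SX_kernel P\<^sub>2" "SX_kernel P\<^sub>3" "SX_kernel P\<^sub>4" "SX_kernel P\<^sub>5"
    unfolding P1 P2 P3 P4 P5 ratio
    by (intro ratio_kernel prop1_kernel law_any_kernel prop3 prop5_kernel accept_reject_kernel prop4_kernel
        measurable_alpha4; simp add: alpha4_def)+
  have balances: "detailed_balance SX P\<^sub>1 \<pi>" "detailed_balance SX P\<^sub>2 \<pi>" "detailed_balance SX P\<^sub>3 \<pi>"
    "detailed_balance SX P\<^sub>4 \<pi>" "detailed_balance SX P\<^sub>5 \<pi>"
    unfolding P1 P2 P3 P4 P5 ratio target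
    by (rule detailed_balance_ratio[OF prop1_kernel reverses_prop1] detailed_balance_ratio[OF law_any_kernel any]
        detailed_balance_ratio[OF prop3 rev3] detailed_balance_prop4 detailed_balance_ratio[OF prop5_kernel rev5])+
  have cs_kernels: "SX_kernel K" if "(c, K) \<in> set ?cs" for c K
    using that kernels by auto
  have weights: "(\<Sum>(c, K)\<leftarrow>?cs. c) = 1"
  proof -
    have nonneg: "0 \<le> p j" if "j \<in> {1..5}" for j
      using p(1)[OF that] by simp
    have "{1..5::nat} = {1, 2, 3, 4, 5}"
      by auto
    with p(2) have "p 1 + (p 2 + (p 3 + (p 4 + p 5))) = 1"
      by (simp add: ac_simps)
    moreover have "(\<Sum>(c, K)\<leftarrow>?cs. c) = ennreal (p 1 + (p 2 + (p 3 + (p 4 + p 5))))"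
      using nonneg[of 1] nonneg[of 2] nonneg[of 3] nonneg[of 4] nonneg[of 5] by simp
    ultimately show ?thesis
      by (simp only: ennreal_1)
  qed
  have P_kernel: "SX_kernel P"
    unfolding P_eq using cs_kernels weights by (rule mixture_kernel)
  have balance: "detailed_balance SX P \<pi>"
    unfolding P_eq using balances by (intro detailed_balance_mixture cs_kernels) (auto simp: target)
  have inv: "invariant_distribution SX P \<pi>"
    using P_kernel balance prob_space_post by (intro invariant_of_detailed_balance) (simp_all add: target)
  have p1: "0 < p 1"
    using p(1)[of 1] by simp
  have down: "ennreal (p 1 * (alpha_ratio dat \<kappa> x (drop_last x) / 2)) \<le> emeasure (P x) B"
    if x: "x \<in> space SX" and B: "B \<in> sets SX" and d: "drop_last x \<in> B" for x B
  proof -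
    have "ennreal (p 1 * (alpha_ratio dat \<kappa> x (drop_last x) / 2)) = ennreal (p 1) * ennreal (alpha_ratio dat \<kappa> x (drop_last x) / 2)"
      using p1 alpha_ratio_bounds(1)[OF x measurable_space[OF measurable_drop_last x]]
      by (intro ennreal_mult) simp_all
    also have "\<dots> \<le> ennreal (p 1) * emeasure (P\<^sub>1 x) B"
      unfolding P1 ratio using down_move[OF that] by (rule mult_left_mono) simp
    also have "\<dots> \<le> emeasure (P x) B"
      unfolding P_eq using cs_kernels x B by (rule emeasure_mixture_ge)
    finally show ?thesis .
  qed
  have sa: "strong_atom SX P x\<^sub>0"
  proof (rule strong_atom_x0[OF P_kernel])
    fix x B assume xB: "x \<in> space SX" "B \<in> sets SX" "drop_last x \<in> B"
    have "0 < p 1 * (alpha_ratio dat \<kappa> x (drop_last x) / 2)"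
      using p1 alpha_ratio_bounds(1)[OF xB(1) measurable_space[OF measurable_drop_last xB(1)]] by simp
    then show "0 < emeasure (P x) B"
      using down[OF xB] by (simp add: less_le_trans[OF _ down[OF xB]])
  qed
  have sk: "stationary_kernel SX P \<pi>"
    using P_kernel inv by unfold_locales
  interpret chain: stationary_strong_atom SX P \<pi> x\<^sub>0
    using sa sk by (intro stationary_strong_atom.intro)
  have ads: "ADS_conditions SX P \<pi>"
  proof (rule chain.ADS_conditions_atom)
    show "0 < p 1 / 2" using p1 by simp
    have "drop_last x\<^sub>0 = x\<^sub>0"
      by (simp add: drop_last_def x\<^sub>0_def)
    moreover have "alpha_ratio dat \<kappa> x\<^sub>0 x\<^sub>0 = 1"
      using phi_pos[OF x0_space] by (simp add: alpha_ratio_def)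
    ultimately show "ennreal (p 1 / 2) \<le> emeasure (P x\<^sub>0) {x\<^sub>0}"
      using down[OF x0_space x0_sets] by simp
  qed
  have unique: "invariant_distribution SX P \<nu> \<longleftrightarrow> \<nu> = \<pi>" for \<nu>
  proof
    show "\<nu> = \<pi>" if "invariant_distribution SX P \<nu>"
      using that by (rule chain.invariant_distribution_unique)
    show "invariant_distribution SX P \<nu>" if "\<nu> = \<pi>"
      unfolding that by (rule inv)
  qed
  have tv: "\<exists>D\<in>sets SX. emeasure \<pi> D = 1 \<and> (\<forall>x\<in>D.
      (\<lambda>n. SUP C\<in>sets SX. \<bar>measure (kernel_power SX P n x) C - measure \<pi> C\<bar>) \<longlonglongrightarrow> 0)"
  proof -
    obtain N where N: "{x \<in> space \<pi>. \<not> (\<lambda>n. chain.tv_dist n x) \<longlonglongrightarrow> 0} \<subseteq> N" "emeasure \<pi> N = 0" "N \<in> sets \<pi>"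
      using chain.AE_tv_dist_tendsto_0 by (rule AE_E)
    have "emeasure \<pi> (space \<pi> - N) = 1"
      using N chain.\<mu>.emeasure_space_1 by (subst emeasure_Diff) (auto dest: sets.sets_into_space)
    moreover have "space \<pi> - N \<in> sets SX"
      using N(3) by (simp add: sets.Diff)
    moreover have "(\<lambda>n. chain.tv_dist n x) \<longlonglongrightarrow> 0" if "x \<in> space \<pi> - N" for x
      using that N(1) by blast
    ultimately show ?thesis
      unfolding chain.tv_dist_def by (intro bexI[of _ "space \<pi> - N"]) auto
  qed
  have lln: "AE x in \<pi>. \<P>(\<omega> in chain_law SX P x.
      (\<lambda>n. (\<Sum>j=1..n. f (\<omega> j)) / real n) \<longlonglongrightarrow> (LINT y|\<pi>. f y)) = 1"
    if f: "f \<in> borel_measurable SX" and fin: "(\<integral>\<^sup>+y. ennreal \<bar>f y\<bar> \<partial>\<pi>) < \<infinity>" for f :: "state \<Rightarrow> real"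
  proof (rule chain.law_of_large_numbers[OF f])
    show "integrable \<pi> f"
      using f fin by (intro integrableI_bounded) (simp_all add: measurable_cong_sets[OF chain.sets_stationary refl])
  qed
  show ?thesis
    using balance ads unique tv lln by blast
qed

end
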